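(* Let $\Sigma=\{\alpha_1,\alpha_2,\dots\}$ be an infinite countable alphabet, $\upsilon\notin\Sigma$ a variable, $\vec k=(k_n)_{n\in\mathbb N}\subseteq\mathbb N$ an increasing sequence, $\mathcal F\subseteq L^{<\infty}(\Sigma,\vec k;\upsilon)$ a tree and $\vec w\in L^\infty(\Sigma,\vec k;\upsilon)$. Case 1: if $\mathcal F_h\cap EV^{<\infty}(\vec w)$ is not pointwise closed, then there exists $\vec u\prec\vec w$ with $EV^{<\infty}(\vec u)\subseteq\mathcal F$. Case 2: if $\mathcal F_h\cap EV^{<\infty}(\vec w)$ is pointwise closed, then $\zeta=\sup\{sO_{\vec u}(\mathcal F_h):\vec u\prec\vec w\}$ is a countable ordinal, and for every countable ordinal $\xi$: (i) if $\xi+1<\zeta$, there exists $\vec u\prec\vec w$ with $L^\xi(\Sigma,\vec k;\upsilon)\cap EV^{<\infty}(\vec u)\subseteq\mathcal F$; (ii) if $\xi>\zeta$, then for every $\vec w_1\prec\vec w$ there exists $\vec u\prec\vec w_1$ with $L^\xi(\Sigma,\vec k;\upsilon)\cap EV^{<\infty}(\vec u)\subseteq L^{<\infty}(\Sigma,\vec k;\upsilon)\setminus\mathcal F$ (equivalently $\mathcal F\cap EV^{<\infty}(\vec u)\subseteq(L^\xi(\Sigma,\vec k;\upsilon))^*\setminus L^\xi(\Sigma,\vec k;\upsilon)$); (iii) if $\xi+1=\zeta$ or $\xi=\zeta$, there exists $\vec u\prec\vec w$ such that either $L^\xi(\Sigma,\vec k;\upsilon)\cap EV^{<\infty}(\vec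 u)\subseteq\mathcal F$ or $L^\xi(\Sigma,\vec k;\upsilon)\cap EV^{<\infty}(\vec u)\subseteq L^{<\infty}(\Sigma,\vec k;\upsilon)\setminus\mathcal F$.
   Context: $\mathbb N=\{1,2,\dots\}$. $L(\Sigma,\vec k;\upsilon)$: functions $w$ from a nonempty finite $\mathrm{dom}(w)\subseteq\mathbb N$ into $\Sigma\cup\{\upsilon\}$ with $w(n)\in\{\upsilon,\alpha_1,\dots,\alpha_{k_n}\}$ and $\upsilon$ attained. $w<u$ iff $\max\mathrm{dom}(w)<\min\mathrm{dom}(u)$; then $w\star u$ is the word on $\mathrm{dom}(w)\cup\mathrm{dom}(u)$ agreeing with $w,u$. $T_0(w)=w$; for $p\in\mathbb N$, $T_p(w)$ replaces each $\upsilon$ at position $n$ by $\alpha_{\min(p,k_n)}$. $L^\infty(\Sigma,\vec k;\upsilon)$: sequences $(w_n)$ with $w_n<w_{n+1}$. For $\vec w\in L^\infty$, $EV(\vec w)$: words $T_{p_1}(w_{n_1})\star\cdots\star T_{p_\lambda}(w_{n_\lambda})$ with $n_1<\dots<n_\lambda$, integers $0\le p_i\le k_{n_i}$, some $p_i=0$; for a finite tuple $\mathbf w=(w_1,\dots,w_l)$, $EV(\mathbf w)$ is defined the same way with $n_\lambda\le l$. $\vec u\prec\vec w$ iff $\vec u\in L^\infty$ with all terms in $EV(\vec w)$. $L^{<\infty}(\Sigma,\vec k;\upsilon)$: $\emptyset$ and all tuples $(w_1,\dots,w_l)$ with $w_1<\dots<w_l$; $EV^{<\infty}(\vec w)$ (resp.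 $EV^{<\infty}(\mathbf w)$): $\emptyset$ and tuples with all terms in $EV(\vec w)$ (resp. $EV(\mathbf w)$). $\mathbf w\propto\mathbf u$: $\mathbf w$ is an initial segment of $\mathbf u$. For $\mathcal F\subseteq L^{<\infty}$: $\mathcal F^*=\{\mathbf w:\mathbf w\propto\mathbf u\text{ for some }\mathbf u\in\mathcal F\}\cup\{\emptyset\}$; $\mathcal F$ is a tree if $\mathcal F^*=\mathcal F$; $\mathcal F_*=\{\mathbf w:\mathbf w\in EV^{<\infty}(\mathbf u)\text{ for some }\mathbf u\in\mathcal F\}\cup\{\emptyset\}$; $\mathcal F$ is hereditary if $\mathcal F_*=\mathcal F$; $\mathcal F_h=\{\mathbf w\in\mathcal F:EV^{<\infty}(\mathbf w)\subseteq\mathcal F\}\cup\{\emptyset\}$. Pointwise closed: let $D=\{(n,a):n\in\mathbb N,\ a\in\{\upsilon,\alpha_1,\dots,\alpha_{k_n}\}\}$, identify each word with its graph (a finite subset of $D$) and each $\mathbf s=(s_1,\dots,s_k)$ with $\sigma(\mathbf s)=\{s_1,\dots,s_k\}\subseteq[D]^{<\omega}$; $\mathcal F$ is pointwise closed if $\{\chi_{\sigma(\mathbf s)}:\mathbf s\in\mathcal F\}$ is closed in $\{0,1\}^{[D]^{<\omega}}$ (product topology). Strong Cantor–Bendixson index: for a family $\mathcal F$ and $\vec s\in L^\infty$, for $\mathbf w=(w_1,\dots,w_l)\in\mathcal F\cap EV^{<\infty}(\vec s)$ put $A_{\mathbf w}=\{t\in EV(\vec s):(w_1,\dots,w_l,t)\notin\mathcal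 F\}$, $A_\emptyset=\{t\in EV(\vec s):(t)\notin\mathcal F\}$; $(\mathcal F)^1_{\vec s}$ is the set of $\mathbf w\in(\mathcal F\cap EV^{<\infty}(\vec s))\cup\{\emptyset\}$ such that $A_{\mathbf w}$ contains no sequence $t_1<t_2<\cdots$; $(\mathcal F)^{\zeta+1}_{\vec s}=((\mathcal F)^\zeta_{\vec s})^1_{\vec s}$ and $(\mathcal F)^\xi_{\vec s}=\bigcap_{1\le\beta<\xi}(\mathcal F)^\beta_{\vec s}$ for limit $\xi$; $sO_{\vec s}(\mathcal F)$ is the least countable $\xi$ with $(\mathcal F)^\xi_{\vec s}=\emptyset$. Schreier families $\mathcal A_\xi$: fixing for each nonzero countable limit $\lambda$ an increasing sequence of successor ordinals $\lambda_n\uparrow\lambda$, and with $s_1<s_2$ meaning $\max s_1<\min s_2$: $\mathcal A_0=\{\emptyset\}$, $\mathcal A_1=\{\{n\}\}$, $\mathcal A_{\zeta+1}=\{\{n\}\cup s_1:\{n\}<s_1\in\mathcal A_\zeta\}$, $\mathcal A_{\omega^{\beta+1}}=\{s_1\cup\dots\cup s_n:n=\min s_1,\ s_1<\dots<s_n\in\mathcal A_{\omega^\beta}\}$, $\mathcal A_{\omega^\lambda}=\{s\neq\emptyset:s\in\mathcal A_{\omega^{\lambda_{\min s}}}\}$ for limit $\lambda$, and for limit $\xi=\omega^\alpha p+\sum_{i=1}^m\omega^{a_i}p_i$ with $\omega^\alpha<\xi<\omega^{\alpha+1}$, $\alpha>a_1>\dots>a_m>0$: $s_0\cup\bigcup_i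 s_i$ with $s_m<\dots<s_1<s_0$, $s_0$ a union of $p$ successive sets in $\mathcal A_{\omega^\alpha}$, $s_i$ a union of $p_i$ successive sets in $\mathcal A_{\omega^{a_i}}$. $L^0=\{\emptyset\}$; for $\xi\ge1$, $L^\xi(\Sigma,\vec k;\upsilon)=\{(w_1,\dots,w_l)\in L^{<\infty}:\{\min\mathrm{dom}(w_i)\}_{i\le l}\in\mathcal A_\xi\}$. *)

theory Defs
  imports "HOL-Analysis.Analysis" "HOL-Library.Sublist"
begin

section \<open>Countable ordinals\<close>

text \<open>The type of all countable ordinals: the elements of the initial well-order of
  cardinality \<open>\<aleph>\<^sub>1\<close>. The order type of the predecessors of an element is the ordinal it denotes;
  the lemmas \<open>countable_lessThan_omega1\<close> and \<open>uncountable_UNIV_omega1\<close> below characterise the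
  type up to order isomorphism.\<close>

typedef omega1 = "Field (cardSuc natLeq)"
proof -
  have "\<not> finite (Field (cardSuc natLeq))"
    using cardSuc_finite[OF natLeq_Card_order] by (simp add: Field_natLeq)
  then show ?thesis by (metis all_not_in_conv finite.emptyI)
qed

lemma wo_omega1: "wo_rel (cardSuc natLeq)"
  using cardSuc_Card_order[OF natLeq_Card_order] unfolding card_order_on_def wo_rel_def by blast

instantiation omega1 :: linorder
begin

definition less_eq_omega1 :: "omega1 \<Rightarrow> omega1 \<Rightarrow> bool" where
  "a \<le> b \<longleftrightarrow> (Rep_omega1 a, Rep_omega1 b) \<in> cardSuc natLeq"

definition less_omega1 :: "omega1 \<Rightarrow> omega1 \<Rightarrow> bool" where
  "a < b \<longleftrightarrow> a \<le> b \<and> \<not> b \<le> (a::omega1)"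

instance
proof
  fix x y z :: omega1
  show "x < y \<longleftrightarrow> x \<le> y \<and> \<not> y \<le> x" by (rule less_omega1_def)
  show "x \<le> x" unfolding less_eq_omega1_def
    using wo_rel.REFL[OF wo_omega1] Rep_omega1 by (auto simp: refl_on_def)
  show "x \<le> z" if "x \<le> y" "y \<le> z" using that unfolding less_eq_omega1_def
    using wo_rel.TRANS[OF wo_omega1] by (meson transD)
  show "x = y" if "x \<le> y" "y \<le> x" using that unfolding less_eq_omega1_def
    using wo_rel.ANTISYM[OF wo_omega1] by (metis Rep_omega1_inject antisymD)
  show "x \<le> y \<or> y \<le> x" unfolding less_eq_omega1_def
    using wo_rel.TOTALS[OF wo_omega1] Rep_omega1 by blast
qed

end

lemma less_omega1_iff:
  "a < b \<longleftrightarrow> (Rep_omega1 a, Rep_omega1 b) \<in> cardSuc natLeq - Id" for a b :: omega1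
proof -
  have "a < b \<longleftrightarrow> a \<le> b \<and> a \<noteq> b" by (rule less_le)
  then show ?thesis by (simp add: less_eq_omega1_def Rep_omega1_inject)
qed

instance omega1 :: wellorder
proof
  fix P and a :: omega1
  assume step: "\<And>x::omega1. (\<And>y. y < x \<Longrightarrow> P y) \<Longrightarrow> P x"
  have "wf (inv_image (cardSuc natLeq - Id) Rep_omega1)"
    using wo_rel.WF[OF wo_omega1] by (rule wf_inv_image)
  then show "P a"
  proof (induction a rule: wf_induct_rule)
    case (less x)
    then show ?case using step by (simp add: less_omega1_iff in_inv_image)
  qed
qed

instantiation omega1 :: conditionally_complete_linorder
begin

definition inf_omega1 :: "omega1 \<Rightarrow> omega1 \<Rightarrow> omega1" where "inf_omega1 = min"
definition sup_omega1 :: "omega1 \<Rightarrow> omega1 \<Rightarrow> omega1" where "sup_omega1 = max"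
definition Inf_omega1 :: "omega1 set \<Rightarrow> omega1" where "Inf_omega1 A = (LEAST a. a \<in> A)"
definition Sup_omega1 :: "omega1 set \<Rightarrow> omega1" where "Sup_omega1 A = (LEAST b. \<forall>a\<in>A. a \<le> b)"

instance
proof
  fix x y z :: omega1 and X :: "omega1 set"
  show "inf x y \<le> x" "inf x y \<le> y" "x \<le> sup x y" "y \<le> sup x y"
    by (simp_all add: inf_omega1_def sup_omega1_def)
  show "x \<le> inf y z" if "x \<le> y" "x \<le> z" using that by (simp add: inf_omega1_def)
  show "sup y z \<le> x" if "y \<le> x" "z \<le> x" using that by (simp add: sup_omega1_def)
  show "Inf X \<le> x" if "x \<in> X" using that by (simp add: Inf_omega1_def Least_le)
  show "z \<le> Inf X" if "X \<noteq> {}" "\<And>x. x \<in> X \<Longrightarrow> z \<le> x"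
    using that by (metis Inf_omega1_def LeastI ex_in_conv)
  show "x \<le> Sup X" if "x \<in> X" "bdd_above X"
  proof -
    obtain b where "\<forall>a\<in>X. a \<le> b" using \<open>bdd_above X\<close> unfolding bdd_above_def by blast
    then have "\<forall>a\<in>X. a \<le> Sup X" unfolding Sup_omega1_def by (rule LeastI)
    then show ?thesis using that by blast
  qed
  show "Sup X \<le> z" if "X \<noteq> {}" "\<And>x. x \<in> X \<Longrightarrow> x \<le> z"
    using that by (simp add: Sup_omega1_def Least_le)
qed

end

lemma countable_lessThan_omega1: "countable {..<a::omega1}"
proof -
  let ?r = "cardSuc natLeq"
  have "(card_of (underS ?r (Rep_omega1 a)), ?r) \<in> ordLess"
    by (rule card_of_underS[OF cardSuc_Card_order[OF natLeq_Card_order] Rep_omega1])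
  then have "(card_of (underS ?r (Rep_omega1 a)), natLeq) \<in> ordLeq"
    by (simp add: cardSuc_ordLeq_ordLess natLeq_Card_order card_of_Card_order)
  then have "(card_of (underS ?r (Rep_omega1 a)), card_of (UNIV::nat set)) \<in> ordLeq"
    using card_of_nat ordIso_symmetric ordLeq_ordIso_trans by blast
  then have "countable (underS ?r (Rep_omega1 a))"
    unfolding countable_def card_of_ordLeq[symmetric] by blast
  moreover have "Rep_omega1 ` {..<a} \<subseteq> underS ?r (Rep_omega1 a)"
    by (auto simp: underS_def less_omega1_iff)
  ultimately have "countable (Rep_omega1 ` {..<a})" by (rule countable_subset[rotated])
  then show ?thesis
    by (rule countable_image_inj_on) (simp add: inj_on_def Rep_omega1_inject)
qed

lemma uncountable_UNIV_omega1: "uncountable (UNIV :: omega1 set)"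
proof
  let ?r = "cardSuc natLeq"
  assume "countable (UNIV :: omega1 set)"
  then have "countable (Field ?r)"
    by (metis countable_image type_definition.Rep_range[OF type_definition_omega1])
  then have "(card_of (Field ?r), card_of (UNIV::nat set)) \<in> ordLeq"
    unfolding countable_def card_of_ordLeq[symmetric] by blast
  then have "(?r, natLeq) \<in> ordLeq"
    using card_of_Field_ordIso[OF cardSuc_Card_order[OF natLeq_Card_order]] card_of_nat
      ordIso_symmetric ordIso_ordLeq_trans ordLeq_ordIso_trans by blast
  moreover have "(natLeq, ?r) \<in> ordLess" by (rule cardSuc_greater[OF natLeq_Card_order])
  ultimately show False using not_ordLess_ordLeq by blast
qed

lemma bdd_above_countable_omega1:
  assumes "countable (A :: omega1 set)" shows "bdd_above A"
proof (rule ccontr)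
  assume "\<not> bdd_above A"
  then have "\<exists>a\<in>A. b < a" for b unfolding bdd_above_def by (meson not_le)
  then have "(UNIV :: omega1 set) = (\<Union>a\<in>A. {..<a})" by blast
  moreover have "countable (\<Union>a\<in>A. {..<a})"
    using assms countable_lessThan_omega1 by blast
  ultimately show False using uncountable_UNIV_omega1 by simp
qed

definition osucc :: "omega1 \<Rightarrow> omega1" where "osucc a = (LEAST b. a < b)"

lemma less_osucc: "a < osucc a"
proof -
  have "\<exists>b. a < b"
  proof (rule ccontr)
    assume "\<nexists>b. a < b"
    then have "UNIV = insert a {..<a}" by (auto simp: not_less order_le_less)
    then show False using uncountable_UNIV_omega1 countable_lessThan_omega1
      by (metis countable_insert)
  qed
  then show ?thesis unfolding osucc_def by (rule LeastI_ex)
qed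

instantiation omega1 :: "{zero, one}"
begin
definition zero_omega1 :: omega1 where "0 = (LEAST a::omega1. True)"
definition one_omega1 :: omega1 where "1 = osucc 0"
instance ..
end

definition is_succ :: "omega1 \<Rightarrow> bool" where "is_succ a \<longleftrightarrow> (\<exists>b. a = osucc b)"

definition opred :: "omega1 \<Rightarrow> omega1" where "opred a = (LEAST b. a = osucc b)"

text \<open>Limit ordinals are nonzero by convention.\<close>

definition is_limit :: "omega1 \<Rightarrow> bool" where "is_limit a \<longleftrightarrow> a \<noteq> 0 \<and> \<not> is_succ a"

lemma osucc_inject: "osucc a = osucc b \<longleftrightarrow> a = b"
proof -
  have "osucc x \<noteq> osucc y" if "x < y" for x y
  proof -
    have "osucc x \<le> y" unfolding osucc_def using that by (rule Least_le)
    then show ?thesis using less_osucc[of y] by auto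
  qed
  then show ?thesis by (metis linorder_neqE)
qed

lemma opred_osucc: "opred (osucc a) = a"
  unfolding opred_def osucc_inject by (simp add: Least_equality)

lemma opred_less: "a \<noteq> 0 \<Longrightarrow> \<not> is_limit a \<Longrightarrow> opred a < a"
  unfolding is_limit_def is_succ_def opred_def by (metis (mono_tags, lifting) LeastI less_osucc)

function oadd :: "omega1 \<Rightarrow> omega1 \<Rightarrow> omega1" where
  "oadd a b = (if b = 0 then a
     else if is_limit b then (SUP c\<in>{..<b}. oadd a c)
     else osucc (oadd a (opred b)))"
  by auto
termination
  by (relation "inv_image {(x, y). x < y} snd") (auto simp: opred_less wf)

primrec omult_nat :: "omega1 \<Rightarrow> nat \<Rightarrow> omega1" where
  "omult_nat a 0 = 0"
| "omult_nat a (Suc n) = oadd (omult_nat a n) a"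

text \<open>\<open>omega_pow a\<close> is \<open>\<omega>\<^sup>a\<close>.\<close>

function omega_pow :: "omega1 \<Rightarrow> omega1" where
  "omega_pow a = (if a = 0 then 1
     else if is_limit a then (SUP c\<in>{..<a}. omega_pow c)
     else (SUP n::nat. omult_nat (omega_pow (opred a)) n))"
  by auto
termination
  by (relation "{(x, y). x < y}") (auto simp: opred_less wf)

declare oadd.simps [simp del] omega_pow.simps [simp del]

section \<open>Schreier families\<close>

definition fundamental_sequences :: "(omega1 \<Rightarrow> nat \<Rightarrow> omega1) \<Rightarrow> bool" where
  "fundamental_sequences fs \<longleftrightarrow> (\<forall>l. is_limit l \<longrightarrow>
     (\<forall>n\<ge>1. is_succ (fs l n)) \<and> strict_mono_on {1..} (fs l) \<and> (SUP n\<in>{1..}. fs l n) = l)"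

definition set_less :: "nat set \<Rightarrow> nat set \<Rightarrow> bool" where
  "set_less s t \<longleftrightarrow> Max s < Min t"

definition succ_union :: "(nat set \<Rightarrow> bool) \<Rightarrow> nat \<Rightarrow> nat set \<Rightarrow> bool" where
  "succ_union P p s \<longleftrightarrow>
     (\<exists>ts. length ts = p \<and> sorted_wrt set_less ts \<and> (\<forall>t\<in>set ts. P t) \<and> s = \<Union> (set ts))"

lemma succ_union_mono [mono]: "P \<le> Q \<Longrightarrow> succ_union P p s \<longrightarrow> succ_union Q p s"
  unfolding succ_union_def by blast

text \<open>In the last rule \<open>cs = [(\<alpha>, p), (a\<^sub>1, p\<^sub>1), \<dots>, (a\<^sub>m, p\<^sub>m)]\<close>, where \<open>m = 0\<close> is allowed, lists the
  Cantor normal form of \<open>\<xi>\<close>, and \<open>ss = [s\<^sub>0, s\<^sub>1, \<dots>, s\<^sub>m]\<close>. In the rule \<open>omega_succ\<close> the number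
  of sets is \<open>min s\<^sub>1 = min s\<close>.\<close>

inductive schreier_mem :: "(omega1 \<Rightarrow> nat \<Rightarrow> omega1) \<Rightarrow> omega1 \<Rightarrow> nat set \<Rightarrow> bool"
  for fs where
  zero: "schreier_mem fs 0 {}"
| one: "n \<ge> 1 \<Longrightarrow> schreier_mem fs 1 {n}"
| succ: "z \<noteq> 0 \<Longrightarrow> schreier_mem fs z s \<Longrightarrow> n \<ge> 1 \<Longrightarrow> set_less {n} s \<Longrightarrow>
    schreier_mem fs (osucc z) ({n} \<union> s)"
| omega_succ: "s \<noteq> {} \<Longrightarrow> succ_union (schreier_mem fs (omega_pow b)) (Min s) s \<Longrightarrow>
    schreier_mem fs (omega_pow (osucc b)) s"
| omega_limit: "is_limit l \<Longrightarrow> s \<noteq> {} \<Longrightarrow> schreier_mem fs (omega_pow (fs l (Min s))) s \<Longrightarrow>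
    schreier_mem fs (omega_pow l) s"
| cantor: "is_limit x \<Longrightarrow> cs = (a, p) # cs' \<Longrightarrow> omega_pow a < x \<Longrightarrow> x < omega_pow (osucc a) \<Longrightarrow>
    sorted_wrt (>) (map fst cs) \<Longrightarrow> (\<forall>(b, q)\<in>set cs. b > 0 \<and> q \<ge> 1) \<Longrightarrow>
    x = foldr (\<lambda>(b, q) y. oadd (omult_nat (omega_pow b) q) y) cs 0 \<Longrightarrow>
    length ss = length cs \<Longrightarrow>
    (\<forall>i<length cs. succ_union (schreier_mem fs (omega_pow (fst (cs ! i)))) (snd (cs ! i)) (ss ! i)) \<Longrightarrow>
    sorted_wrt (\<lambda>s t. set_less t s) ss \<Longrightarrow>
    schreier_mem fs x (\<Union> (set ss))"

definition schreier :: "(omega1 \<Rightarrow> nat \<Rightarrow> omega1) \<Rightarrow> omega1 \<Rightarrow> nat set set" where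
  "schreier fs \<xi> = {s. schreier_mem fs \<xi> s}"

section \<open>Located words\<close>

text \<open>Words are partial functions, so that \<open>w \<star> u\<close> is \<open>w ++ u\<close>. Throughout, \<open>\<alpha>\<close> enumerates the
  alphabet by the indices \<open>1, 2, \<dots>\<close>, \<open>\<upsilon>\<close> is the variable, and \<open>k\<close> and sequences of words are only
  used at indices \<open>\<ge> 1\<close>.\<close>

type_synonym 'a lword = "nat \<rightharpoonup> 'a"

definition located_words :: "(nat \<Rightarrow> 'a) \<Rightarrow> 'a \<Rightarrow> (nat \<Rightarrow> nat) \<Rightarrow> 'a lword set" where
  "located_words \<alpha> \<upsilon> k = {w. dom w \<noteq> {} \<and> finite (dom w) \<and> dom w \<subseteq> {1..} \<and>
     (\<forall>n\<in>dom w. the (w n) \<in> {\<upsilon>} \<union> \<alpha> ` {1..k n}) \<and> \<upsilon> \<in> ran w}"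

definition word_less :: "'a lword \<Rightarrow> 'a lword \<Rightarrow> bool" where
  "word_less w u \<longleftrightarrow> Max (dom w) < Min (dom u)"

definition subst_var :: "(nat \<Rightarrow> 'a) \<Rightarrow> 'a \<Rightarrow> (nat \<Rightarrow> nat) \<Rightarrow> nat \<Rightarrow> 'a lword \<Rightarrow> 'a lword" where
  "subst_var \<alpha> \<upsilon> k p w = (if p = 0 then w
     else (\<lambda>n. if w n = Some \<upsilon> then Some (\<alpha> (min p (k n))) else w n))"

definition L_inf :: "(nat \<Rightarrow> 'a) \<Rightarrow> 'a \<Rightarrow> (nat \<Rightarrow> nat) \<Rightarrow> (nat \<Rightarrow> 'a lword) set" where
  "L_inf \<alpha> \<upsilon> k = {W. \<forall>n\<ge>1. W n \<in> located_words \<alpha> \<upsilon> k \<and> word_less (W n) (W (Suc n))}"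

definition L_fin :: "(nat \<Rightarrow> 'a) \<Rightarrow> 'a \<Rightarrow> (nat \<Rightarrow> nat) \<Rightarrow> 'a lword list set" where
  "L_fin \<alpha> \<upsilon> k = {ws. set ws \<subseteq> located_words \<alpha> \<upsilon> k \<and> sorted_wrt word_less ws}"

text \<open>The words extracted from the terms of \<open>W\<close> with index in \<open>I\<close>; \<open>ps\<close> is the list of the pairs
  \<open>(n\<^sub>i, p\<^sub>i)\<close>.\<close>

definition EV_on :: "(nat \<Rightarrow> 'a) \<Rightarrow> 'a \<Rightarrow> (nat \<Rightarrow> nat) \<Rightarrow> nat set \<Rightarrow> (nat \<Rightarrow> 'a lword) \<Rightarrow> 'a lword set" where
  "EV_on \<alpha> \<upsilon> k I W = {foldr (++) (map (\<lambda>(n, p). subst_var \<alpha> \<upsilon> k p (W n)) ps) Map.empty | ps.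
     sorted_wrt (<) (map fst ps) \<and> (\<forall>(n, p)\<in>set ps. n \<in> I \<and> p \<le> k n) \<and> (\<exists>(n, p)\<in>set ps. p = 0)}"

definition EV :: "(nat \<Rightarrow> 'a) \<Rightarrow> 'a \<Rightarrow> (nat \<Rightarrow> nat) \<Rightarrow> (nat \<Rightarrow> 'a lword) \<Rightarrow> 'a lword set" where
  "EV \<alpha> \<upsilon> k W = EV_on \<alpha> \<upsilon> k {1..} W"

definition EV_tuple :: "(nat \<Rightarrow> 'a) \<Rightarrow> 'a \<Rightarrow> (nat \<Rightarrow> nat) \<Rightarrow> 'a lword list \<Rightarrow> 'a lword set" where
  "EV_tuple \<alpha> \<upsilon> k ws = EV_on \<alpha> \<upsilon> k {1..length ws} (\<lambda>n. ws ! (n - 1))"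

definition EV_fin :: "(nat \<Rightarrow> 'a) \<Rightarrow> 'a \<Rightarrow> (nat \<Rightarrow> nat) \<Rightarrow> (nat \<Rightarrow> 'a lword) \<Rightarrow> 'a lword list set" where
  "EV_fin \<alpha> \<upsilon> k W = {ws \<in> L_fin \<alpha> \<upsilon> k. set ws \<subseteq> EV \<alpha> \<upsilon> k W}"

definition EV_fin_tuple :: "(nat \<Rightarrow> 'a) \<Rightarrow> 'a \<Rightarrow> (nat \<Rightarrow> nat) \<Rightarrow> 'a lword list \<Rightarrow> 'a lword list set" where
  "EV_fin_tuple \<alpha> \<upsilon> k us = {ws \<in> L_fin \<alpha> \<upsilon> k. set ws \<subseteq> EV_tuple \<alpha> \<upsilon> k us}"

text \<open>\<open>word_refines \<alpha> \<upsilon> k U W\<close> is \<open>U \<prec> W\<close>.\<close>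

definition word_refines ::
    "(nat \<Rightarrow> 'a) \<Rightarrow> 'a \<Rightarrow> (nat \<Rightarrow> nat) \<Rightarrow> (nat \<Rightarrow> 'a lword) \<Rightarrow> (nat \<Rightarrow> 'a lword) \<Rightarrow> bool" where
  "word_refines \<alpha> \<upsilon> k U W \<longleftrightarrow> U \<in> L_inf \<alpha> \<upsilon> k \<and> (\<forall>n\<ge>1. U n \<in> EV \<alpha> \<upsilon> k W)"

section \<open>Families of finite sequences of words\<close>

definition initial_segments :: "'a lword list set \<Rightarrow> 'a lword list set" where
  "initial_segments F = {ws. \<exists>us\<in>F. prefix ws us} \<union> {[]}"

definition is_tree :: "'a lword list set \<Rightarrow> bool" where
  "is_tree F \<longleftrightarrow> initial_segments F = F"

definition hered_part ::
    "(nat \<Rightarrow> 'a) \<Rightarrow> 'a \<Rightarrow> (nat \<Rightarrow> nat) \<Rightarrow> 'a lword list set \<Rightarrow> 'a lword list set" where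
  "hered_part \<alpha> \<upsilon> k F = {ws \<in> F. EV_fin_tuple \<alpha> \<upsilon> k ws \<subseteq> F} \<union> {[]}"

text \<open>A word is identified with its graph, a finite subset of \<open>D = letter_graph \<alpha> \<upsilon> k\<close>. Points of the
  product of copies of \<open>{0, 1}\<close> indexed by the finite subsets \<open>Fpow D\<close> are extensional functions,
  hence the restriction of the characteristic functions.\<close>

definition letter_graph :: "(nat \<Rightarrow> 'a) \<Rightarrow> 'a \<Rightarrow> (nat \<Rightarrow> nat) \<Rightarrow> (nat \<times> 'a) set" where
  "letter_graph \<alpha> \<upsilon> k = {(n, a). n \<ge> 1 \<and> a \<in> {\<upsilon>} \<union> \<alpha> ` {1..k n}}"

definition pointwise_closed ::
    "(nat \<Rightarrow> 'a) \<Rightarrow> 'a \<Rightarrow> (nat \<Rightarrow> nat) \<Rightarrow> 'a lword list set \<Rightarrow> bool" where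
  "pointwise_closed \<alpha> \<upsilon> k F \<longleftrightarrow>
     closedin (product_topology (\<lambda>_. discrete_topology {0, 1::nat}) (Fpow (letter_graph \<alpha> \<upsilon> k)))
       ((\<lambda>ws. restrict (indicator (Map.graph ` set ws)) (Fpow (letter_graph \<alpha> \<upsilon> k))) ` F)"

definition L_xi ::
    "(omega1 \<Rightarrow> nat \<Rightarrow> omega1) \<Rightarrow> (nat \<Rightarrow> 'a) \<Rightarrow> 'a \<Rightarrow> (nat \<Rightarrow> nat) \<Rightarrow> omega1 \<Rightarrow> 'a lword list set" where
  "L_xi fs \<alpha> \<upsilon> k \<xi> = (if \<xi> = 0 then {[]}
     else {ws \<in> L_fin \<alpha> \<upsilon> k. (\<lambda>w. Min (dom w)) ` set ws \<in> schreier fs \<xi>})"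

section \<open>The strong Cantor-Bendixson index\<close>

definition bad_extensions ::
    "(nat \<Rightarrow> 'a) \<Rightarrow> 'a \<Rightarrow> (nat \<Rightarrow> nat) \<Rightarrow> (nat \<Rightarrow> 'a lword) \<Rightarrow> 'a lword list set \<Rightarrow>
     'a lword list \<Rightarrow> 'a lword set" where
  "bad_extensions \<alpha> \<upsilon> k S F ws = {t \<in> EV \<alpha> \<upsilon> k S. ws @ [t] \<notin> F}"

definition strong_derivative ::
    "(nat \<Rightarrow> 'a) \<Rightarrow> 'a \<Rightarrow> (nat \<Rightarrow> nat) \<Rightarrow> (nat \<Rightarrow> 'a lword) \<Rightarrow> 'a lword list set \<Rightarrow>
     'a lword list set" where
  "strong_derivative \<alpha> \<upsilon> k S F = {ws \<in> (F \<inter> EV_fin \<alpha> \<upsilon> k S) \<union> {[]}.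
     \<not> (\<exists>t :: nat \<Rightarrow> 'a lword. \<forall>n. t n \<in> bad_extensions \<alpha> \<upsilon> k S F ws \<and> word_less (t n) (t (Suc n)))}"

text \<open>The convention \<open>(F)\<^sup>0 = F\<close> makes \<open>(F)\<^sup>1\<close> an instance of the successor clause.\<close>

function scb_derivative ::
    "(nat \<Rightarrow> 'a) \<Rightarrow> 'a \<Rightarrow> (nat \<Rightarrow> nat) \<Rightarrow> (nat \<Rightarrow> 'a lword) \<Rightarrow> 'a lword list set \<Rightarrow>
     omega1 \<Rightarrow> 'a lword list set" where
  "scb_derivative \<alpha> \<upsilon> k S F \<xi> = (if \<xi> = 0 then F
     else if is_limit \<xi> then (\<Inter>\<beta>\<in>{1..<\<xi>}. scb_derivative \<alpha> \<upsilon> k S F \<beta>)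
     else strong_derivative \<alpha> \<upsilon> k S (scb_derivative \<alpha> \<upsilon> k S F (opred \<xi>)))"
  by auto
termination
  by (relation "inv_image {(x, y). x < y} (\<lambda>(_, _, _, _, _, \<xi>). \<xi>)") (auto simp: opred_less wf)

declare scb_derivative.simps [simp del]

text \<open>\<open>sO\<close> is meaningful only if some derivative is empty, which is what \<open>sO_defined\<close> says.\<close>

definition sO_defined ::
    "(nat \<Rightarrow> 'a) \<Rightarrow> 'a \<Rightarrow> (nat \<Rightarrow> nat) \<Rightarrow> (nat \<Rightarrow> 'a lword) \<Rightarrow> 'a lword list set \<Rightarrow> bool" where
  "sO_defined \<alpha> \<upsilon> k S F \<longleftrightarrow> (\<exists>\<xi>\<ge>1. scb_derivative \<alpha> \<upsilon> k S F \<xi> = {})"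

definition sO ::
    "(nat \<Rightarrow> 'a) \<Rightarrow> 'a \<Rightarrow> (nat \<Rightarrow> nat) \<Rightarrow> (nat \<Rightarrow> 'a lword) \<Rightarrow> 'a lword list set \<Rightarrow> omega1" where
  "sO \<alpha> \<upsilon> k S F = (LEAST \<xi>. \<xi> \<ge> 1 \<and> scb_derivative \<alpha> \<upsilon> k S F \<xi> = {})"

end

theory Submission
  imports Defs
begin

text \<open>Everything rests on two facts. First, for a finite partition of the words extracted from
  \<open>w\<close> some \<open>u \<prec> w\<close> has all its extracted words in one cell: in the semigroup of
  ultrafilters on words take a minimal idempotent \<open>r\<close> of constant words and an idempotent \<open>q\<close> of
  variable words with \<open>q r = r q = q\<close>; minimality forces \<open>T\<^sub>p q = r\<close> for all \<open>p\<close>, and \<open>u\<close> is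
  built inside the cell that belongs to \<open>q\<close>. Second, deleting the least element \<open>n\<close> of a set in
  \<open>\<A>\<^sub>\<xi>\<close> leaves a set in \<open>\<A>\<^bsub>\<xi>(n)\<^esub>\<close> for an ordinal \<open>\<xi>(n) < \<xi>\<close>, and \<open>\<xi>(n) \<longlongrightarrow> \<xi>\<close> when \<open>\<xi>\<close> is a
  limit. Induction on \<open>\<xi>\<close> with a fusion argument then gives, for every family \<open>\<F>\<close>, some
  \<open>u \<prec> w\<close> such that \<open>\<F>\<close> contains either all or none of the members of \<open>L\<^sup>\<xi>\<close> extracted from \<open>u\<close>.

  The index of \<open>\<F>\<^sub>h\<close> decides between the alternatives. If the empty tuple survives \<open>\<xi> + 1\<close>
  derivatives, following surviving extensions along the ordinals \<open>\<xi>(n)\<close> leads to a member of \<open>L\<^sup>\<xi>\<close> in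
  \<open>\<F>\<close>; conversely, if \<open>\<F>\<^sub>h\<close> contains all of \<open>L\<^sup>\<xi>\<close>, the empty tuple survives \<open>\<xi>\<close> derivatives. Pointwise
  closedness of \<open>\<F>\<^sub>h\<close> below \<open>w\<close> means that \<open>\<F>\<^sub>h\<close> has no infinite branch there, and the indices of a
  well-founded countable tree are bounded.\<close>

section \<open>Ordinal arithmetic\<close>

text \<open>The families \<open>\<A>\<^sub>\<xi>\<close> are given by dissimilar cases, so the
  ordinals \<open>\<xi>(n)\<close> cannot be read off uniformly. Cantor normal forms unify the
  cases: if the leading exponent of \<open>r\<close> is at most \<open>a\<close>, a member of the
  family of \<open>\<omega>\<^sup>a + r\<close> is a member of the family of \<open>r\<close>
  followed by one of the family of \<open>\<omega>\<^sup>a\<close>. The least element therefore sits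
  in the block of the smallest exponent, and only powers of \<open>\<omega>\<close> need a
  computation of their own. The bound \<open>p \<le> k n\<close> is the recurring obstacle.
  Substituting \<open>p\<close> in the \<open>n\<close>-th term of \<open>u\<close> means
  substituting \<open>p\<close> in terms of \<open>w\<close>; this is admissible because those terms
  have index at least \<open>n\<close> and \<open>k\<close> is increasing. Compositions of
  refinements have to keep track of this index bound. One derivative is spent on finding a surviving
  extension, whence \<open>\<xi> + 1\<close> in one direction. In the other, \<open>\<F>\<close>
  containing \<open>L\<^sup>\<xi>\<close> is not enough, since the index is that of
  \<open>\<F>\<^sub>h\<close>; one tuple of minimal length lies in \<open>\<F>\<^sub>h\<close>, and
  a second application of the dichotomy spreads this to all of \<open>L\<^sup>\<xi>\<close>.\<close>

lemma zero_le_omega1: "0 \<le> (a::omega1)"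
  unfolding zero_omega1_def by (rule Least_le) simp

lemma not_less_zero_omega1: "\<not> a < (0::omega1)"
  using zero_le_omega1 by (simp add: not_less)

lemma omega1_neq_0_iff: "a \<noteq> 0 \<longleftrightarrow> 0 < (a::omega1)"
  using zero_le_omega1[of a] by auto

lemma osucc_le_iff: "osucc a \<le> b \<longleftrightarrow> a < b"
  using less_osucc[of a] unfolding osucc_def by (metis Least_le order_less_le_trans)

lemma less_osucc_iff: "a < osucc b \<longleftrightarrow> a \<le> b"
  using osucc_le_iff[of b a] by (metis not_le)

lemma osucc_less_iff: "osucc a < osucc b \<longleftrightarrow> a < b"
  by (simp add: less_osucc_iff osucc_le_iff)

lemma osucc_neq_0: "osucc a \<noteq> 0"
  using less_osucc[of a] not_less_zero_omega1 by metis

lemma is_limit_osucc: "\<not> is_limit (osucc a)"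
  unfolding is_limit_def is_succ_def by blast

lemma is_limit_0: "\<not> is_limit 0"
  unfolding is_limit_def by blast

lemma is_limit_1: "\<not> is_limit 1"
  unfolding one_omega1_def by (rule is_limit_osucc)

lemma one_le_iff_omega1: "1 \<le> (a::omega1) \<longleftrightarrow> a \<noteq> 0"
  unfolding one_omega1_def osucc_le_iff omega1_neq_0_iff ..

lemma one_neq_0_omega1: "(1::omega1) \<noteq> 0"
  unfolding one_omega1_def by (rule osucc_neq_0)

lemma is_limit_osucc_less: "is_limit l \<Longrightarrow> a < l \<Longrightarrow> osucc a < l"
  by (metis is_limit_osucc osucc_le_iff order_le_imp_less_or_eq)

lemma omega1_cases [case_names zero succ limit]:
  obtains "a = 0" | b where "a = osucc b" | "is_limit a"
  unfolding is_limit_def is_succ_def by blast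

lemma omega1_induct [case_names zero succ limit]:
  assumes "P 0" "\<And>b. P b \<Longrightarrow> P (osucc b)" "\<And>l. is_limit l \<Longrightarrow> (\<And>b. b < l \<Longrightarrow> P b) \<Longrightarrow> P l"
  shows "P a"
proof (induction a rule: less_induct)
  case (less a)
  show ?case by (cases a rule: omega1_cases) (use less assms less_osucc in auto)
qed

lemma is_limit_less_cofinal:
  assumes "a \<noteq> 0" "\<And>x. x < a \<Longrightarrow> \<exists>y. x < y \<and> y < a" shows "is_limit a"
  using assms less_osucc less_osucc_iff unfolding is_limit_def is_succ_def by (metis not_le)

text \<open>The order is only conditionally complete; countability of the index set supplies the
  bound that makes the supremum meaningful.\<close>

lemma less_SUP_omega1:
  fixes f :: "'i \<Rightarrow> omega1"
  assumes "countable I" "I \<noteq> {}"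
  shows "x < (SUP i\<in>I. f i) \<longleftrightarrow> (\<exists>i\<in>I. x < f i)"
  using assms by (intro less_cSUP_iff bdd_above_countable_omega1) auto

lemma is_limit_lessThan: "is_limit l \<Longrightarrow> {..<l} \<noteq> {}"
  unfolding is_limit_def omega1_neq_0_iff by blast

text \<open>Sums and powers at limits are known through what lies strictly below them, so identities
  between them are proved in this form.\<close>

lemma eq_by_less: "(\<And>x. x < a \<longleftrightarrow> x < b) \<Longrightarrow> a = (b::'o::linorder)"
  by (meson antisym not_le order.refl)

lemma oadd_0 [simp]: "oadd a 0 = a"
  by (simp add: oadd.simps)

lemma oadd_osucc: "oadd a (osucc b) = osucc (oadd a b)"
  by (subst oadd.simps) (simp add: osucc_neq_0 is_limit_osucc opred_osucc)

lemma less_oadd_limit: "is_limit l \<Longrightarrow> x < oadd a l \<longleftrightarrow> (\<exists>c<l. x < oadd a c)"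
  using less_SUP_omega1[OF countable_lessThan_omega1 is_limit_lessThan, of l x "oadd a"]
  by (subst oadd.simps) (auto simp: is_limit_def)

lemma oadd_strict_mono: "b < c \<Longrightarrow> oadd a b < oadd a c"
proof (induction c rule: omega1_induct)
  case (succ c)
  then show ?case by (metis less_osucc less_osucc_iff oadd_osucc order_le_less order_less_trans)
next
  case (limit l)
  then show ?case using less_oadd_limit[of l "oadd a b" a] is_limit_osucc_less less_osucc oadd_osucc by metis
qed (simp add: not_less_zero_omega1)

lemma oadd_less_iff: "oadd a b < oadd a c \<longleftrightarrow> b < c"
  by (metis oadd_strict_mono less_asym linorder_neqE order_less_irrefl)

lemma oadd_inject: "oadd a b = oadd a c \<longleftrightarrow> b = c"
  by (metis oadd_strict_mono linorder_neqE order_less_irrefl)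

lemma oadd_le_iff: "oadd a b \<le> oadd a c \<longleftrightarrow> b \<le> c"
  using oadd_less_iff[of a c b] by (metis not_le)

lemma oadd_ge1: "a \<le> oadd a b"
  using oadd_le_iff[of a 0 b] zero_le_omega1 by simp

lemma strict_mono_ge_id:
  assumes "\<And>a b. a < b \<Longrightarrow> f a < f b" shows "a \<le> f (a::omega1)"
proof (induction a rule: less_induct)
  case (less a)
  show ?case
  proof (rule ccontr)
    assume "\<not> a \<le> f a"
    then have "f a < a" by simp
    then show False using less[of "f a"] assms[of "f a" a] by simp
  qed
qed

lemma oadd_ge2: "b \<le> oadd a b"
  by (rule strict_mono_ge_id) (rule oadd_strict_mono)

lemma oadd_0_left [simp]: "oadd 0 b = b"
proof (induction b rule: omega1_induct)
  case (limit l)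
  show ?case
  proof (rule eq_by_less)
    fix x show "x < oadd 0 l \<longleftrightarrow> x < l"
      using limit(2) unfolding less_oadd_limit[OF limit(1)]
      by (metis is_limit_osucc_less less_osucc limit(1) order_less_trans)
  qed
qed (simp_all add: oadd_osucc)

lemma oadd_is_limit: "is_limit l \<Longrightarrow> is_limit (oadd a l)"
proof (rule is_limit_less_cofinal)
  assume l: "is_limit l"
  then show "oadd a l \<noteq> 0" by (metis omega1_neq_0_iff oadd_ge2 order_less_le_trans is_limit_def)
  fix x assume "x < oadd a l"
  then obtain c where "c < l" "x < oadd a c" using less_oadd_limit[OF l] by blast
  then show "\<exists>y. x < y \<and> y < oadd a l" using oadd_strict_mono by blast
qed

lemma oadd_assoc: "oadd (oadd a b) c = oadd a (oadd b c)"
proof (induction c rule: omega1_induct)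
  case (limit l)
  have bl: "is_limit (oadd b l)" using limit(1) by (rule oadd_is_limit)
  show ?case
  proof (rule eq_by_less)
    fix x
    have "x < oadd (oadd a b) l \<longleftrightarrow> (\<exists>c<l. x < oadd a (oadd b c))"
      using limit(2) less_oadd_limit[OF limit(1)] by metis
    also have "\<dots> \<longleftrightarrow> (\<exists>d<oadd b l. x < oadd a d)"
      using less_oadd_limit[OF limit(1), of _ b] oadd_strict_mono by (meson order_less_trans)
    finally show "x < oadd (oadd a b) l \<longleftrightarrow> x < oadd a (oadd b l)"
      unfolding less_oadd_limit[OF bl] .
  qed
qed (simp_all add: oadd_osucc)

text \<open>Left subtraction. The least \<open>b\<close> with \<open>x \<le> oadd a b\<close> does
  not overshoot: below \<open>b\<close> all sums are less than \<open>x\<close>, and the sum at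
  \<open>b\<close> is their successor or their supremum.\<close>

lemma oadd_subtract:
  assumes "a \<le> x" obtains b where "x = oadd a b"
proof -
  define b where "b = (LEAST b. x \<le> oadd a b)"
  have b: "x \<le> oadd a b" unfolding b_def by (rule LeastI[of _ x]) (rule oadd_ge2)
  have less: "oadd a c < x" if "c < b" for c
    using not_less_Least[of c "\<lambda>b. x \<le> oadd a b"] that unfolding b_def by simp
  have "oadd a b \<le> x"
  proof (cases b rule: omega1_cases)
    case zero
    then show ?thesis using assms by simp
  next
    case (succ c)
    then show ?thesis using less[of c] less_osucc by (simp add: oadd_osucc osucc_le_iff)
  next
    case limit
    then show ?thesis using less less_oadd_limit[OF limit, of x a] by (meson less_asym not_le)
  qed
  then show ?thesis using b by (intro that[of b]) simp
qed

lemma omult_nat_strict_mono: "0 < a \<Longrightarrow> m < n \<Longrightarrow> omult_nat a m < omult_nat a n"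
proof (induction n)
  case (Suc n)
  have "omult_nat a n < omult_nat a (Suc n)"
    using oadd_strict_mono[OF Suc.prems(1), of "omult_nat a n"] by simp
  then show ?case using Suc by (metis less_SucE order_less_trans)
qed simp

lemma omult_nat_mono: "m \<le> n \<Longrightarrow> omult_nat a m \<le> omult_nat a n"
proof (induction n)
  case (Suc n)
  then show ?case using oadd_ge1[of "omult_nat a n" a] by (auto simp: le_Suc_eq intro: order_trans)
qed simp

lemma omult_nat_Suc2: "omult_nat a (Suc n) = oadd a (omult_nat a n)"
proof (induction n)
  case (Suc n)
  have "omult_nat a (Suc (Suc n)) = oadd (oadd a (omult_nat a n)) a" using Suc by simp
  then show ?case by (simp add: oadd_assoc)
qed simp

lemma omega_pow_0: "omega_pow 0 = 1"
  by (simp add: omega_pow.simps)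

lemma less_omega_pow_osucc: "x < omega_pow (osucc b) \<longleftrightarrow> (\<exists>n. x < omult_nat (omega_pow b) n)"
  by (subst omega_pow.simps) (simp add: osucc_neq_0 is_limit_osucc opred_osucc less_SUP_omega1)

lemma less_omega_pow_limit: "is_limit l \<Longrightarrow> x < omega_pow l \<longleftrightarrow> (\<exists>c<l. x < omega_pow c)"
  using less_SUP_omega1[OF countable_lessThan_omega1 is_limit_lessThan, of l x omega_pow]
  by (subst omega_pow.simps) (auto simp: is_limit_def)

lemma omega_pow_pos: "0 < omega_pow a"
proof (induction a rule: omega1_induct)
  case zero
  show ?case using one_neq_0_omega1 by (simp add: omega_pow_0 omega1_neq_0_iff)
next
  case (succ b)
  then show ?case unfolding less_omega_pow_osucc by (intro exI[of _ "Suc 0"]) simp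
next
  case (limit l)
  then show ?case using less_omega_pow_limit[OF limit(1)] is_limit_lessThan by blast
qed

lemma omult_less_omega_pow: "omult_nat (omega_pow b) n < omega_pow (osucc b)"
  unfolding less_omega_pow_osucc using omult_nat_strict_mono[OF omega_pow_pos, of n "Suc n"] by blast

lemma omega_pow_less_osucc: "omega_pow b < omega_pow (osucc b)"
  using omult_less_omega_pow[of b "Suc 0"] by simp

lemma omega_pow_strict_mono: "b < c \<Longrightarrow> omega_pow b < omega_pow c"
proof (induction c rule: omega1_induct)
  case (succ c)
  then show ?case
    by (metis less_osucc_iff omega_pow_less_osucc order_le_less order_less_trans)
next
  case (limit l)
  then show ?case using less_omega_pow_limit[of l "omega_pow b"]
    by (metis is_limit_osucc_less omega_pow_less_osucc)
qed (simp add: not_less_zero_omega1)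

lemma omega_pow_less_iff: "omega_pow a < omega_pow b \<longleftrightarrow> a < b"
  by (metis omega_pow_strict_mono less_asym linorder_neqE order_less_irrefl)

lemma omega_pow_le_iff: "omega_pow a \<le> omega_pow b \<longleftrightarrow> a \<le> b"
  using omega_pow_less_iff[of b a] by (metis not_le)

lemma omega_pow_inject: "omega_pow a = omega_pow b \<longleftrightarrow> a = b"
  by (metis omega_pow_strict_mono linorder_neqE order_less_irrefl)

lemma omega_pow_is_limit: "a \<noteq> 0 \<Longrightarrow> is_limit (omega_pow a)"
proof (rule is_limit_less_cofinal)
  assume a: "a \<noteq> 0"
  show "omega_pow a \<noteq> 0" using omega_pow_pos omega1_neq_0_iff by blast
  fix x assume x: "x < omega_pow a"
  show "\<exists>y. x < y \<and> y < omega_pow a"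
  proof (cases a rule: omega1_cases)
    case (succ b)
    then show ?thesis using x omult_less_omega_pow unfolding succ less_omega_pow_osucc by blast
  next
    case limit
    then show ?thesis using x less_omega_pow_limit[OF limit] omega_pow_strict_mono by blast
  qed (use a in simp)
qed

text \<open>The least \<open>c\<close> with \<open>x < omega_pow c\<close> exists because
  \<open>x \<le> omega_pow x\<close>. It is not a limit, where the power is a supremum of smaller
  powers, so it has a predecessor: the leading exponent of \<open>x\<close>.\<close>

lemma omega_pow_bracket:
  assumes "x \<noteq> 0" obtains a where "omega_pow a \<le> x" "x < omega_pow (osucc a)"
proof -
  define c where "c = (LEAST c. x < omega_pow c)"
  have "x \<le> omega_pow x" by (rule strict_mono_ge_id) (rule omega_pow_strict_mono)
  then have "x < omega_pow (osucc x)" using omega_pow_less_osucc by (rule order_le_less_trans)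
  then have c: "x < omega_pow c" unfolding c_def by (rule LeastI)
  have less: "omega_pow b \<le> x" if "b < c" for b
    using not_less_Least[of b "\<lambda>c. x < omega_pow c"] that unfolding c_def by simp
  show ?thesis
  proof (cases c rule: omega1_cases)
    case zero
    then have "x < 1" using c by (simp add: omega_pow_0)
    then show ?thesis using assms one_le_iff_omega1[of x] by simp
  next
    case (succ b)
    then show ?thesis using that[of b] less[of b] c less_osucc by simp
  next
    case limit
    then show ?thesis using c less less_omega_pow_limit[OF limit, of x] by (metis not_le)
  qed
qed

lemma omega_pow_add_less:
  assumes "x < omega_pow (osucc a)" shows "oadd (omega_pow a) x < omega_pow (osucc a)"
proof -
  obtain n where "x < omult_nat (omega_pow a) n" using assms less_omega_pow_osucc by blast
  then have "oadd (omega_pow a) x < omult_nat (omega_pow a) (Suc n)"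
    unfolding omult_nat_Suc2 by (rule oadd_strict_mono)
  then show ?thesis using less_omega_pow_osucc by blast
qed

text \<open>Cantor normal forms, written without coefficients as non-increasing lists of exponents.\<close>

definition cnf_val :: "omega1 list \<Rightarrow> omega1" where
  "cnf_val es = foldr (\<lambda>a y. oadd (omega_pow a) y) es 0"

abbreviation noninc :: "omega1 list \<Rightarrow> bool" where
  "noninc \<equiv> sorted_wrt (\<ge>)"

lemma cnf_val_simps [simp]:
  "cnf_val [] = 0" "cnf_val (a # es) = oadd (omega_pow a) (cnf_val es)"
  by (simp_all add: cnf_val_def)

lemma cnf_val_append: "cnf_val (es @ fs) = oadd (cnf_val es) (cnf_val fs)"
  by (induction es) (simp_all add: oadd_assoc)

lemma cnf_val_pos: "es \<noteq> [] \<Longrightarrow> cnf_val es \<noteq> 0"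
  by (cases es) (auto simp: omega1_neq_0_iff intro: order_less_le_trans[OF omega_pow_pos oadd_ge1])

lemma cnf_val_less: "noninc (a # es) \<Longrightarrow> cnf_val (a # es) < omega_pow (osucc a)"
proof (induction es arbitrary: a)
  case Nil
  then show ?case using omega_pow_less_osucc by simp
next
  case (Cons b es)
  then have "cnf_val (b # es) < omega_pow (osucc b)" by simp
  also have "\<dots> \<le> omega_pow (osucc a)" using Cons.prems by (simp add: omega_pow_le_iff osucc_le_iff less_osucc_iff)
  finally show ?case using omega_pow_add_less by simp
qed

lemma cnf_val_bracket:
  "noninc (a # es) \<Longrightarrow> omega_pow a \<le> cnf_val (a # es) \<and> cnf_val (a # es) < omega_pow (osucc a)"
  using cnf_val_less oadd_ge1 by simp

lemma bracket_unique:
  "omega_pow a \<le> x \<Longrightarrow> x < omega_pow (osucc a) \<Longrightarrow> omega_pow b \<le> x \<Longrightarrow> x < omega_pow (osucc b) \<Longrightarrow> a = b"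
  by (metis less_osucc_iff omega_pow_less_iff order_le_less_trans antisym)

text \<open>The value determines the leading exponent by \<open>bracket_unique\<close>, and left
  cancellation of addition removes it.\<close>

lemma cnf_unique: "noninc es \<Longrightarrow> noninc fs \<Longrightarrow> cnf_val es = cnf_val fs \<Longrightarrow> es = fs"
proof (induction es arbitrary: fs)
  case Nil
  then show ?case using cnf_val_pos[of fs] by auto
next
  case (Cons a es)
  then obtain b gs where fs: "fs = b # gs" using cnf_val_pos[of "a # es"] by (cases fs) auto
  have "a = b"
    using cnf_val_bracket[OF Cons.prems(1)] cnf_val_bracket[of b gs] Cons.prems bracket_unique
    unfolding fs by metis
  then show ?case using Cons fs by (auto simp: oadd_inject)
qed

lemma cnf_exists: "\<exists>es. noninc es \<and> cnf_val es = x"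
proof (induction x rule: less_induct)
  case (less x)
  show ?case
  proof (cases "x = 0")
    case True
    then show ?thesis by (intro exI[of _ "[]"]) simp
  next
    case False
    then obtain a where a: "omega_pow a \<le> x" "x < omega_pow (osucc a)" by (rule omega_pow_bracket)
    obtain y where y: "x = oadd (omega_pow a) y" using oadd_subtract[OF a(1)] .
    \<comment> \<open>If \<open>x\<close> absorbed \<open>omega_pow a\<close> on the left, it would
      absorb every finite multiple and bound them all, against
      \<open>x < omega_pow (osucc a)\<close>. So the remainder is smaller and the induction
      applies.\<close>
    have "y \<noteq> x"
    proof
      assume "y = x"
      then have eq: "oadd (omega_pow a) x = x" using y by simp
      have "oadd (omult_nat (omega_pow a) n) x = x" for n
        by (induction n) (simp_all add: oadd_assoc eq)
      then have "omult_nat (omega_pow a) n \<le> x" for n using oadd_ge1 by metis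
      then show False using a(2) less_omega_pow_osucc by (metis not_le)
    qed
    then have yx: "y < x" using y oadd_ge2[of y "omega_pow a"] by simp
    then obtain es where es: "noninc es" "cnf_val es = y" using less by blast
    have "noninc (a # es)"
    proof (cases es)
      case (Cons b fs)
      have "omega_pow b \<le> y" using cnf_val_bracket[of b fs] es Cons by simp
      then have "omega_pow b < omega_pow (osucc a)" using yx a(2) by simp
      then have "b \<le> a" by (simp add: omega_pow_less_iff less_osucc_iff)
      then show ?thesis using es(1) Cons by auto
    qed simp
    then show ?thesis using es(2) y by (intro exI[of _ "a # es"]) simp
  qed
qed

lemma cnf_val_is_limit: "es \<noteq> [] \<Longrightarrow> \<forall>a\<in>set es. 0 < a \<Longrightarrow> is_limit (cnf_val es)"
proof (induction es)
  case (Cons a es)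
  then show ?case
    by (cases "es = []") (auto intro: oadd_is_limit omega_pow_is_limit simp: omega1_neq_0_iff)
qed simp

section \<open>Concatenation of families of sets\<close>

text \<open>Unlike \<open>set_less\<close>, which goes through \<open>Max\<close> and
  \<open>Min\<close>, this is meaningful for empty sets, so that the empty set can serve as a unit
  of concatenation.\<close>

definition before :: "nat set \<Rightarrow> nat set \<Rightarrow> bool" where
  "before s t \<longleftrightarrow> (\<forall>x\<in>s. \<forall>y\<in>t. x < y)"

lemma set_less_before:
  "finite s \<Longrightarrow> finite t \<Longrightarrow> s \<noteq> {} \<Longrightarrow> t \<noteq> {} \<Longrightarrow> set_less s t \<longleftrightarrow> before s t"
  unfolding set_less_def before_def by (meson Max_in Max_less_iff Min_gr_iff Min_in)

definition cat :: "(nat set \<Rightarrow> bool) \<Rightarrow> (nat set \<Rightarrow> bool) \<Rightarrow> nat set \<Rightarrow> bool" where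
  "cat P Q s \<longleftrightarrow> (\<exists>t u. P t \<and> Q u \<and> before t u \<and> s = t \<union> u)"

lemma cat_assoc: "cat (cat P Q) R = cat P (cat Q R)"
proof (intro ext iffI)
  fix s assume "cat (cat P Q) R s"
  then obtain t u v where "P t" "Q u" "R v" "before t u" "before (t \<union> u) v" "s = t \<union> u \<union> v"
    unfolding cat_def by blast
  moreover from this have "before u v" "before t (u \<union> v)" by (auto simp: before_def)
  ultimately show "cat P (cat Q R) s" unfolding cat_def by (metis Un_assoc)
next
  fix s assume "cat P (cat Q R) s"
  then obtain t u v where "P t" "Q u" "R v" "before u v" "before t (u \<union> v)" "s = t \<union> (u \<union> v)"
    unfolding cat_def by blast
  moreover from this have "before t u" "before (t \<union> u) v" by (auto simp: before_def)
  ultimately show "cat (cat P Q) R s" unfolding cat_def by (metis Un_assoc)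
qed

definition cat_unit :: "nat set \<Rightarrow> bool" where "cat_unit s \<longleftrightarrow> s = {}"

lemma cat_unit_left [simp]: "cat cat_unit P = P" and cat_unit_right [simp]: "cat P cat_unit = P"
  by (auto simp: cat_def cat_unit_def before_def fun_eq_iff)

primrec cat_pow :: "(nat set \<Rightarrow> bool) \<Rightarrow> nat \<Rightarrow> nat set \<Rightarrow> bool" where
  "cat_pow P 0 = cat_unit"
| "cat_pow P (Suc n) = cat P (cat_pow P n)"

lemma cat_pow_Suc2: "cat_pow P (Suc n) = cat (cat_pow P n) P"
proof (induction n)
  case (Suc n)
  have "cat_pow P (Suc (Suc n)) = cat P (cat (cat_pow P n) P)" using Suc by simp
  then show ?case by (simp add: cat_assoc)
qed simp

text \<open>On nonempty finite blocks \<open>set_less\<close> and \<open>before\<close> agree, so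
  successive unions become powers in the monoid of families.\<close>

lemma succ_union_eq_cat_pow:
  assumes "\<And>s. P s \<Longrightarrow> finite s \<and> s \<noteq> {}"
  shows "succ_union P p = cat_pow P p"
proof (induction p)
  case 0
  then show ?case by (auto simp: succ_union_def fun_eq_iff cat_unit_def)
next
  case (Suc p)
  show ?case
  proof (intro ext iffI)
    fix s assume "succ_union P (Suc p) s"
    then obtain ts' where ts': "length ts' = Suc p" "sorted_wrt set_less ts'" "\<forall>t\<in>set ts'. P t"
      "s = \<Union> (set ts')"
      unfolding succ_union_def by blast
    then obtain t ts where "ts' = t # ts" by (cases ts') auto
    with ts' have ts: "length ts = p" "sorted_wrt set_less (t # ts)" "\<forall>t\<in>set (t # ts). P t"
      "s = \<Union> (set (t # ts))" by simp_all
    have "before t t'" if "t' \<in> set ts" for t'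
      using set_less_before[of t t'] ts(2,3) assms that by simp
    then have "before t (\<Union> (set ts))" by (auto simp: before_def)
    moreover have "succ_union P p (\<Union> (set ts))" unfolding succ_union_def using ts by auto
    ultimately show "cat_pow P (Suc p) s"
      using ts(3,4) Suc unfolding cat_pow.simps cat_def by (intro exI[of _ t] exI[of _ "\<Union> (set ts)"]) auto
  next
    fix s assume "cat_pow P (Suc p) s"
    then obtain t u where t: "P t" "succ_union P p u" "before t u" "s = t \<union> u"
      using Suc unfolding cat_pow.simps cat_def by auto
    then obtain ts where ts: "length ts = p" "sorted_wrt set_less ts" "\<forall>t\<in>set ts. P t" "u = \<Union> (set ts)"
      unfolding succ_union_def by blast
    have "set_less t t'" if "t' \<in> set ts" for t'
      using set_less_before[of t t'] assms t(1,3) ts(3,4) that by (auto simp: before_def)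
    then show "succ_union P (Suc p) s"
      unfolding succ_union_def using ts t by (intro exI[of _ "t # ts"]) auto
  qed
qed

text \<open>As \<open>P\<close> has no empty member, the least element \<open>n\<close> must lie in
  the first piece; deleting it changes the first factor only.\<close>

lemma cat_head:
  assumes "\<And>s. P s \<Longrightarrow> s \<noteq> {}"
    and eq: "\<And>t. finite t \<Longrightarrow> \<forall>x\<in>t. n < x \<Longrightarrow> P ({n} \<union> t) \<longleftrightarrow> P' t"
    and s: "finite s" "\<forall>x\<in>s. n < x"
  shows "cat P Q ({n} \<union> s) \<longleftrightarrow> cat P' Q s"
proof
  assume "cat P Q ({n} \<union> s)"
  then obtain t u where tu: "P t" "Q u" "before t u" "{n} \<union> s = t \<union> u" unfolding cat_def by blast
  have nu: "n \<notin> u"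
  proof
    assume "n \<in> u"
    obtain x where "x \<in> t" using assms(1)[OF tu(1)] by blast
    then have "x < n" "x \<in> {n} \<union> s" using tu(3,4) \<open>n \<in> u\<close> by (auto simp: before_def)
    then show False using s(2) by auto
  qed
  then have nt: "n \<in> t" using tu(4) by blast
  have "n \<notin> s" using s(2) by auto
  have "s = (t \<union> u) - {n}" using tu(4) \<open>n \<notin> s\<close> by auto
  then have st: "s = (t - {n}) \<union> u" using nu by blast
  moreover have "finite (t - {n})" using s(1) st by simp
  moreover have "\<forall>x\<in>t - {n}. n < x" using s(2) st by blast
  moreover have "{n} \<union> (t - {n}) = t" using nt by blast
  ultimately have "P' (t - {n})" using eq[of "t - {n}"] tu(1) by simp
  then show "cat P' Q s" unfolding cat_def using tu(2,3) st by (auto simp: before_def)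
next
  assume "cat P' Q s"
  then obtain t u where tu: "P' t" "Q u" "before t u" "s = t \<union> u" unfolding cat_def by blast
  have "P ({n} \<union> t)" using eq[of t] tu(1,4) s by auto
  moreover have "before ({n} \<union> t) u" using tu(3,4) s(2) by (auto simp: before_def)
  ultimately show "cat P Q ({n} \<union> s)" unfolding cat_def using tu(2,4) by (metis Un_assoc)
qed

section \<open>Structure of the Schreier families\<close>

lemma succ_union_props:
  assumes "succ_union P p s" and "\<And>t. P t \<Longrightarrow> finite t \<and> t \<subseteq> {1..} \<and> t \<noteq> {}"
  shows "finite s \<and> s \<subseteq> {1..} \<and> (p \<ge> 1 \<longrightarrow> s \<noteq> {})"
proof -
  obtain ts where ts: "length ts = p" "\<forall>t\<in>set ts. P t" "s = \<Union> (set ts)"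
    using assms(1) unfolding succ_union_def by blast
  have "ts \<noteq> []" if "p \<ge> 1" using ts(1) that by auto
  then have "s \<noteq> {}" if "p \<ge> 1" using ts assms(2) that by (cases ts) auto
  then show ?thesis using ts(2,3) assms(2) by blast
qed

lemma schreier_mem_props:
  "schreier_mem fs x s \<Longrightarrow> finite s \<and> s \<subseteq> {1..} \<and> (x \<noteq> 0 \<longrightarrow> s \<noteq> {})"
proof (induction rule: schreier_mem.induct)
  case (omega_succ s b)
  then have "succ_union (\<lambda>s. schreier_mem fs (omega_pow b) s \<and> finite s \<and> s \<subseteq> {1..} \<and> s \<noteq> {}) (Min s) s"
    using omega_pow_pos omega1_neq_0_iff by simp
  from succ_union_props[OF this] show ?case using omega_succ(1) by simp
next
  case (cantor x cs a p cs' ss)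
  have 1: "finite (ss ! i) \<and> ss ! i \<subseteq> {1..} \<and> ss ! i \<noteq> {}" if i: "i < length cs" for i
  proof -
    have su: "succ_union (\<lambda>s. schreier_mem fs (omega_pow (fst (cs ! i))) s \<and> finite s \<and> s \<subseteq> {1..} \<and> s \<noteq> {})
       (snd (cs ! i)) (ss ! i)"
      using cantor i omega_pow_pos omega1_neq_0_iff by simp
    moreover have "snd (cs ! i) \<ge> 1" using cantor.hyps i by (metis case_prod_beta nth_mem)
    ultimately show ?thesis using succ_union_props[OF su] by simp
  qed
  have "length ss > 0" using cantor.hyps by simp
  then have "ss ! 0 \<in> set ss" by simp
  then have "\<Union> (set ss) \<noteq> {}" using 1[of 0] cantor.hyps by auto
  moreover have "finite t \<and> t \<subseteq> {1..}" if "t \<in> set ss" for t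
    using that 1 cantor.hyps by (metis in_set_conv_nth)
  ultimately show ?case by blast
qed auto

section \<open>Inversion of the inductive rules, one kind of ordinal at a time\<close>

lemma schreier_mem_0: "schreier_mem fs 0 = cat_unit"
proof (intro ext iffI)
  fix s assume "schreier_mem fs 0 s"
  then show "cat_unit s"
    by cases (use one_neq_0_omega1 osucc_neq_0 omega_pow_pos is_limit_0 in
      \<open>(metis cat_unit_def less_irrefl)+\<close>)
qed (auto simp: cat_unit_def intro: schreier_mem.zero)

text \<open>Although \<open>1\<close> is also \<open>omega_pow 0\<close>, the rules for powers have
  nonzero exponents and hence limit values, so only the rule for singletons can produce it.\<close>

lemma schreier_mem_1: "schreier_mem fs 1 s \<longleftrightarrow> (\<exists>n\<ge>1. s = {n})"
proof
  assume "schreier_mem fs 1 s"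
  then show "\<exists>n\<ge>1. s = {n}"
  proof cases
    case (succ z s n)
    then show ?thesis by (metis one_omega1_def osucc_inject)
  next
    case (omega_succ b)
    then show ?thesis by (metis is_limit_1 omega_pow_is_limit osucc_neq_0)
  next
    case (omega_limit l)
    then show ?thesis by (metis is_limit_1 omega_pow_is_limit is_limit_def)
  qed (use one_neq_0_omega1 is_limit_1 in auto)
qed (auto intro: schreier_mem.one)

lemma schreier_mem_osucc:
  assumes "z \<noteq> 0"
  shows "schreier_mem fs (osucc z) s \<longleftrightarrow> (\<exists>n\<ge>1. \<exists>t. schreier_mem fs z t \<and> set_less {n} t \<and> s = {n} \<union> t)"
proof
  assume "schreier_mem fs (osucc z) s"
  then show "\<exists>n\<ge>1. \<exists>t. schreier_mem fs z t \<and> set_less {n} t \<and> s = {n} \<union> t"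
  proof cases
    case (one n)
    then show ?thesis using assms by (metis one_omega1_def osucc_inject)
  next
    case (succ y t n)
    then have "y = z" by (simp add: osucc_inject)
    then show ?thesis using succ by auto
  next
    case (omega_succ b)
    then show ?thesis by (metis is_limit_osucc omega_pow_is_limit osucc_neq_0)
  next
    case (omega_limit l)
    then show ?thesis by (metis is_limit_osucc omega_pow_is_limit is_limit_def)
  next
    case zero
    then show ?thesis using osucc_neq_0[of z] by metis
  next
    case (cantor cs)
    then show ?thesis using is_limit_osucc by metis
  qed
qed (auto intro: schreier_mem.succ[OF assms, simplified])

lemma schreier_mem_omega_succ:
  "schreier_mem fs (omega_pow (osucc b)) s \<longleftrightarrow>
     s \<noteq> {} \<and> succ_union (schreier_mem fs (omega_pow b)) (Min s) s"
proof
  have lim: "is_limit (omega_pow (osucc b))" using omega_pow_is_limit osucc_neq_0 by blast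
  assume "schreier_mem fs (omega_pow (osucc b)) s"
  then show "s \<noteq> {} \<and> succ_union (schreier_mem fs (omega_pow b)) (Min s) s"
  proof cases
    case zero
    then show ?thesis using lim is_limit_0 by metis
  next
    case one
    then show ?thesis using lim is_limit_1 by metis
  next
    case succ
    then show ?thesis using lim is_limit_osucc by metis
  next
    case (omega_succ c)
    then show ?thesis by (simp add: omega_pow_inject osucc_inject)
  next
    case (omega_limit l)
    then show ?thesis by (metis is_limit_osucc omega_pow_inject)
  next
    case (cantor cs a)
    then show ?thesis by (metis omega_pow_less_iff osucc_less_iff less_osucc_iff not_le)
  qed
qed (auto intro: schreier_mem.omega_succ)

lemma schreier_mem_omega_limit:
  assumes "is_limit l"
  shows "schreier_mem fs (omega_pow l) s \<longleftrightarrow> s \<noteq> {} \<and> schreier_mem fs (omega_pow (fs l (Min s))) s"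
proof
  have lim: "is_limit (omega_pow l)" using omega_pow_is_limit assms is_limit_def by blast
  assume "schreier_mem fs (omega_pow l) s"
  then show "s \<noteq> {} \<and> schreier_mem fs (omega_pow (fs l (Min s))) s"
  proof cases
    case zero
    then show ?thesis using lim is_limit_0 by metis
  next
    case one
    then show ?thesis using lim is_limit_1 by metis
  next
    case succ
    then show ?thesis using lim is_limit_osucc by metis
  next
    case (omega_succ c)
    then show ?thesis using assms is_limit_osucc by (metis omega_pow_inject)
  next
    case (omega_limit l)
    then show ?thesis by (simp add: omega_pow_inject)
  next
    case (cantor cs a)
    then show ?thesis by (metis omega_pow_less_iff less_osucc_iff not_le)
  qed
qed (auto intro: schreier_mem.omega_limit[OF assms])

text \<open>Strictly between consecutive powers there is no power, which excludes the rules for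
  powers; the bracket also identifies the leading exponent in the remaining rule.\<close>

lemma schreier_mem_cantor:
  assumes x: "is_limit x" and a: "omega_pow a < x" "x < omega_pow (osucc a)"
  shows "schreier_mem fs x s \<longleftrightarrow> (\<exists>cs p cs' ss. cs = (a, p) # cs' \<and>
    sorted_wrt (>) (map fst cs) \<and> (\<forall>(b, q)\<in>set cs. b > 0 \<and> q \<ge> 1) \<and>
    x = foldr (\<lambda>(b, q) y. oadd (omult_nat (omega_pow b) q) y) cs 0 \<and>
    length ss = length cs \<and>
    (\<forall>i<length cs. succ_union (schreier_mem fs (omega_pow (fst (cs ! i)))) (snd (cs ! i)) (ss ! i)) \<and>
    sorted_wrt (\<lambda>s t. set_less t s) ss \<and> s = \<Union> (set ss))" (is "_ \<longleftrightarrow> ?R")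
proof
  have no: "x \<noteq> omega_pow b" for b
    using a by (metis omega_pow_less_iff less_osucc_iff not_le)
  assume "schreier_mem fs x s"
  then show ?R
  proof cases
    case zero
    then show ?thesis using x is_limit_0 by metis
  next
    case one
    then show ?thesis using x is_limit_1 by metis
  next
    case succ
    then show ?thesis using x is_limit_osucc by metis
  next
    case (omega_succ c)
    then show ?thesis using no by blast
  next
    case (omega_limit l)
    then show ?thesis using no by blast
  next
    case (cantor cs b p cs' ss)
    then have "a = b" using bracket_unique[of a x b] a by simp
    then show ?thesis using cantor by blast
  qed
next
  assume ?R
  then show "schreier_mem fs x s"
    using schreier_mem.cantor[OF x _ a] by blast
qed

section \<open>Schreier families along Cantor normal forms\<close>

definition flat :: "(omega1 \<times> nat) list \<Rightarrow> omega1 list" where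
  "flat cs = concat (map (\<lambda>(a, p). replicate p a) cs)"

lemma cnf_val_replicate: "cnf_val (replicate p a) = omult_nat (omega_pow a) p"
  by (induction p) (simp_all add: omult_nat_Suc2 del: omult_nat.simps(2))

lemma cnf_val_flat:
  "cnf_val (flat cs) = foldr (\<lambda>(b, q) y. oadd (omult_nat (omega_pow b) q) y) cs 0"
  by (induction cs) (auto simp: flat_def cnf_val_append cnf_val_replicate)

lemma noninc_flat: "sorted_wrt (>) (map fst cs) \<Longrightarrow> noninc (flat cs)"
proof (induction cs)
  case (Cons c cs)
  have "noninc (replicate p a)" for p and a :: omega1 by (induction p) auto
  then show ?case using Cons
    by (cases c) (auto simp: flat_def sorted_wrt_append less_imp_le in_set_replicate)
qed (simp add: flat_def)

lemma mem_flat: "(b, q) \<in> set cs \<Longrightarrow> q \<ge> 1 \<Longrightarrow> b \<in> set (flat cs)"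
  by (induction cs) (auto simp: flat_def)

lemma flat_exists:
  "noninc es \<Longrightarrow> \<exists>cs. flat cs = es \<and> sorted_wrt (>) (map fst cs) \<and> (\<forall>(b, q)\<in>set cs. q \<ge> 1)"
proof (induction es)
  case Nil
  show ?case by (intro exI[of _ "[]"]) (simp add: flat_def)
next
  case (Cons e es)
  then obtain cs where cs: "flat cs = es" "sorted_wrt (>) (map fst cs)" "\<forall>(b, q)\<in>set cs. q \<ge> 1" by auto
  show ?case
  proof (cases cs)
    case Nil
    then show ?thesis using cs by (intro exI[of _ "[(e, 1)]"]) (simp add: flat_def)
  next
    case (Cons c cs')
    obtain b q where c: "c = (b, q)" by (cases c)
    have q: "q \<ge> 1" using cs(3) Cons c by simp
    then have "b \<in> set es" using cs(1) Cons c by (auto simp: flat_def)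
    then have "b \<le> e" using Cons.prems by auto
    show ?thesis
    proof (cases "b = e")
      case True
      have "flat ((e, Suc q) # cs') = e # es" using cs(1) Cons c True by (simp add: flat_def)
      then show ?thesis using cs Cons c True by (intro exI[of _ "(e, Suc q) # cs'"]) auto
    next
      case False
      then have "b < e" using \<open>b \<le> e\<close> by simp
      then have "sorted_wrt (>) (map fst ((e, 1) # cs))" using cs(2) Cons c by auto
      then show ?thesis using cs by (intro exI[of _ "(e, 1) # cs"]) (auto simp: flat_def)
    qed
  qed
qed

text \<open>The order is reversed because the rule \<open>cantor\<close> puts the sets of the
  leading exponent last; the exponent at the head of the list contributes the final block.\<close>

definition cnf_fam :: "(omega1 \<Rightarrow> nat \<Rightarrow> omega1) \<Rightarrow> omega1 list \<Rightarrow> nat set \<Rightarrow> bool" where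
  "cnf_fam fs es = foldr (\<lambda>a Q. cat Q (schreier_mem fs (omega_pow a))) es cat_unit"

lemma cnf_fam_simps [simp]:
  "cnf_fam fs [] = cat_unit"
  "cnf_fam fs (a # es) = cat (cnf_fam fs es) (schreier_mem fs (omega_pow a))"
  by (simp_all add: cnf_fam_def)

lemma cnf_fam_append: "cnf_fam fs (es @ gs) = cat (cnf_fam fs gs) (cnf_fam fs es)"
  by (induction es) (simp_all add: cat_assoc)

lemma cnf_fam_replicate: "cnf_fam fs (replicate p a) = cat_pow (schreier_mem fs (omega_pow a)) p"
  by (induction p) (simp_all only: replicate.simps cnf_fam_simps cat_pow.simps(1) cat_pow_Suc2)

lemma schreier_mem_omega_props:
  "schreier_mem fs (omega_pow a) s \<Longrightarrow> finite s \<and> s \<noteq> {}"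
  using schreier_mem_props omega_pow_pos omega1_neq_0_iff by blast

lemma list_all2_set2_ex: "list_all2 R xs ys \<Longrightarrow> y \<in> set ys \<Longrightarrow> \<exists>x\<in>set xs. R x y"
  by (induction rule: list_all2_induct) auto

text \<open>Coefficients at least 1 make every union of blocks nonempty, so that
  \<open>set_less\<close> between the pieces is the same as \<open>before\<close>; a coefficient
  \<open>q\<close> corresponds to \<open>q\<close> equal exponents in
  \<open>flat cs\<close>.\<close>

lemma cantor_eq_cnf_fam:
  assumes "\<forall>(b, q)\<in>set cs. q \<ge> 1"
  shows "(\<exists>ss. length ss = length cs \<and>
    (\<forall>i<length cs. succ_union (schreier_mem fs (omega_pow (fst (cs ! i)))) (snd (cs ! i)) (ss ! i)) \<and>
    sorted_wrt (\<lambda>s t. set_less t s) ss \<and> s = \<Union> (set ss)) \<longleftrightarrow> cnf_fam fs (flat cs) s"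
proof -
  define R where "R = (\<lambda>c. succ_union (schreier_mem fs (omega_pow (fst c))) (snd c))"
  have R: "finite s \<and> s \<noteq> {}" if "R c s" "snd c \<ge> 1" for c s
    using succ_union_props[OF that(1)[unfolded R_def]] schreier_mem_props that(2)
      omega_pow_pos omega1_neq_0_iff by blast
  have "(\<exists>ss. list_all2 R cs ss \<and> sorted_wrt (\<lambda>s t. set_less t s) ss \<and> s = \<Union> (set ss))
    \<longleftrightarrow> cnf_fam fs (flat cs) s"
    using assms
  proof (induction cs arbitrary: s)
    case Nil
    then show ?case by (simp add: flat_def cat_unit_def)
  next
    case (Cons c cs)
    obtain b q where c: "c = (b, q)" by (cases c)
    have c1: "snd c \<ge> 1" "\<forall>c\<in>set cs. snd c \<ge> 1" using Cons.prems by auto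
    have IH: "(\<exists>ss. list_all2 R cs ss \<and> sorted_wrt (\<lambda>s t. set_less t s) ss \<and> s = \<Union> (set ss))
      \<longleftrightarrow> cnf_fam fs (flat cs) s" for s using Cons by simp
    have Rc: "cnf_fam fs (replicate q b) = R c"
      unfolding R_def c cnf_fam_replicate
      using succ_union_eq_cat_pow[of "schreier_mem fs (omega_pow b)" q, OF schreier_mem_omega_props] by simp
    have "cnf_fam fs (flat (c # cs)) = cat (cnf_fam fs (flat cs)) (R c)"
      unfolding Rc[symmetric] by (simp add: flat_def c cnf_fam_append)
    moreover have "(\<exists>ss. list_all2 R (c # cs) ss \<and> sorted_wrt (\<lambda>s t. set_less t s) ss \<and> s = \<Union> (set ss))
      \<longleftrightarrow> cat (cnf_fam fs (flat cs)) (R c) s"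
    proof
      assume "\<exists>ss. list_all2 R (c # cs) ss \<and> sorted_wrt (\<lambda>s t. set_less t s) ss \<and> s = \<Union> (set ss)"
      then obtain u ts where ts: "R c u" "list_all2 R cs ts" "sorted_wrt (\<lambda>s t. set_less t s) (u # ts)"
        "s = \<Union> (set (u # ts))" by (auto simp: list_all2_Cons1)
      have "before t u" if t: "t \<in> set ts" for t
      proof -
        obtain d where "d \<in> set cs" "R d t" using list_all2_set2_ex[OF ts(2) t] by blast
        then show ?thesis using R c1 ts(1,3) t set_less_before[of t u] by auto
      qed
      then have "before (\<Union> (set ts)) u" by (auto simp: before_def)
      moreover have "cnf_fam fs (flat cs) (\<Union> (set ts))" using IH ts(2,3) by auto
      ultimately show "cat (cnf_fam fs (flat cs)) (R c) s" unfolding cat_def using ts(1,4) by auto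
    next
      assume "cat (cnf_fam fs (flat cs)) (R c) s"
      then obtain t u where tu: "cnf_fam fs (flat cs) t" "R c u" "before t u" "s = t \<union> u"
        unfolding cat_def by blast
      then obtain ts where ts: "list_all2 R cs ts" "sorted_wrt (\<lambda>s t. set_less t s) ts" "t = \<Union> (set ts)"
        by (metis (lifting) IH[THEN iffD2])
      have "set_less t u" if t: "t \<in> set ts" for t
      proof -
        obtain d where "d \<in> set cs" "R d t" using list_all2_set2_ex[OF ts(1) t] by blast
        moreover have "before t u" using tu(3) ts(3) t by (auto simp: before_def)
        ultimately show ?thesis using R c1 tu(2) set_less_before[of t u] by auto
      qed
      then show "\<exists>ss. list_all2 R (c # cs) ss \<and> sorted_wrt (\<lambda>s t. set_less t s) ss \<and> s = \<Union> (set ss)"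
        using tu ts by (intro exI[of _ "u # ts"]) auto
    qed
    ultimately show ?case by simp
  qed
  moreover have "list_all2 R cs ss \<longleftrightarrow> length ss = length cs \<and>
    (\<forall>i<length cs. succ_union (schreier_mem fs (omega_pow (fst (cs ! i)))) (snd (cs ! i)) (ss ! i))" for ss
    unfolding list_all2_conv_all_nth R_def by auto
  ultimately show ?thesis by (simp add: conj_assoc)
qed

lemma cat_singleton: "cat (schreier_mem fs 1) P s \<longleftrightarrow> (\<exists>n\<ge>1. \<exists>t. P t \<and> before {n} t \<and> s = {n} \<union> t)"
  unfolding cat_def schreier_mem_1 by blast

text \<open>Brings all rules under one scheme, from which deletion of the least element can be
  computed block by block.\<close>

theorem schreier_mem_cnf: "noninc es \<Longrightarrow> schreier_mem fs (cnf_val es) = cnf_fam fs es"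
proof (induction "length es" arbitrary: es rule: less_induct)
  case less
  \<comment> \<open>The split follows the rules: a last exponent 0 means a successor, whose extra
    singleton comes in front of the shorter list; one positive exponent is a pure power, where both
    sides coincide; two or more positive exponents fall under the rule
    \<open>cantor\<close>.\<close>
  consider "es = []" | es' where "es = es' @ [0]" | a where "es = [a]" "0 < a"
    | a b es' where "es = a # b # es'" "\<forall>a\<in>set es. 0 < a"
  proof (cases es rule: rev_cases)
    case (snoc es' y)
    show ?thesis
    proof (cases "y = 0")
      case False
      then have "\<forall>a\<in>set es. 0 < a"
        using less.prems snoc by (auto simp: sorted_wrt_append omega1_neq_0_iff intro: order_less_le_trans)
      then show ?thesis using that(3)[of y] that(4) snoc by (cases es'; cases "tl es'") fastforce+
    qed (use that(2) snoc in auto)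
  qed (use that(1) in auto)
  then show ?case
  proof cases
    case 1
    then show ?thesis by (simp add: schreier_mem_0)
  next
    case (2 es')
    have val: "cnf_val es = osucc (cnf_val es')"
      using 2 by (simp add: cnf_val_append omega_pow_0 one_omega1_def oadd_osucc)
    have fam: "cnf_fam fs es = cat (schreier_mem fs 1) (cnf_fam fs es')"
      using 2 by (simp add: cnf_fam_append omega_pow_0)
    show ?thesis
    proof (cases "es' = []")
      case True
      then show ?thesis using val fam by (simp add: one_omega1_def)
    next
      case False
      have nz: "cnf_val es' \<noteq> 0" using cnf_val_pos False by blast
      have eq: "schreier_mem fs (cnf_val es') = cnf_fam fs es'"
        using less 2 by (simp add: sorted_wrt_append)
      have "schreier_mem fs (cnf_val es) s \<longleftrightarrow> cnf_fam fs es s" for s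
        unfolding fam cat_singleton val schreier_mem_osucc[OF nz] eq
        using schreier_mem_props[of fs "cnf_val es'"] nz set_less_before[of "{_}"] eq
        by (metis finite.emptyI finite.insertI insert_not_empty)
      then show ?thesis by blast
    qed
  next
    case (3 a)
    then show ?thesis by simp
  next
    case (4 a b es')
    have lim: "is_limit (cnf_val es)" using cnf_val_is_limit 4 by blast
    have br: "omega_pow a < cnf_val es" "cnf_val es < omega_pow (osucc a)"
      using oadd_strict_mono[of 0 "cnf_val (b # es')" "omega_pow a"] cnf_val_pos[of "b # es'"]
        cnf_val_less[of a "b # es'"] less.prems 4(1) by (auto simp: omega1_neq_0_iff)
    have "schreier_mem fs (cnf_val es) s \<longleftrightarrow> cnf_fam fs es s" for s
    proof
      assume "schreier_mem fs (cnf_val es) s"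
      then obtain cs where cs: "sorted_wrt (>) (map fst cs)" "\<forall>(b, q)\<in>set cs. b > 0 \<and> q \<ge> 1"
          "cnf_val es = cnf_val (flat cs)"
        and ss: "\<exists>ss. length ss = length cs \<and>
    (\<forall>i<length cs. succ_union (schreier_mem fs (omega_pow (fst (cs ! i)))) (snd (cs ! i)) (ss ! i)) \<and>
    sorted_wrt (\<lambda>s t. set_less t s) ss \<and> s = \<Union> (set ss)"
        unfolding schreier_mem_cantor[OF lim br] cnf_val_flat by blast
      have "flat cs = es" using cnf_unique cs(3) noninc_flat[OF cs(1)] less.prems by metis
      moreover have "\<forall>(b, q)\<in>set cs. q \<ge> 1" using cs(2) by auto
      from cantor_eq_cnf_fam[OF this, of fs s] ss have "cnf_fam fs (flat cs) s" by blast
      ultimately show "cnf_fam fs es s" by simp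
    next
      assume fam: "cnf_fam fs es s"
      obtain cs where cs: "flat cs = es" "sorted_wrt (>) (map fst cs)" "\<forall>(b, q)\<in>set cs. q \<ge> 1"
        using flat_exists[OF less.prems] by blast
      have "\<forall>(b, q)\<in>set cs. b > 0 \<and> q \<ge> 1"
      proof clarify
        fix b q assume bq: "(b, q) \<in> set cs"
        then have "q \<ge> 1" using cs(3) by auto
        moreover from this have "b \<in> set (flat cs)" using mem_flat[OF bq] by blast
        ultimately show "b > 0 \<and> q \<ge> 1" using 4(2) cs(1) by blast
      qed
      moreover obtain p cs' where "cs = (a, p) # cs'"
      proof (cases cs)
        case Nil
        then show ?thesis using cs(1) 4(1) by (simp add: flat_def)
      next
        case (Cons c cs')
        obtain d q where c: "c = (d, q)" by (cases c)
        then have "d = a" using cs(1,3) 4(1) Cons by (cases q) (auto simp: flat_def)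
        then show ?thesis using that Cons c by blast
      qed
      moreover note cs(2) cnf_val_flat[of cs, unfolded cs(1)] cantor_eq_cnf_fam[OF cs(3), of fs s]
      ultimately show "schreier_mem fs (cnf_val es) s"
        unfolding schreier_mem_cantor[OF lim br] using fam cs(1) by blast
    qed
    then show ?thesis by blast
  qed
qed

text \<open>The bound says that the exponents of \<open>r\<close> do not exceed \<open>a\<close>, so
  \<open>a\<close> may be put in front of the normal form of \<open>r\<close>.\<close>

lemma schreier_mem_oadd:
  assumes "r < omega_pow (osucc a)"
  shows "schreier_mem fs (oadd (omega_pow a) r) = cat (schreier_mem fs r) (schreier_mem fs (omega_pow a))"
proof -
  obtain es where es: "noninc es" "cnf_val es = r" using cnf_exists by blast
  have "noninc (a # es)"
  proof (cases es)
    case (Cons b gs)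
    have "omega_pow b \<le> r" using cnf_val_bracket[of b gs] es Cons by simp
    then have "b \<le> a" using assms by (metis less_osucc_iff omega_pow_less_iff order_le_less_trans)
    then show ?thesis using es(1) Cons by auto
  qed simp
  then show ?thesis using schreier_mem_cnf[of "a # es" fs] schreier_mem_cnf[of es fs] es by simp
qed

lemma omult_add_less:
  "r < omega_pow (osucc a) \<Longrightarrow> oadd (omult_nat (omega_pow a) m) r < omega_pow (osucc a)"
  by (induction m) (simp_all add: omult_nat_Suc2 oadd_assoc omega_pow_add_less del: omult_nat.simps(2))

lemma schreier_mem_omult_add:
  assumes "r < omega_pow (osucc a)"
  shows "schreier_mem fs (oadd (omult_nat (omega_pow a) m) r) =
    cat (schreier_mem fs r) (cat_pow (schreier_mem fs (omega_pow a)) m)"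
proof (induction m)
  case (Suc m)
  then show ?case
    using schreier_mem_oadd[OF omult_add_less[OF assms], of fs m]
    by (simp only: omult_nat_Suc2 oadd_assoc cat_pow_Suc2 cat_assoc)
qed simp

text \<open>The last two clauses keep \<open>r n\<close> large: they are what allows a tuple to
  survive \<open>x\<close> derivatives once its far extensions survive \<open>r n\<close> of
  them.\<close>

definition residual :: "(omega1 \<Rightarrow> nat \<Rightarrow> omega1) \<Rightarrow> omega1 \<Rightarrow> (nat \<Rightarrow> omega1) \<Rightarrow> bool" where
  "residual fs x r \<longleftrightarrow>
    (\<forall>n\<ge>1. r n < x \<and> (\<forall>s. finite s \<longrightarrow> (\<forall>i\<in>s. n < i) \<longrightarrow>
       schreier_mem fs x ({n} \<union> s) = schreier_mem fs (r n) s)) \<and>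
    (\<forall>z. x = osucc z \<longrightarrow> (\<forall>n\<ge>1. r n = z)) \<and>
    (is_limit x \<longrightarrow> (\<forall>b<x. \<exists>N. \<forall>n\<ge>N. b \<le> r n))"

text \<open>For a successor exponent the number of blocks is the least element \<open>n\<close>, and
  deleting \<open>n\<close> damages the first block only. For a limit exponent the least element
  selects the power \<open>fs a n\<close>, so the residual is the diagonal of those of the selected
  powers.\<close>

lemma residual_omega_pow:
  assumes fs: "fundamental_sequences fs"
  shows "\<exists>r. residual fs (omega_pow a) r"
proof (induction a rule: less_induct)
  case (less a)
  \<comment> \<open>The explicit lower bound is carried along for the limit case: convergence of
    each single residual function would say nothing about the diagonal.\<close>
  have step: "\<exists>r. residual fs (omega_pow (osucc b)) r \<and>
      (\<forall>n. omult_nat (omega_pow b) (n - 1) \<le> r n)" if b: "\<exists>r. residual fs (omega_pow b) r" for b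
  proof -
    obtain r where r: "residual fs (omega_pow b) r" using b by blast
    \<comment> \<open>What remains of the first block has ordinal \<open>r n\<close> and is followed
      by \<open>n - 1\<close> intact blocks; in ordinal notation the intact blocks are the leading
      part.\<close>
    define r' where "r' n = oadd (omult_nat (omega_pow b) (n - 1)) (r n)" for n
    have r'ge: "omult_nat (omega_pow b) (n - 1) \<le> r' n" for n unfolding r'_def by (rule oadd_ge1)
    have lim: "is_limit (omega_pow (osucc b))" by (rule omega_pow_is_limit[OF osucc_neq_0])
    have rn: "r n < omega_pow (osucc b)" if "n \<ge> 1" for n
    proof -
      have "r n < omega_pow b" using r that unfolding residual_def by blast
      then show ?thesis using omega_pow_less_osucc by (rule order_less_trans)
    qed
    have "residual fs (omega_pow (osucc b)) r'"
      unfolding residual_def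
    proof (intro conjI allI impI)
      fix n :: nat assume n: "n \<ge> 1"
      show "r' n < omega_pow (osucc b)" unfolding r'_def by (rule omult_add_less[OF rn[OF n]])
      fix s :: "nat set" assume s: "finite s" "\<forall>i\<in>s. n < i"
      have "Min ({n} \<union> s) = n" using s by (intro Min_eqI) auto
      then have "schreier_mem fs (omega_pow (osucc b)) ({n} \<union> s) \<longleftrightarrow>
          cat_pow (schreier_mem fs (omega_pow b)) n ({n} \<union> s)"
        using succ_union_eq_cat_pow[of "schreier_mem fs (omega_pow b)" n, OF schreier_mem_omega_props]
        by (simp add: schreier_mem_omega_succ)
      also have "cat_pow (schreier_mem fs (omega_pow b)) n =
          cat_pow (schreier_mem fs (omega_pow b)) (Suc (n - 1))" using n by simp
      also have "cat_pow (schreier_mem fs (omega_pow b)) (Suc (n - 1)) ({n} \<union> s) \<longleftrightarrow>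
          cat (schreier_mem fs (r n)) (cat_pow (schreier_mem fs (omega_pow b)) (n - 1)) s"
        unfolding cat_pow.simps
        by (rule cat_head) (use r n s schreier_mem_omega_props in \<open>auto simp: residual_def\<close>)
      finally show "schreier_mem fs (omega_pow (osucc b)) ({n} \<union> s) = schreier_mem fs (r' n) s"
        unfolding r'_def schreier_mem_omult_add[OF rn[OF n]] .
    next
      fix z n assume "omega_pow (osucc b) = osucc z"
      then show "r' n = z" using lim is_limit_osucc by metis
    next
      fix c assume "c < omega_pow (osucc b)"
      then obtain m where m: "c < omult_nat (omega_pow b) m" using less_omega_pow_osucc by blast
      have "c \<le> r' n" if "n \<ge> Suc m" for n
      proof -
        have "m \<le> n - 1" using that by simp
        from m omult_nat_mono[OF this, of "omega_pow b"] r'ge[of n] show ?thesis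
          by (meson less_imp_le order_trans)
      qed
      then show "\<exists>N. \<forall>n\<ge>N. c \<le> r' n" by blast
    qed
    then show ?thesis using r'ge by blast
  qed
  show ?case
  proof (cases a rule: omega1_cases)
    case zero
    have "residual fs 1 (\<lambda>_. 0)"
      unfolding residual_def
      using one_neq_0_omega1 is_limit_1
      by (auto simp: omega1_neq_0_iff schreier_mem_0 schreier_mem_1 cat_unit_def)
        (auto simp: one_omega1_def osucc_inject)
    then show ?thesis unfolding zero omega_pow_0 by blast
  next
    case (succ b)
    then show ?thesis using step[of b] less[of b] less_osucc[of b] by blast
  next
    case limit
    \<comment> \<open>Fundamental sequences consist of successors, so \<open>step\<close> applies to
      each \<open>fs a n\<close> and yields the lower bound in terms of its predecessor.\<close>
    define c where "c n = opred (fs a n)" for n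
    have fsc: "fs a n = osucc (c n)" if "n \<ge> 1" for n
    proof -
      have "is_succ (fs a n)" using fs limit that unfolding fundamental_sequences_def by blast
      then show ?thesis unfolding c_def is_succ_def using opred_osucc by metis
    qed
    have sup: "(SUP n\<in>{1..}. fs a n) = a" and sm: "strict_mono_on {1..} (fs a)"
      using fs limit unfolding fundamental_sequences_def by blast+
    have less_a: "b < a \<longleftrightarrow> (\<exists>n\<in>{1..}. b < fs a n)" for b
      by (subst sup[symmetric], rule less_SUP_omega1) auto
    have fsa: "fs a n < a" if "n \<ge> 1" for n
      using less_a[of "fs a n"] strict_mono_onD[OF sm, of n "Suc n"] that by fastforce
    have "\<forall>n. \<exists>r. n \<ge> 1 \<longrightarrow> residual fs (omega_pow (fs a n)) r \<and>
      (\<forall>m. omult_nat (omega_pow (c n)) (m - 1) \<le> r m)"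
    proof
      fix n
      show "\<exists>r. n \<ge> 1 \<longrightarrow> residual fs (omega_pow (fs a n)) r \<and>
        (\<forall>m. omult_nat (omega_pow (c n)) (m - 1) \<le> r m)"
      proof (cases "n \<ge> 1")
        case True
        then have "c n < a" using fsa[OF True] fsc[OF True] less_osucc by (metis order_less_trans)
        then show ?thesis using step[of "c n"] less[of "c n"] fsc[OF True] by simp
      qed simp
    qed
    then obtain R where R: "\<And>n. n \<ge> 1 \<Longrightarrow> residual fs (omega_pow (fs a n)) (R n)"
      "\<And>n m. n \<ge> 1 \<Longrightarrow> omult_nat (omega_pow (c n)) (m - 1) \<le> R n m" by metis
    have lim: "is_limit (omega_pow a)" using omega_pow_is_limit limit is_limit_def by blast
    have "residual fs (omega_pow a) (\<lambda>n. R n n)"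
      unfolding residual_def
    proof (intro conjI allI impI)
      fix n :: nat assume n: "n \<ge> 1"
      show "R n n < omega_pow a"
        using R(1)[OF n] n omega_pow_strict_mono[OF fsa[OF n]] unfolding residual_def
        by (meson order_less_trans)
      fix s :: "nat set" assume s: "finite s" "\<forall>i\<in>s. n < i"
      have "Min ({n} \<union> s) = n" using s by (intro Min_eqI) auto
      then show "schreier_mem fs (omega_pow a) ({n} \<union> s) = schreier_mem fs (R n n) s"
        using R(1)[OF n] n s unfolding residual_def schreier_mem_omega_limit[OF limit] by simp
    next
      fix z n assume "omega_pow a = osucc z"
      then show "R n n = z" using lim is_limit_osucc by metis
    next
      fix b assume "b < omega_pow a"
      then obtain d where d: "d < a" "b < omega_pow d" using less_omega_pow_limit[OF limit] by blast
      then obtain N where N: "N \<ge> 1" "d < fs a N" using less_a by auto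
      \<comment> \<open>With \<open>N \<ge> 1\<close>, the bound \<open>N + 1\<close> ensures
        \<open>n - 1 \<ge> 1\<close>, hence at least one full copy of \<open>omega_pow (c n)\<close>
        below \<open>R n n\<close>.\<close>
      have "b \<le> R n n" if n: "n \<ge> N + 1" for n
      proof -
        have "d < fs a n" using N n strict_mono_onD[OF sm, of N n] by (auto intro: order_less_trans)
        then have "d \<le> c n" using fsc[of n] n by (simp add: less_osucc_iff)
        then have "b \<le> omega_pow (c n)" using d(2) omega_pow_le_iff by (meson less_imp_le order_less_le_trans)
        also have "\<dots> = omult_nat (omega_pow (c n)) 1" by simp
        also have "\<dots> \<le> omult_nat (omega_pow (c n)) (n - 1)" using n N by (intro omult_nat_mono) simp
        also have "\<dots> \<le> R n n" using R(2) n by simp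
        finally show ?thesis .
      qed
      then show "\<exists>N. \<forall>n\<ge>N. b \<le> R n n" by blast
    qed
    then show ?thesis by blast
  qed
qed

text \<open>Induction along the normal form: the least element lies in the part belonging to the
  tail of the list, so the residual of the tail is added to the untouched leading power.\<close>

theorem residual_exists:
  assumes fs: "fundamental_sequences fs" and x: "x \<noteq> 0"
  shows "\<exists>r. residual fs x r"
proof -
  have "\<exists>r. residual fs (cnf_val es) r" if "noninc es" "es \<noteq> []" for es
    using that
  proof (induction es)
    case (Cons a es)
    show ?case
    proof (cases "es = []")
      case True
      then show ?thesis using residual_omega_pow[OF fs] by simp
    next
      case False
      then obtain r where r: "residual fs (cnf_val es) r" using Cons by auto
      have val: "cnf_val (a # es) = oadd (omega_pow a) (cnf_val es)" by simp
      have less: "cnf_val es < omega_pow (osucc a)"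
        using cnf_val_less[OF Cons.prems(1)] oadd_ge2[of "cnf_val es" "omega_pow a"] by simp
      have "residual fs (cnf_val (a # es)) (\<lambda>n. oadd (omega_pow a) (r n))"
        unfolding residual_def
      proof (intro conjI allI impI)
        fix n :: nat assume n: "n \<ge> 1"
        have rn: "r n < cnf_val es" using r n unfolding residual_def by blast
        then show "oadd (omega_pow a) (r n) < cnf_val (a # es)" unfolding val by (rule oadd_strict_mono)
        fix s :: "nat set" assume s: "finite s" "\<forall>i\<in>s. n < i"
        have "schreier_mem fs (cnf_val (a # es)) ({n} \<union> s) \<longleftrightarrow>
            cat (schreier_mem fs (cnf_val es)) (schreier_mem fs (omega_pow a)) ({n} \<union> s)"
          unfolding val schreier_mem_oadd[OF less] ..
        also have "\<dots> \<longleftrightarrow> cat (schreier_mem fs (r n)) (schreier_mem fs (omega_pow a)) s"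
          by (rule cat_head)
            (use r n s schreier_mem_props cnf_val_pos[OF False] in \<open>auto simp: residual_def\<close>)
        also have "\<dots> \<longleftrightarrow> schreier_mem fs (oadd (omega_pow a) (r n)) s"
          using schreier_mem_oadd[of "r n" a fs] rn less by simp
        finally show "schreier_mem fs (cnf_val (a # es)) ({n} \<union> s) =
          schreier_mem fs (oadd (omega_pow a) (r n)) s" .
      next
        fix z and n :: nat assume z: "cnf_val (a # es) = osucc z" and n: "n \<ge> 1"
        show "oadd (omega_pow a) (r n) = z"
        proof (cases "cnf_val es" rule: omega1_cases)
          case zero
          then show ?thesis using cnf_val_pos[OF False] by simp
        next
          case (succ y)
          then have "r n = y" using r n unfolding residual_def by blast
          then show ?thesis using z succ by (simp add: oadd_osucc osucc_inject)
        next
          case limit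
          then show ?thesis using oadd_is_limit[OF limit, of "omega_pow a"] z is_limit_osucc by simp
        qed
      next
        fix b assume lim: "is_limit (cnf_val (a # es))" and b: "b < cnf_val (a # es)"
        have lim': "is_limit (cnf_val es)"
        proof (cases "cnf_val es" rule: omega1_cases)
          case zero
          then show ?thesis using cnf_val_pos[OF False] by simp
        next
          case (succ y)
          then show ?thesis using lim is_limit_osucc by (simp add: oadd_osucc)
        qed
        obtain c where c: "c < cnf_val es" "b < oadd (omega_pow a) c"
          using b less_oadd_limit[OF lim'] unfolding val by blast
        then obtain N where "\<forall>n\<ge>N. c \<le> r n" using r lim' unfolding residual_def by blast
        then have "\<forall>n\<ge>N. b \<le> oadd (omega_pow a) (r n)"
          using c(2) oadd_le_iff by (meson less_imp_le order_less_le_trans)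
        then show "\<exists>N. \<forall>n\<ge>N. b \<le> oadd (omega_pow a) (r n)" by blast
      qed
      then show ?thesis by blast
    qed
  qed simp
  moreover obtain es where "noninc es" "cnf_val es = x" using cnf_exists by blast
  ultimately show ?thesis using x by (metis cnf_val_simps(1))
qed

section \<open>Idempotent ultrafilters\<close>

text \<open>This and the next two instances make the function space containing the ultrafilters
  Hausdorff, as the semigroup locale below demands.\<close>

instance "fun" :: (type, t0_space) t0_space
proof
  fix f g :: "'a \<Rightarrow> 'b" assume "f \<noteq> g"
  then obtain i where "f i \<noteq> g i" by blast
  from t0_space_class.t0_space[OF this] obtain A where A: "open A" "\<not> (f i \<in> A \<longleftrightarrow> g i \<in> A)"
    by (elim exE conjE)
  then show "\<exists>U. open U \<and> \<not> (f \<in> U \<longleftrightarrow> g \<in> U)"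
    by (intro exI[of _ "(\<lambda>h. h i) -` A"]) (auto intro!: open_vimage)
qed

instance "fun" :: (type, t1_space) t1_space
proof
  fix f g :: "'a \<Rightarrow> 'b" assume "f \<noteq> g"
  then obtain i where "f i \<noteq> g i" by blast
  then obtain A where A: "open A" "f i \<in> A" "g i \<notin> A"
    by (meson t1_space)
  then show "\<exists>U. open U \<and> f \<in> U \<and> g \<notin> U"
    by (intro exI[of _ "(\<lambda>h. h i) -` A"]) (auto intro!: open_vimage)
qed

instance "fun" :: (type, t2_space) t2_space
proof
  fix f g :: "'a \<Rightarrow> 'b" assume "f \<noteq> g"
  then obtain i where "f i \<noteq> g i" by blast
  then obtain A B where AB: "open A" "open B" "f i \<in> A" "g i \<in> B" "A \<inter> B = {}"
    by (meson hausdorff)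
  have "open ((\<lambda>h :: 'a \<Rightarrow> 'b. h i) -` C)" if "open C" for C
    using that by (intro open_vimage) simp_all
  then show "\<exists>U V. open U \<and> open V \<and> f \<in> U \<and> g \<in> V \<and> U \<inter> V = {}"
    using AB by (intro exI[of _ "(\<lambda>h. h i) -` A"] exI[of _ "(\<lambda>h. h i) -` B"]) auto
qed

text \<open>Zorn's lemma for complements, so that maximal complements give minimal closed sets;
  compactness keeps the intersection of a chain nonempty. It serves both for subsemigroups and for
  left ideals.\<close>

lemma compact_minimal_closed:
  fixes K :: "'x::t2_space set" and P :: "'x set \<Rightarrow> bool"
  assumes K: "compact K" and ne: "K \<noteq> {}" and PK: "P K"
    and inter: "\<And>C. C \<noteq> {} \<Longrightarrow> \<forall>S\<in>C. P S \<and> S \<subseteq> K \<Longrightarrow> P (\<Inter>C)"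
  obtains M where "closed M" "M \<noteq> {}" "M \<subseteq> K" "P M"
    "\<And>S. closed S \<Longrightarrow> S \<noteq> {} \<Longrightarrow> S \<subseteq> M \<Longrightarrow> P S \<Longrightarrow> S = M"
proof -
  define Q where "Q S \<longleftrightarrow> closed S \<and> S \<noteq> {} \<and> S \<subseteq> K \<and> P S" for S
  have "\<exists>N\<in>{- S | S. Q S}. \<forall>X\<in>{- S | S. Q S}. N \<subseteq> X \<longrightarrow> X = N"
  proof (rule subset_Zorn_nonempty)
    show "{- S | S. Q S} \<noteq> {}" using assms unfolding Q_def by (auto intro: compact_imp_closed)
    fix \<C> assume ch: "\<C> \<noteq> {}" "subset.chain {- S | S. Q S} \<C>"
    define D where "D = uminus ` \<C>"
    have QD: "\<forall>S\<in>D. Q S" using ch(2) unfolding D_def subset.chain_def by fastforce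
    have Dne: "D \<noteq> {}" using ch(1) unfolding D_def by simp
    have "X \<subseteq> Y \<or> Y \<subseteq> X" if XY: "X \<in> \<C>" "Y \<in> \<C>" for X Y
      using ch(2) XY unfolding subset.chain_def by blast
    then have lin: "X \<subseteq> Y \<or> Y \<subseteq> X" if "X \<in> D" "Y \<in> D" for X Y
      using that unfolding D_def by (metis (no_types, lifting) Compl_subset_Compl_iff imageE)
    \<comment> \<open>Finite intersections of a chain of sets are members of the chain, which gives
      the finite intersection property.\<close>
    have fin: "E = {} \<or> \<Inter>E \<in> D" if "finite E" "E \<subseteq> D" for E
      using that
    proof (induction E rule: finite_induct)
      case (insert x E)
      show ?case
      proof (cases "E = {}")
        case False
        then have "x \<inter> \<Inter>E = x \<or> x \<inter> \<Inter>E = \<Inter>E" using insert lin[of x "\<Inter>E"] by blast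
        then show ?thesis using insert False by auto
      qed (use insert in auto)
    qed auto
    have "K \<inter> \<Inter>D \<noteq> {}"
    proof (rule compact_imp_fip[OF K])
      show "closed T" if "T \<in> D" for T using QD that Q_def by blast
      show "K \<inter> \<Inter>E \<noteq> {}" if "finite E" "E \<subseteq> D" for E
        using fin[OF that] QD ne unfolding Q_def by (metis Inf_empty Int_absorb1 Int_UNIV_right)
    qed
    moreover have "closed (\<Inter>D)" using QD Q_def by blast
    moreover have "P (\<Inter>D)" using inter[OF Dne] QD Q_def by blast
    moreover have "\<Inter>D \<subseteq> K" using Dne QD Q_def by blast
    ultimately have "Q (\<Inter>D)" unfolding Q_def by blast
    moreover have "\<Union>\<C> = - \<Inter>D" unfolding D_def by auto
    ultimately show "\<Union>\<C> \<in> {- S | S. Q S}" by blast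
  qed
  then obtain M where M: "Q M" "\<And>N. N \<in> {- S | S. Q S} \<Longrightarrow> - M \<subseteq> N \<Longrightarrow> N = - M"
    by (smt (verit) mem_Collect_eq)
  show ?thesis
  proof (rule that)
    show "S = M" if "closed S" "S \<noteq> {}" "S \<subseteq> M" "P S" for S
    proof -
      have "Q S" using M(1) that unfolding Q_def by blast
      then have "- S = - M" using M(2)[of "- S"] that(3) by blast
      then show ?thesis by simp
    qed
  qed (use M(1) Q_def in auto)
qed

section \<open>Idempotents in compact right topological semigroups\<close>

locale right_topological_semigroup =
  fixes mul :: "'x::t2_space \<Rightarrow> 'x \<Rightarrow> 'x" (infixl \<open>\<odot>\<close> 70)
  assumes assoc: "(a \<odot> b) \<odot> c = a \<odot> (b \<odot> c)"
    and cont: "continuous_on UNIV (\<lambda>a. a \<odot> b)"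
begin

definition subsemigroup :: "'x set \<Rightarrow> bool" where
  "subsemigroup S \<longleftrightarrow> (\<forall>a\<in>S. \<forall>b\<in>S. a \<odot> b \<in> S)"

lemma compact_translate: "compact S \<Longrightarrow> compact ((\<lambda>a. a \<odot> b) ` S)"
  by (rule compact_continuous_image[OF continuous_on_subset[OF cont]]) auto

text \<open>In a minimal compact subsemigroup \<open>M\<close> every \<open>e\<close> satisfies
  \<open>M e = M\<close>. Hence the closed subsemigroup of all \<open>a\<close> in \<open>M\<close>
  with \<open>a e = e\<close> is nonempty, equals \<open>M\<close> by minimality, and contains
  \<open>e\<close>.\<close>

theorem Ellis_idempotent:
  assumes "compact K" "K \<noteq> {}" "subsemigroup K"
  obtains e where "e \<in> K" "e \<odot> e = e"
proof -
  obtain M where M: "closed M" "M \<noteq> {}" "M \<subseteq> K" "subsemigroup M"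
    and min: "\<And>S. closed S \<Longrightarrow> S \<noteq> {} \<Longrightarrow> S \<subseteq> M \<Longrightarrow> subsemigroup S \<Longrightarrow> S = M"
  proof (rule compact_minimal_closed[OF assms(1,2), of subsemigroup])
    show "subsemigroup K" using assms(3) unfolding subsemigroup_def by blast
    show "subsemigroup (\<Inter>C)" if "C \<noteq> {}" "\<forall>S\<in>C. subsemigroup S \<and> S \<subseteq> K" for C
      using that unfolding subsemigroup_def by blast
  qed blast
  obtain e where e: "e \<in> M" using M(2) by blast
  have cM: "compact M" using assms(1) M(1,3) by (metis closed_Int_compact inf.absorb1)
  have "(\<lambda>a. a \<odot> e) ` M = M"
  proof (rule min)
    show "closed ((\<lambda>a. a \<odot> e) ` M)" using compact_translate[OF cM] by (rule compact_imp_closed)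
    show "subsemigroup ((\<lambda>a. a \<odot> e) ` M)"
      unfolding subsemigroup_def
    proof clarify
      fix a b assume "a \<in> M" "b \<in> M"
      then have "a \<odot> e \<odot> b \<in> M" using M(4) e unfolding subsemigroup_def by blast
      then show "a \<odot> e \<odot> (b \<odot> e) \<in> (\<lambda>a. a \<odot> e) ` M" by (auto simp: assoc[symmetric])
    qed
  qed (use M e in \<open>auto simp: subsemigroup_def\<close>)
  then have "\<exists>a\<in>M. a \<odot> e = e" using e by (metis imageE)
  then have ne: "{a \<in> M. a \<odot> e = e} \<noteq> {}" by blast
  have "{a \<in> M. a \<odot> e = e} = M"
  proof (rule min[OF _ ne])
    have "closed ((\<lambda>a. a \<odot> e) -` {e})"
      using continuous_on_closed_vimage[of UNIV "\<lambda>a. a \<odot> e"] cont by auto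
    moreover have "{a \<in> M. a \<odot> e = e} = M \<inter> (\<lambda>a. a \<odot> e) -` {e}" by auto
    ultimately show "closed {a \<in> M. a \<odot> e = e}" using M(1) by auto
    show "subsemigroup {a \<in> M. a \<odot> e = e}" using M(4) unfolding subsemigroup_def by (auto simp: assoc)
  qed auto
  then show ?thesis using e M(3) that by blast
qed

text \<open>Take \<open>r\<close> in a minimal closed left ideal \<open>M\<close>. An idempotent
  \<open>e\<close> below \<open>r\<close> lies in \<open>M\<close> because \<open>e = e r\<close>,
  so \<open>K e = M\<close> contains \<open>r\<close>; then \<open>r e = r\<close>, while
  \<open>r e = e\<close>.\<close>

lemma minimal_idempotent:
  assumes "compact K" "K \<noteq> {}" "subsemigroup K"
  obtains r where "r \<in> K" "r \<odot> r = r"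
    "\<And>e. e \<in> K \<Longrightarrow> e \<odot> e = e \<Longrightarrow> r \<odot> e = e \<Longrightarrow> e \<odot> r = e \<Longrightarrow> e = r"
proof -
  define ideal where "ideal L \<longleftrightarrow> (\<forall>a\<in>K. \<forall>b\<in>L. a \<odot> b \<in> L)" for L
  obtain M where M: "closed M" "M \<noteq> {}" "M \<subseteq> K" "ideal M"
    and min: "\<And>S. closed S \<Longrightarrow> S \<noteq> {} \<Longrightarrow> S \<subseteq> M \<Longrightarrow> ideal S \<Longrightarrow> S = M"
  proof (rule compact_minimal_closed[OF assms(1,2), of ideal])
    show "ideal K" using assms(3) unfolding subsemigroup_def ideal_def by blast
    show "ideal (\<Inter>C)" if "C \<noteq> {}" "\<forall>S\<in>C. ideal S \<and> S \<subseteq> K" for C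
      using that unfolding ideal_def by blast
  qed blast
  have cM: "compact M" using assms(1) M(1,3) by (metis closed_Int_compact inf.absorb1)
  have "subsemigroup M" using M(3,4) unfolding subsemigroup_def ideal_def by blast
  then obtain r where r: "r \<in> M" "r \<odot> r = r" using Ellis_idempotent[OF cM M(2)] by blast
  show ?thesis
  proof (rule that)
    fix e assume e: "e \<in> K" "e \<odot> e = e" "r \<odot> e = e" "e \<odot> r = e"
    have eM: "e \<in> M" using M(4) r(1) e(1,4) unfolding ideal_def by metis
    have "(\<lambda>a. a \<odot> e) ` K = M"
    proof (rule min)
      show "closed ((\<lambda>a. a \<odot> e) ` K)" using compact_translate[OF assms(1)] by (rule compact_imp_closed)
      show "ideal ((\<lambda>a. a \<odot> e) ` K)"
        using assms(3) unfolding ideal_def subsemigroup_def by (auto simp: assoc[symmetric])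
      show "(\<lambda>a. a \<odot> e) ` K \<subseteq> M" using M(4) eM unfolding ideal_def by blast
    qed (use assms(2) in auto)
    then obtain x where "r = x \<odot> e" using r(1) by (metis imageE)
    then have "r \<odot> e = r" using e(2) by (simp add: assoc)
    then show "e = r" using e(3) by simp
  qed (use r M(3) in auto)
qed

text \<open>Here \<open>q = r e\<close> for an idempotent \<open>e\<close> of the compact semigroup \<open>V r\<close>, so that \<open>q\<close> and every \<open>T q\<close>
  lie below \<open>r\<close>.\<close>

theorem Carlson_idempotents:
  assumes C: "compact C" "C \<noteq> {}" "subsemigroup C"
    and V: "compact V" "V \<noteq> {}" "subsemigroup V"
    and CV: "\<And>a b. a \<in> C \<Longrightarrow> b \<in> V \<Longrightarrow> a \<odot> b \<in> V \<and> b \<odot> a \<in> V"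
    and TC: "\<And>T a. T \<in> \<T> \<Longrightarrow> a \<in> C \<Longrightarrow> T a = a"
    and TV: "\<And>T a. T \<in> \<T> \<Longrightarrow> a \<in> V \<Longrightarrow> T a \<in> C"
    and hom: "\<And>T a b. T \<in> \<T> \<Longrightarrow> T (a \<odot> b) = T a \<odot> T b"
  obtains q r where "q \<in> V" "r \<in> C" "q \<odot> q = q" "r \<odot> r = r" "q \<odot> r = q" "r \<odot> q = q"
    "\<And>T. T \<in> \<T> \<Longrightarrow> T q = r"
proof -
  obtain r where r: "r \<in> C" "r \<odot> r = r"
    and min: "\<And>e. e \<in> C \<Longrightarrow> e \<odot> e = e \<Longrightarrow> r \<odot> e = e \<Longrightarrow> e \<odot> r = e \<Longrightarrow> e = r"
    using minimal_idempotent[OF C] by metis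
  have "subsemigroup ((\<lambda>a. a \<odot> r) ` V)"
    unfolding subsemigroup_def
  proof clarify
    fix a b assume "a \<in> V" "b \<in> V"
    then have "a \<odot> (r \<odot> b) \<in> V" using V(3) CV r(1) unfolding subsemigroup_def by blast
    then show "a \<odot> r \<odot> (b \<odot> r) \<in> (\<lambda>a. a \<odot> r) ` V" by (auto simp: assoc[symmetric])
  qed
  then obtain e where e: "e \<in> (\<lambda>a. a \<odot> r) ` V" "e \<odot> e = e"
    using Ellis_idempotent[OF compact_translate[OF V(1)]] V(2) by blast
  then obtain v where v: "v \<in> V" "e = v \<odot> r" by blast
  have er: "e \<odot> r = e" using v(2) r(2) by (simp add: assoc)
  define q where "q = r \<odot> e"
  have qV: "q \<in> V" using CV r(1) v unfolding q_def by blast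
  have qr: "q \<odot> r = q" using er by (simp add: q_def assoc)
  have rq: "r \<odot> q = q" using r(2) by (simp add: q_def assoc[symmetric])
  have "q \<odot> q = r \<odot> ((e \<odot> r) \<odot> e)" by (simp only: q_def assoc)
  then have qq: "q \<odot> q = q" using er e(2) by (simp add: q_def)
  have "T q = r" if T: "T \<in> \<T>" for T
  proof (rule min)
    show "T q \<odot> T q = T q" using hom[OF T, of q q] qq by simp
    show "r \<odot> T q = T q" using hom[OF T, of r q] rq TC[OF T r(1)] by simp
    show "T q \<odot> r = T q" using hom[OF T, of q r] qr TC[OF T r(1)] by simp
  qed (use TV T qV in auto)
  then show ?thesis by (rule that[OF qV r(1) qq r(2) qr rq])
qed

end

text \<open>The two equivalences already give upward closure and exclude the empty set, and each
  instance of them constrains finitely many coordinates, so the set is closed in the product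
  topology.\<close>

definition ultra :: "('b set \<Rightarrow> bool) set" where
  "ultra = {p. (\<forall>A B. p (A \<inter> B) \<longleftrightarrow> p A \<and> p B) \<and> (\<forall>A. p (- A) \<longleftrightarrow> \<not> p A)}"

lemma ultra_Int: "p \<in> ultra \<Longrightarrow> p (A \<inter> B) \<longleftrightarrow> p A \<and> p B"
  and ultra_Compl: "p \<in> ultra \<Longrightarrow> p (- A) \<longleftrightarrow> \<not> p A"
  unfolding ultra_def by blast+

lemma ultra_mono: "p \<in> ultra \<Longrightarrow> p A \<Longrightarrow> A \<subseteq> B \<Longrightarrow> p B"
  using ultra_Int[of p A B] by (simp add: Int_absorb2)

lemma ultra_UNIV: "p \<in> ultra \<Longrightarrow> p UNIV"
  using ultra_Int[of p "{}" UNIV] ultra_Compl[of p "{}"] ultra_mono[of p "{}" UNIV] by auto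

lemma ultra_nonempty: "p \<in> ultra \<Longrightarrow> p A \<Longrightarrow> A \<noteq> {}"
  using ultra_UNIV[of p] ultra_Compl[of p UNIV] by auto

lemma ultra_INT:
  assumes "p \<in> ultra" "finite I" "\<And>i. i \<in> I \<Longrightarrow> p (A i)"
  shows "p (\<Inter>i\<in>I. A i)"
  using assms(2,3) by (induction I rule: finite_induct) (auto simp: ultra_UNIV[OF assms(1)] ultra_Int[OF assms(1)])

lemma clopen_coordinate:
  fixes A :: "'b set"
  shows "closed {p :: 'b set \<Rightarrow> bool. p A}" "closed {p :: 'b set \<Rightarrow> bool. \<not> p A}"
proof -
  have c: "continuous_on UNIV (\<lambda>p :: 'b set \<Rightarrow> bool. p A)" by simp
  have "closed ((\<lambda>p :: 'b set \<Rightarrow> bool. p A) -` {True})"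
    "closed ((\<lambda>p :: 'b set \<Rightarrow> bool. p A) -` {False})"
    using c by (auto intro!: closed_vimage)
  moreover have "(\<lambda>p :: 'b set \<Rightarrow> bool. p A) -` {True} = {p. p A}"
     "(\<lambda>p :: 'b set \<Rightarrow> bool. p A) -` {False} = {p. \<not> p A}" by auto
  ultimately show "closed {p :: 'b set \<Rightarrow> bool. p A}" "closed {p :: 'b set \<Rightarrow> bool. \<not> p A}" by simp_all
qed

lemma compact_ultra: "compact (ultra :: ('b set \<Rightarrow> bool) set)"
proof -
  have "compact (UNIV :: ('b set \<Rightarrow> bool) set)"
  proof -
    have "compactin (product_topology (\<lambda>_. euclidean) UNIV) (PiE UNIV (\<lambda>_::'b set. UNIV :: bool set))"
      unfolding compactin_PiE by (auto intro: finite_imp_compact)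
    then show ?thesis by (simp add: euclidean_product_topology)
  qed
  moreover have eq: "ultra = (\<Inter>A::'b set. \<Inter>B. ({p. p (A \<inter> B)} \<inter> {p. p A} \<inter> {p. p B})
      \<union> ({p. \<not> p (A \<inter> B)} \<inter> ({p. \<not> p A} \<union> {p. \<not> p B})))
    \<inter> (\<Inter>A::'b set. ({p. p (- A)} \<inter> {p. \<not> p A}) \<union> ({p. \<not> p (- A)} \<inter> {p. p A}))"
    unfolding ultra_def by auto
  have "closed (ultra :: ('b set \<Rightarrow> bool) set)"
    unfolding eq by (intro closed_Int closed_INT closed_Un ballI clopen_coordinate)
  ultimately show ?thesis by (metis compact_Int_closed inf_top_left)
qed

text \<open>The extension of \<open>f\<close> to ultrafilters by iterated limits, first along
  \<open>q\<close> and then along \<open>p\<close>; in this order it is continuous in the left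
  argument.\<close>

definition ultra_mul :: "('b \<Rightarrow> 'b \<Rightarrow> 'b) \<Rightarrow> ('b set \<Rightarrow> bool) \<Rightarrow> ('b set \<Rightarrow> bool) \<Rightarrow> 'b set \<Rightarrow> bool" where
  "ultra_mul f p q A = p {x. q {y. f x y \<in> A}}"

definition ultra_map :: "('b \<Rightarrow> 'b) \<Rightarrow> ('b set \<Rightarrow> bool) \<Rightarrow> 'b set \<Rightarrow> bool" where
  "ultra_map T p A = p {x. T x \<in> A}"

lemma ultra_mul_ultra: "p \<in> ultra \<Longrightarrow> q \<in> ultra \<Longrightarrow> ultra_mul f p q \<in> ultra"
  unfolding ultra_def ultra_mul_def
  by (simp add: Collect_conj_eq Collect_neg_eq)

lemma ultra_map_ultra: "p \<in> ultra \<Longrightarrow> ultra_map T p \<in> ultra"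
  unfolding ultra_def ultra_map_def
  by (simp add: Collect_conj_eq Collect_neg_eq)

lemma ultra_mul_semigroup:
  assumes "\<And>a b c. f (f a b) c = f a (f b c)"
  shows "right_topological_semigroup (ultra_mul f)"
proof
  show "ultra_mul f (ultra_mul f a b) c = ultra_mul f a (ultra_mul f b c)" for a b c
    unfolding ultra_mul_def by (auto simp: fun_eq_iff assms)
  show "continuous_on UNIV (\<lambda>a. ultra_mul f a b)" for b
    unfolding ultra_mul_def by (rule continuous_on_coordinatewise_then_product) simp
qed

lemma ultra_map_mul:
  assumes "\<And>a b. T (f a b) = f (T a) (T b)"
  shows "ultra_map T (ultra_mul f p q) = ultra_mul f (ultra_map T p) (ultra_map T q)"
  unfolding ultra_mul_def ultra_map_def by (simp add: assms)

text \<open>By compactness finitely many conditions suffice, and these hold for the principal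
  ultrafilter at a point of the smallest set involved.\<close>

lemma ultra_filter_base:
  fixes B :: "nat \<Rightarrow> 'b set"
  assumes ne: "\<And>n. B n \<noteq> {}" and dec: "\<And>m n. m \<le> n \<Longrightarrow> B n \<subseteq> B m"
  shows "compact {p \<in> ultra. \<forall>n. p (B n)}" "{p \<in> ultra. \<forall>n. p (B n)} \<noteq> {}"
proof -
  have eq: "{p \<in> ultra. \<forall>n. p (B n)} = ultra \<inter> (\<Inter>n. {p. p (B n)})" by auto
  show "compact {p \<in> ultra. \<forall>n. p (B n)}"
    unfolding eq by (intro compact_Int_closed compact_ultra closed_INT ballI clopen_coordinate)
  show "{p \<in> ultra. \<forall>n. p (B n)} \<noteq> {}"
    unfolding eq
  proof (rule compact_imp_fip_image[OF compact_ultra clopen_coordinate(1)])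
    fix I :: "nat set" assume "finite I"
    then obtain m where m: "\<forall>n\<in>I. n \<le> m" by (meson finite_nat_set_iff_bounded_le)
    obtain x where x: "x \<in> B m" using ne by blast
    define p where "p = (\<lambda>A. x \<in> A)"
    have "p \<in> ultra" unfolding ultra_def p_def by auto
    moreover have "\<forall>n\<in>I. p (B n)" using m x dec unfolding p_def by blast
    ultimately show "ultra \<inter> (\<Inter>n\<in>I. {p. p (B n)}) \<noteq> {}" by auto
  qed
qed

section \<open>Extracted words\<close>

locale words =
  fixes \<alpha> :: "nat \<Rightarrow> 'a" and \<upsilon> :: 'a and k :: "nat \<Rightarrow> nat"
  assumes letter_neq_var: "\<And>i. i \<ge> 1 \<Longrightarrow> \<alpha> i \<noteq> \<upsilon>"
    and k_pos: "\<And>n. n \<ge> 1 \<Longrightarrow> k n \<ge> 1"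
    and k_mono: "\<And>m n. 1 \<le> m \<Longrightarrow> m \<le> n \<Longrightarrow> k m \<le> k n"
begin

abbreviation "T \<equiv> subst_var \<alpha> \<upsilon> k"
abbreviation "LW \<equiv> located_words \<alpha> \<upsilon> k"
abbreviation "Linf \<equiv> L_inf \<alpha> \<upsilon> k"
abbreviation "Lfin \<equiv> L_fin \<alpha> \<upsilon> k"
abbreviation "ev_on \<equiv> EV_on \<alpha> \<upsilon> k"
abbreviation "ev \<equiv> EV \<alpha> \<upsilon> k"
abbreviation "ev_tuple \<equiv> EV_tuple \<alpha> \<upsilon> k"
abbreviation "ev_fin \<equiv> EV_fin \<alpha> \<upsilon> k"
abbreviation "ev_fin_tuple \<equiv> EV_fin_tuple \<alpha> \<upsilon> k"
abbreviation "refining \<equiv> word_refines \<alpha> \<upsilon> k"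

text \<open>The requirement that some \<open>p\<close> be 0 is kept separate, because constant
  combinations are needed as intermediate objects.\<close>

definition valid :: "nat set \<Rightarrow> (nat \<times> nat) list \<Rightarrow> bool" where
  "valid I ps \<longleftrightarrow> sorted_wrt (<) (map fst ps) \<and> (\<forall>(n, p)\<in>set ps. n \<in> I \<and> p \<le> k n)"

definition comb :: "(nat \<Rightarrow> 'a lword) \<Rightarrow> (nat \<times> nat) list \<Rightarrow> 'a lword" where
  "comb W ps = foldr (++) (map (\<lambda>(n, p). T p (W n)) ps) Map.empty"

lemma EV_on_eq: "ev_on I W = {comb W ps | ps. valid I ps \<and> (\<exists>n. (n, 0) \<in> set ps)}"
proof -
  have "(\<exists>(n, p)\<in>set ps. p = 0) \<longleftrightarrow> (\<exists>n. (n, 0) \<in> set ps)" for ps :: "(nat \<times> nat) list" by auto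
  then show ?thesis unfolding EV_on_def valid_def comb_def by (simp add: conj_assoc)
qed

lemma EV_onI: "valid I ps \<Longrightarrow> (n, 0) \<in> set ps \<Longrightarrow> comb W ps \<in> ev_on I W"
  unfolding EV_on_eq by (intro CollectI exI[of _ ps]) auto

lemma EV_onE:
  assumes "x \<in> ev_on I W"
  obtains ps n where "x = comb W ps" "valid I ps" "(n, 0) \<in> set ps"
  using assms unfolding EV_on_eq by (elim CollectE exE conjE)

lemma valid_mono: "valid I ps \<Longrightarrow> I \<subseteq> J \<Longrightarrow> valid J ps"
  unfolding valid_def by auto

lemma valid_Nil [simp]: "valid I []"
  by (simp add: valid_def)

lemma valid_append:
  "valid I (ps @ qs) \<longleftrightarrow> valid I ps \<and> valid I qs \<and> (\<forall>i\<in>fst ` set ps. \<forall>j\<in>fst ` set qs. i < j)"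
  by (auto simp: valid_def sorted_wrt_append)

lemma valid_Cons:
  "valid I ((n, p) # qs) \<longleftrightarrow> n \<in> I \<and> p \<le> k n \<and> valid I qs \<and> (\<forall>j\<in>fst ` set qs. n < j)"
  by (auto simp: valid_def)

lemma valid_snoc:
  "valid I (ps @ [(n, p)]) \<longleftrightarrow> valid I ps \<and> n \<in> I \<and> p \<le> k n \<and> (\<forall>i\<in>fst ` set ps. i < n)"
  by (auto simp: valid_append valid_Cons)

lemma validD: "valid I ps \<Longrightarrow> (n, p) \<in> set ps \<Longrightarrow> n \<in> I \<and> p \<le> k n"
  by (auto simp: valid_def)

lemma EV_on_mono: "I \<subseteq> J \<Longrightarrow> ev_on I W \<subseteq> ev_on J W"
  unfolding EV_on_eq using valid_mono by blast

lemma comb_simps [simp]: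
  "comb W [] = Map.empty" "comb W ((n, p) # ps) = T p (W n) ++ comb W ps"
  by (simp_all add: comb_def)

lemma comb_append: "comb W (ps @ qs) = comb W ps ++ comb W qs"
  by (induction ps) auto

lemma T_0 [simp]: "T 0 w = w"
  by (simp add: subst_var_def)

lemma dom_T [simp]: "dom (T p w) = dom w"
  by (auto simp: subst_var_def dom_def)

lemma T_empty [simp]: "T p Map.empty = Map.empty"
  by (auto simp: subst_var_def)

lemma T_add: "T p (w ++ u) = T p w ++ T p u"
  by (auto simp: subst_var_def map_add_def fun_eq_iff split: option.splits)

lemma letter_neq_var': "1 \<le> p \<Longrightarrow> 1 \<le> n \<Longrightarrow> \<alpha> (min p (k n)) \<noteq> \<upsilon>"
  using letter_neq_var k_pos by simp

text \<open>Letters differ from the variable, so nothing is left to substitute after a nonzero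
  substitution.\<close>

lemma T_T: "dom w \<subseteq> {1..} \<Longrightarrow> T p (T q w) = T (if q = 0 then p else q) w"
  using letter_neq_var'[of q] by (fastforce simp: subst_var_def fun_eq_iff)

lemma T_no_var: "dom w \<subseteq> {1..} \<Longrightarrow> p \<ge> 1 \<Longrightarrow> \<upsilon> \<notin> ran (T p w)"
proof
  assume w: "dom w \<subseteq> {1..}" "p \<ge> 1" and "\<upsilon> \<in> ran (T p w)"
  then obtain n where n: "T p w n = Some \<upsilon>" by (auto simp: ran_def)
  then have "n \<in> dom (T p w)" by blast
  then have "n \<ge> 1" using w by auto
  then show False using n w(2) letter_neq_var'[of p n] by (auto simp: subst_var_def split: if_splits)
qed

lemma T_id: "\<upsilon> \<notin> ran w \<Longrightarrow> T p w = w"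
  by (auto simp: subst_var_def ran_def fun_eq_iff)

text \<open>The effect of \<open>T p\<close> on the list describing a word: only entries 0 still
  carry the variable.\<close>

definition sub :: "nat \<Rightarrow> (nat \<times> nat) list \<Rightarrow> (nat \<times> nat) list" where
  "sub p ps = map (\<lambda>(n, q). (n, if q = 0 then p else q)) ps"

lemma sub_0 [simp]: "sub 0 ps = ps"
  by (induction ps) (auto simp: sub_def)

lemma fst_sub: "map fst (sub p ps) = map fst ps"
  by (auto simp: sub_def)

lemma fst_set_sub [simp]: "fst ` set (sub p ps) = fst ` set ps"
  using arg_cong[OF fst_sub, of set p ps] by simp

lemma valid_sub: "valid I ps \<Longrightarrow> (\<And>n. n \<in> fst ` set ps \<Longrightarrow> p \<le> k n) \<Longrightarrow> valid I (sub p ps)"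
  unfolding valid_def fst_sub by (fastforce simp: sub_def)

lemma T_comb:
  assumes "\<And>n. n \<in> fst ` set ps \<Longrightarrow> dom (W n) \<subseteq> {1..}"
  shows "T p (comb W ps) = comb W (sub p ps)"
  using assms by (induction ps) (auto simp: T_add T_T sub_def)

lemma dom_comb: "dom (comb W ps) = (\<Union>n\<in>fst ` set ps. dom (W n))"
proof (induction ps)
  case (Cons a ps)
  obtain n p where a: "a = (n, p)" by (cases a)
  show ?case unfolding a comb_simps dom_map_add dom_T Cons.IH by auto
qed simp

lemma LW_dom: "w \<in> LW \<Longrightarrow> dom w \<noteq> {} \<and> finite (dom w) \<and> dom w \<subseteq> {1..}"
  by (auto simp: located_words_def)

lemma LW_var: "w \<in> LW \<Longrightarrow> \<upsilon> \<in> ran w"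
  by (auto simp: located_words_def)

lemma word_less_iff:
  "w \<in> LW \<Longrightarrow> u \<in> LW \<Longrightarrow> word_less w u \<longleftrightarrow> (\<forall>x\<in>dom w. \<forall>y\<in>dom u. x < y)"
  unfolding word_less_def using LW_dom[of w] LW_dom[of u] by (meson Max_in Max_less_iff Min_gr_iff Min_in)

lemma word_less_trans:
  "word_less w u \<Longrightarrow> word_less u v \<Longrightarrow> u \<in> LW \<Longrightarrow> word_less w v"
  unfolding word_less_def using LW_dom[of u] by (meson Min_le_iff Max_ge order.strict_trans order_le_less_trans Max_in)

lemma word_less_irrefl: "w \<in> LW \<Longrightarrow> \<not> word_less w w"
  using word_less_iff[of w w] LW_dom[of w] by (metis ex_in_conv less_irrefl)

text \<open>Covers infinite sequences, their tails and finite tuples at once, with \<open>J\<close>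
  equal to \<open>{1..}\<close>, \<open>{n..}\<close> or \<open>{1..l}\<close>.\<close>

definition wseq :: "nat set \<Rightarrow> (nat \<Rightarrow> 'a lword) \<Rightarrow> bool" where
  "wseq J W \<longleftrightarrow> J \<subseteq> {1..} \<and> (\<forall>n\<in>J. W n \<in> LW) \<and> (\<forall>m\<in>J. \<forall>n\<in>J. m < n \<longrightarrow> word_less (W m) (W n))"

lemma wseq_LW: "wseq J W \<Longrightarrow> n \<in> J \<Longrightarrow> W n \<in> LW"
  unfolding wseq_def by blast

lemma wseq_less:
  "wseq J W \<Longrightarrow> m \<in> J \<Longrightarrow> n \<in> J \<Longrightarrow> m < n \<Longrightarrow> x \<in> dom (W m) \<Longrightarrow> y \<in> dom (W n) \<Longrightarrow> x < y"
  unfolding wseq_def using word_less_iff by blast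

lemma wseq_pos: "wseq J W \<Longrightarrow> n \<in> J \<Longrightarrow> 1 \<le> n"
  unfolding wseq_def by auto

lemma wseq_dom:
  assumes "wseq J W" "n \<in> J" shows "dom (W n) \<noteq> {}" "finite (dom (W n))" "dom (W n) \<subseteq> {1..}"
  using LW_dom[OF wseq_LW[OF assms]] by blast+

lemma wseq_subset: "wseq J W \<Longrightarrow> I \<subseteq> J \<Longrightarrow> wseq I W"
  unfolding wseq_def by blast

lemma Linf_wseq: assumes "W \<in> Linf" shows "wseq {1..} W"
proof -
  have LW: "W n \<in> LW" "word_less (W n) (W (Suc n))" if "n \<ge> 1" for n
    using assms that unfolding L_inf_def by auto
  have "word_less (W m) (W n)" if "1 \<le> m" "m < n" for m n
    using that(2)
  proof (induction n)
    case (Suc n)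
    show ?case
    proof (cases "m = n")
      case True
      then show ?thesis using LW(2)[of m] that(1) by simp
    next
      case False
      then have "word_less (W m) (W n)" using Suc by simp
      then show ?thesis using word_less_trans LW[of n] that(1) Suc.prems by simp
    qed
  qed simp
  then show ?thesis unfolding wseq_def using LW by auto
qed

lemma Linf_dom_ge: assumes "W \<in> Linf" "n \<ge> 1" "x \<in> dom (W n)" shows "n \<le> x"
  using assms(2,3)
proof (induction n arbitrary: x)
  case (Suc n)
  have W: "wseq {1..} W" using assms(1) by (rule Linf_wseq)
  show ?case
  proof (cases "n = 0")
    case True
    then show ?thesis using wseq_dom(3)[OF W, of "Suc n"] Suc.prems by auto
  next
    case False
    then obtain y where y: "y \<in> dom (W n)" using wseq_dom(1)[OF W, of n] by auto
    then have "n \<le> y" using Suc False by simp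
    also have "y < x" using wseq_less[OF W _ _ _ y Suc.prems(2)] False by simp
    finally show ?thesis by simp
  qed
qed simp

lemma Lfin_wseq: assumes "ws \<in> Lfin" shows "wseq {1..length ws} (\<lambda>n. ws ! (n - 1))"
  using assms unfolding wseq_def L_fin_def by (auto simp: sorted_wrt_iff_nth_less subset_iff)

text \<open>Distinct terms have disjoint domains, so \<open>++\<close> never overwrites a
  letter.\<close>

lemma comb_apply:
  assumes "wseq J W" "valid J ps" "(n, p) \<in> set ps" "j \<in> dom (W n)"
  shows "comb W ps j = T p (W n) j"
  using assms(2,3)
proof (induction ps)
  case (Cons a ps)
  obtain m q where a: "a = (m, q)" by (cases a)
  have v: "valid J ps" "\<forall>j\<in>fst ` set ps. m < j" "m \<in> J" using Cons.prems(1) unfolding a valid_Cons by auto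
  show ?case
  proof (cases "(n, p) \<in> set ps")
    case True
    then have "comb W ps j = T p (W n) j" using Cons v by blast
    moreover obtain y where y: "T p (W n) j = Some y" using assms(4) dom_T[of p "W n"] by blast
    ultimately show ?thesis using a y by (simp add: map_add_def)
  next
    case False
    then have mn: "m = n" "q = p" using Cons.prems(2) a by auto
    have "j \<notin> dom (W i)" if i: "i \<in> fst ` set ps" for i
    proof
      assume "j \<in> dom (W i)"
      moreover have "i \<in> J" using i validD[OF v(1)] by auto
      moreover have "m < i" using v(2) i by blast
      ultimately show False using wseq_less[OF assms(1) v(3), of i j j] mn(1) assms(4) by blast
    qed
    then have "j \<notin> dom (comb W ps)" unfolding dom_comb by blast
    then have "comb W ps j = None" by (simp add: domIff)
    then show ?thesis using a mn by (simp add: map_add_def)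
  qed
qed simp

lemma LW_letter: "w \<in> LW \<Longrightarrow> j \<in> dom w \<Longrightarrow> the (T p w j) \<in> {\<upsilon>} \<union> \<alpha> ` {1..k j}"
proof -
  assume w: "w \<in> LW" "j \<in> dom w"
  have "j \<ge> 1" using LW_dom[OF w(1)] w(2) by auto
  then have "min p (k j) \<in> {1..k j}" if "p \<noteq> 0" using k_pos[of j] that by auto
  then have "\<alpha> (min p (k j)) \<in> \<alpha> ` {1..k j}" if "p \<noteq> 0" using that by blast
  moreover have "the (w j) \<in> {\<upsilon>} \<union> \<alpha> ` {1..k j}" using w unfolding located_words_def by blast
  ultimately show ?thesis by (auto simp: subst_var_def)
qed

lemma comb_LW:
  assumes "wseq J W" "valid J ps" "(n, 0) \<in> set ps"
  shows "comb W ps \<in> LW"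
  unfolding located_words_def
proof (intro CollectI conjI ballI)
  have nJ: "n \<in> J" using validD[OF assms(2,3)] by blast
  have J: "m \<in> J" if "m \<in> fst ` set ps" for m using that validD[OF assms(2)] by auto
  show "dom (comb W ps) \<noteq> {}"
    using wseq_dom(1)[OF assms(1) nJ] assms(3) unfolding dom_comb by force
  have "finite (dom (W m)) \<and> dom (W m) \<subseteq> {1..}" if "m \<in> fst ` set ps" for m
    using wseq_dom(2,3)[OF assms(1) J[OF that]] by blast
  then show "finite (dom (comb W ps))" "dom (comb W ps) \<subseteq> {1..}"
    unfolding dom_comb by (blast intro: finite_UN_I)+
  have "\<upsilon> \<in> ran (W n)" using LW_var wseq_LW[OF assms(1) nJ] by blast
  then obtain j where j: "W n j = Some \<upsilon>" by (auto simp: ran_def)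
  then show "\<upsilon> \<in> ran (comb W ps)"
    using comb_apply[OF assms, of j] by (metis T_0 domI ranI)
  fix j assume "j \<in> dom (comb W ps)"
  then obtain m where "m \<in> fst ` set ps" "j \<in> dom (W m)" unfolding dom_comb by blast
  then obtain p where mp: "(m, p) \<in> set ps" "j \<in> dom (W m)" by force
  then show "the (comb W ps j) \<in> {\<upsilon>} \<union> \<alpha> ` {1..k j}"
    using comb_apply[OF assms(1,2) mp] LW_letter[of "W m" j p] wseq_LW[OF assms(1)] validD[OF assms(2) mp(1)]
    by simp
qed

lemma EV_on_LW: "wseq J W \<Longrightarrow> ev_on J W \<subseteq> LW"
  using comb_LW by (blast elim: EV_onE)

text \<open>\<open>dom (W i)\<close> is part of \<open>dom (U m)\<close> and
  \<open>dom (W j)\<close> part of \<open>dom (U n)\<close>, so the order of the words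
  \<open>U\<close> forces the order of the indices used in \<open>W\<close>.\<close>

lemma reps_less:
  assumes U: "wseq J U" and W: "wseq I W" and mn: "m \<in> J" "n \<in> J" "m < n"
    and ps: "U m = comb W ps" "valid I ps" and qs: "U n = comb W qs" "valid I qs"
    and ij: "i \<in> fst ` set ps" "j \<in> fst ` set qs"
  shows "i < j"
proof (rule ccontr)
  assume "\<not> i < j"
  have iI: "i \<in> I" "j \<in> I" using ij validD[OF ps(2)] validD[OF qs(2)] by auto
  obtain a b where a: "a \<in> dom (W i)" and b: "b \<in> dom (W j)"
    using wseq_dom(1)[OF W] iI by blast
  have lt: "x < y" if "x \<in> dom (W i)" "y \<in> dom (W j)" for x y
  proof -
    have "x \<in> dom (U m)" "y \<in> dom (U n)" using that ij unfolding ps(1) qs(1) dom_comb by blast+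
    then show ?thesis using wseq_less[OF U mn] by blast
  qed
  show False
  proof (cases "i = j")
    case True
    then show ?thesis using lt[of a a] a by simp
  next
    case False
    then have "b < a" using \<open>\<not> i < j\<close> wseq_less[OF W iI(2,1) _ b a] by simp
    then show ?thesis using lt[OF a b] by simp
  qed
qed

text \<open>The hypothesis with \<open>{n..}\<close> is essential to the substitutions:
  \<open>p \<le> k n\<close> for the term \<open>U n\<close> becomes the same \<open>p\<close> for
  terms \<open>W i\<close> with \<open>i \<ge> n\<close>, where \<open>k n \<le> k i\<close> makes
  it admissible.\<close>

lemma EV_on_trans:
  assumes U: "wseq J U" and W: "wseq I W" and UW: "\<And>n. n \<in> J \<Longrightarrow> U n \<in> ev_on (I \<inter> {n..}) W"
  shows "ev_on J U \<subseteq> ev_on I W"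
proof
  have "\<forall>n\<in>J. \<exists>ps. U n = comb W ps \<and> valid (I \<inter> {n..}) ps \<and> (\<exists>i. (i, 0) \<in> set ps)"
    using UW by (meson EV_onE)
  then obtain Q where Q: "\<And>n. n \<in> J \<Longrightarrow> U n = comb W (Q n)"
      "\<And>n. n \<in> J \<Longrightarrow> valid (I \<inter> {n..}) (Q n)" "\<And>n. n \<in> J \<Longrightarrow> \<exists>i. (i, 0) \<in> set (Q n)"
    by metis
  have Q2: "valid I (Q n)" if "n \<in> J" for n using Q(2)[OF that] by (rule valid_mono) simp
  \<comment> \<open>Replaces each pair for \<open>U\<close> by the pairs of its representation in
    \<open>W\<close>, with the outer substitution pushed inside.\<close>
  define R where "R ps = concat (map (\<lambda>(n, p). sub p (Q n)) ps)" for ps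
  have main: "valid I (R ps) \<and> comb U ps = comb W (R ps) \<and>
      fst ` set (R ps) = (\<Union>n\<in>fst ` set ps. fst ` set (Q n))" if "valid J ps" for ps
    using that
  proof (induction ps)
    case (Cons a ps)
    obtain n p where a: "a = (n, p)" by (cases a)
    have n: "n \<in> J" "p \<le> k n" "valid J ps" "\<forall>j\<in>fst ` set ps. n < j"
      using Cons.prems unfolding a valid_Cons by auto
    have R: "R (a # ps) = sub p (Q n) @ R ps" by (simp add: R_def a)
    have QI: "i \<in> I \<and> n \<le> i" if "i \<in> fst ` set (Q n)" for i
      using that validD[OF Q(2)[OF n(1)]] by auto
    have "valid I (sub p (Q n))"
    proof (rule valid_sub[OF Q2[OF n(1)]])
      fix i assume "i \<in> fst ` set (Q n)"
      then have "k n \<le> k i" using QI wseq_pos[OF U n(1)] k_mono by blast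
      then show "p \<le> k i" using n(2) by simp
    qed
    moreover have "i < j" if ij: "i \<in> fst ` set (sub p (Q n))" "j \<in> fst ` set (R ps)" for i j
    proof -
      obtain m where m: "m \<in> fst ` set ps" "j \<in> fst ` set (Q m)" using Cons.IH[OF n(3)] ij(2) by blast
      then have "m \<in> J" using validD[OF n(3)] by auto
      then show ?thesis
        using reps_less[OF U W n(1) _ _ Q(1)[OF n(1)] Q2[OF n(1)], of m "Q m" i j] n(4) m ij(1) Q(1) Q2
        by simp
    qed
    ultimately have "valid I (R (a # ps))" unfolding R valid_append using Cons.IH[OF n(3)] by blast
    moreover have "T p (U n) = comb W (sub p (Q n))"
      unfolding Q(1)[OF n(1)] by (rule T_comb) (use QI wseq_dom(3)[OF W] in blast)
    ultimately show ?case using Cons.IH[OF n(3)] unfolding R comb_append by (simp add: a image_Un)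
  qed (simp add: R_def)
  fix x assume "x \<in> ev_on J U"
  then obtain ps n where ps: "x = comb U ps" "valid J ps" "(n, 0) \<in> set ps" by (rule EV_onE)
  \<comment> \<open>A term of \<open>U\<close> left unsubstituted keeps an unsubstituted term of
    \<open>W\<close>, so the flattened combination still contains the variable.\<close>
  obtain i where "(i, 0) \<in> set (Q n)" using Q(3) validD[OF ps(2,3)] by blast
  then have "(i, 0) \<in> set (R ps)" using ps(3) unfolding R_def by force
  then show "x \<in> ev_on I W" using main[OF ps(2)] ps(1) EV_onI by metis
qed

text \<open>The condition on \<open>J\<close> makes it an initial interval. Indices used by
  successive terms increase strictly and start at 1 or later, so the \<open>n\<close>-th term uses
  no index below \<open>n\<close>.\<close>

lemma EV_on_index:
  assumes U: "wseq J U" and W: "wseq I W" and UW: "\<And>n. n \<in> J \<Longrightarrow> U n \<in> ev_on I W"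
    and J: "\<And>n. Suc n \<in> J \<Longrightarrow> n = 0 \<or> n \<in> J" and n: "n \<in> J"
  shows "U n \<in> ev_on (I \<inter> {n..}) W"
proof -
  have "\<forall>n\<in>J. \<exists>ps. U n = comb W ps \<and> valid I ps \<and> (\<exists>i. (i, 0) \<in> set ps)"
    using UW by (meson EV_onE)
  then obtain Q where Q: "\<And>n. n \<in> J \<Longrightarrow> U n = comb W (Q n)"
      "\<And>n. n \<in> J \<Longrightarrow> valid I (Q n)" "\<And>n. n \<in> J \<Longrightarrow> \<exists>i. (i, 0) \<in> set (Q n)"
    by metis
  have ge: "n \<in> J \<Longrightarrow> i \<in> fst ` set (Q n) \<Longrightarrow> n \<le> i" for n i
  proof (induction n arbitrary: i)
    case (Suc n)
    show ?case
    proof (cases "n = 0")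
      case True
      have "i \<in> I" using Suc.prems(2) validD[OF Q(2)[OF Suc.prems(1)]] by auto
      then show ?thesis using wseq_pos[OF W] True by simp
    next
      case False
      then have nJ: "n \<in> J" using J[OF Suc.prems(1)] by blast
      then obtain j where j: "j \<in> fst ` set (Q n)" using Q(3) by force
      then have "n \<le> j" using Suc.IH nJ by blast
      also have "j < i"
        using reps_less[OF U W nJ Suc.prems(1) _ Q(1)[OF nJ] Q(2)[OF nJ] Q(1)[OF Suc.prems(1)]
          Q(2)[OF Suc.prems(1)] j Suc.prems(2)] by simp
      finally show ?thesis by simp
    qed
  qed simp
  have "valid (I \<inter> {n..}) (Q n)" using Q(2)[OF n] ge[OF n] unfolding valid_def by fastforce
  then show ?thesis using Q(1,3)[OF n] EV_onI by metis
qed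

lemma self_EV_on: "n \<in> I \<Longrightarrow> W n \<in> ev_on I W"
  using EV_onI[of I "[(n, 0)]" n W] by (simp add: valid_Cons)

lemma comb_cong: "(\<And>n. n \<in> fst ` set ps \<Longrightarrow> U n = W n) \<Longrightarrow> comb U ps = comb W ps"
  by (induction ps) auto

lemma EV_on_cong: "(\<And>n. n \<in> I \<Longrightarrow> U n = W n) \<Longrightarrow> ev_on I U = ev_on I W"
proof -
  assume eq: "\<And>n. n \<in> I \<Longrightarrow> U n = W n"
  have "comb U ps = comb W ps" if "valid I ps" for ps
  proof (rule comb_cong)
    fix n assume "n \<in> fst ` set ps"
    then obtain p where "(n, p) \<in> set ps" by force
    from validD[OF that this] show "U n = W n" using eq by blast
  qed
  then show ?thesis unfolding EV_on_eq by (intro Collect_cong) metis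
qed

section \<open>Refinement as a preorder, and words extracted from tuples\<close>

lemma refines_Linf: "refining U W \<Longrightarrow> U \<in> Linf"
  unfolding word_refines_def by blast

lemma refines_EV_on:
  assumes "refining U W" "W \<in> Linf" "1 \<le> n" shows "U n \<in> ev_on {n..} W"
proof -
  have "U n \<in> ev_on ({1..} \<inter> {n..}) W"
    by (rule EV_on_index[OF Linf_wseq[OF refines_Linf[OF assms(1)]] Linf_wseq[OF assms(2)]])
      (use assms in \<open>auto simp: word_refines_def EV_def\<close>)
  then show ?thesis by (rule set_mp[OF EV_on_mono, rotated]) auto
qed

lemma refines_EV_on_subset:
  assumes "refining U W" "W \<in> Linf" "1 \<le> n" shows "ev_on {n..} U \<subseteq> ev_on {n..} W"
proof (rule EV_on_trans)
  show "wseq {n..} U" "wseq {n..} W"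
    by (rule wseq_subset[OF Linf_wseq[OF refines_Linf[OF assms(1)]]], use assms(3) in force)
      (rule wseq_subset[OF Linf_wseq[OF assms(2)]], use assms(3) in force)
  fix m assume m: "m \<in> {n..}"
  then have "U m \<in> ev_on {m..} W" using refines_EV_on[OF assms(1,2), of m] assms(3) by simp
  moreover have "{m..} = {n..} \<inter> {m..}" using m by auto
  ultimately show "U m \<in> ev_on ({n..} \<inter> {m..}) W" by simp
qed

lemma refines_EV: "refining U W \<Longrightarrow> W \<in> Linf \<Longrightarrow> ev U \<subseteq> ev W"
  unfolding EV_def using refines_EV_on_subset[of U W 1] by simp

lemma refines_trans: "refining V U \<Longrightarrow> refining U W \<Longrightarrow> W \<in> Linf \<Longrightarrow> refining V W"
  using refines_EV[of U W] unfolding word_refines_def by blast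

lemma refines_refl: "W \<in> Linf \<Longrightarrow> refining W W"
  unfolding word_refines_def EV_def by (auto intro: self_EV_on)

lemma EV_LW: "W \<in> Linf \<Longrightarrow> ev W \<subseteq> LW"
  unfolding EV_def by (rule EV_on_LW[OF Linf_wseq])

lemma EV_fin_mono: "ev U \<subseteq> ev W \<Longrightarrow> ev_fin U \<subseteq> ev_fin W"
  unfolding EV_fin_def by blast

lemma EV_tuple_nth: "ws \<in> Lfin \<Longrightarrow> 1 \<le> n \<Longrightarrow> n \<le> length ws \<Longrightarrow> set ws \<subseteq> X \<Longrightarrow> ws ! (n - 1) \<in> X"
  by (auto simp: subset_iff)

lemma EV_tuple_EV:
  assumes "ws \<in> ev_fin W" "W \<in> Linf" shows "ev_tuple ws \<subseteq> ev W"
  unfolding EV_tuple_def EV_def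
proof (rule EV_on_trans[OF _ Linf_wseq[OF assms(2)]])
  have ws: "ws \<in> Lfin" "set ws \<subseteq> ev W" using assms(1) unfolding EV_fin_def by auto
  show seq: "wseq {1..length ws} (\<lambda>n. ws ! (n - 1))" by (rule Lfin_wseq[OF ws(1)])
  show "ws ! (n - 1) \<in> ev_on ({1..} \<inter> {n..}) W" if "n \<in> {1..length ws}" for n
    by (rule EV_on_index[OF seq Linf_wseq[OF assms(2)] _ _ that])
      (use ws EV_tuple_nth[OF ws(1)] in \<open>auto simp: EV_def\<close>)
qed

lemma EV_fin_tuple_index:
  assumes "ws \<in> Lfin" "vs \<in> ev_fin_tuple ws" "n \<in> {1..length vs}"
  shows "vs ! (n - 1) \<in> ev_on ({1..length ws} \<inter> {n..}) (\<lambda>n. ws ! (n - 1))"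
proof -
  have vs: "vs \<in> Lfin" "set vs \<subseteq> ev_tuple ws" using assms(2) unfolding EV_fin_tuple_def by auto
  show ?thesis
    by (rule EV_on_index[OF Lfin_wseq[OF vs(1)] Lfin_wseq[OF assms(1)] _ _ assms(3)])
      (use vs EV_tuple_nth[OF vs(1)] in \<open>auto simp: EV_tuple_def\<close>)
qed

lemma EV_tuple_trans:
  assumes "ws \<in> Lfin" "vs \<in> ev_fin_tuple ws" shows "ev_tuple vs \<subseteq> ev_tuple ws"
proof -
  have vs: "vs \<in> Lfin" using assms(2) unfolding EV_fin_tuple_def by auto
  show ?thesis
    unfolding EV_tuple_def
    by (rule EV_on_trans[OF Lfin_wseq[OF vs] Lfin_wseq[OF assms(1)] EV_fin_tuple_index[OF assms]])
qed

text \<open>The last word of \<open>vs\<close> uses only indices at least \<open>length vs\<close>,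
  and these must exist in \<open>ws\<close>.\<close>

lemma EV_fin_tuple_length:
  assumes "ws \<in> Lfin" "vs \<in> ev_fin_tuple ws" shows "length vs \<le> length ws"
proof (cases "vs = []")
  case False
  then have "length vs \<in> {1..length vs}" by (simp add: Suc_le_eq)
  from EV_fin_tuple_index[OF assms this] obtain ps n where "valid ({1..length ws} \<inter> {length vs..}) ps"
    "(n, 0) \<in> set ps" by (rule EV_onE)
  from validD[OF this] show ?thesis by simp
qed simp

lemma self_EV_tuple: "ws \<in> Lfin \<Longrightarrow> set ws \<subseteq> ev_tuple ws"
proof
  fix w assume "w \<in> set ws"
  then obtain i where i: "i < length ws" "w = ws ! i" by (auto simp: in_set_conv_nth)
  then show "w \<in> ev_tuple ws"
    unfolding EV_tuple_def using self_EV_on[of "Suc i" "{1..length ws}" "\<lambda>n. ws ! (n - 1)"] by simp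
qed

lemma EV_tuple_map_upt: "ev_tuple (map U [1..<Suc n]) = ev_on {1..n} U"
proof -
  have "ev_on {1..n} (\<lambda>i. map U [1..<Suc n] ! (i - 1)) = ev_on {1..n} U"
  proof (rule EV_on_cong)
    fix i assume "i \<in> {1..n}"
    then show "map U [1..<Suc n] ! (i - 1) = U i" by (subst nth_map) (auto simp del: upt_Suc)
  qed
  then show ?thesis unfolding EV_tuple_def by (simp del: upt_Suc)
qed

lemma EV_finite_support:
  assumes "x \<in> ev U" obtains n where "x \<in> ev_on {1..n} U"
proof -
  obtain ps m where ps: "x = comb U ps" "valid {1..} ps" "(m, 0) \<in> set ps"
    using assms unfolding EV_def by (rule EV_onE)
  obtain n where "\<forall>i\<in>fst ` set ps. i \<le> n" by (metis finite_imageI List.finite_set finite_nat_set_iff_bounded_le)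
  then have "valid {1..n} ps" using ps(2) unfolding valid_def by fastforce
  then show ?thesis using that ps EV_onI by blast
qed

lemma EV_fin_finite_support:
  assumes "vs \<in> ev_fin U" obtains n where "vs \<in> ev_fin_tuple (map U [1..<Suc n])"
proof -
  have "\<exists>n. set vs' \<subseteq> ev_on {1..n} U" if "set vs' \<subseteq> ev U" for vs'
    using that
  proof (induction vs')
    case (Cons v vs')
    then obtain n where n: "set vs' \<subseteq> ev_on {1..n} U" by auto
    obtain m where m: "v \<in> ev_on {1..m} U" using EV_finite_support[of v U] Cons.prems by auto
    have "ev_on {1..n} U \<subseteq> ev_on {1..max m n} U" "ev_on {1..m} U \<subseteq> ev_on {1..max m n} U"
      by (auto intro!: EV_on_mono)
    then show ?case using m n by (intro exI[of _ "max m n"]) auto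
  qed simp
  then obtain n where "set vs \<subseteq> ev_on {1..n} U" using assms unfolding EV_fin_def by blast
  then show ?thesis using that[of n] assms unfolding EV_fin_tuple_def EV_fin_def EV_tuple_map_upt by blast
qed

end

section \<open>The partition theorem for extracted words\<close>

lemma ultra_cong: "p \<in> ultra \<Longrightarrow> p B \<Longrightarrow> A \<inter> B = A' \<inter> B \<Longrightarrow> p A = p A'"
  using ultra_Int by metis

text \<open>Reduces closure properties of sets of ultrafilters to the question whether a fixed word
  can be followed by all sufficiently late ones.\<close>

lemma ultra_mul_closed:
  fixes X Y Z :: "nat \<Rightarrow> 'b set"
  assumes p: "p \<in> ultra" "\<And>n. p (X n)" and q: "q \<in> ultra" "\<And>n. q (Y n)"
    and XYZ: "\<And>n x. x \<in> X n \<Longrightarrow> \<exists>m. \<forall>y\<in>Y m. f x y \<in> Z n"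
  shows "ultra_mul f p q (Z n)"
proof -
  have "X n \<subseteq> {x. q {y. f x y \<in> Z n}}"
  proof clarify
    fix x assume "x \<in> X n"
    then obtain m where "\<forall>y\<in>Y m. f x y \<in> Z n" using XYZ by blast
    then show "q {y. f x y \<in> Z n}" by (intro ultra_mono[OF q(1) q(2)[of m]]) blast
  qed
  then show ?thesis unfolding ultra_mul_def by (rule ultra_mono[OF p(1) p(2)])
qed

context words
begin

text \<open>Ultrafilters containing all these sets concentrate on words far to the right, so that
  concatenation with any fixed word is eventually well ordered.\<close>

definition tail_combs :: "(nat \<Rightarrow> 'a lword) \<Rightarrow> nat \<Rightarrow> 'a lword set" where
  "tail_combs W n = {comb W ps | ps. valid {Suc n..} ps \<and> ps \<noteq> []}"

definition tail_var :: "(nat \<Rightarrow> 'a lword) \<Rightarrow> nat \<Rightarrow> 'a lword set" where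
  "tail_var W n = {x \<in> tail_combs W n. \<upsilon> \<in> ran x}"

definition tail_const :: "(nat \<Rightarrow> 'a lword) \<Rightarrow> nat \<Rightarrow> 'a lword set" where
  "tail_const W n = {x \<in> tail_combs W n. \<upsilon> \<notin> ran x}"

text \<open>Needed contrapositively: a variable in the word forces an entry 0 in the list, which
  turns members of \<open>tail_var\<close> into extracted words.\<close>

lemma comb_no_var:
  assumes "wseq J W" "valid J ps" "\<forall>(n, p)\<in>set ps. p \<noteq> 0"
  shows "\<upsilon> \<notin> ran (comb W ps)"
proof
  assume "\<upsilon> \<in> ran (comb W ps)"
  then obtain j where j: "comb W ps j = Some \<upsilon>" by (auto simp: ran_def)
  then have "j \<in> dom (comb W ps)" by blast
  then obtain n where "n \<in> fst ` set ps" "j \<in> dom (W n)" unfolding dom_comb by blast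
  then obtain p where p: "(n, p) \<in> set ps" "j \<in> dom (W n)" by force
  then have "T p (W n) j = Some \<upsilon>" using comb_apply[OF assms(1,2) p] j by simp
  moreover have "\<upsilon> \<notin> ran (T p (W n))"
    using T_no_var wseq_dom(3)[OF assms(1)] validD[OF assms(2) p(1)] assms(3) p(1) by fastforce
  ultimately show False by (auto intro: ranI)
qed

lemma tail_combs_mono: "m \<le> n \<Longrightarrow> tail_combs W n \<subseteq> tail_combs W m"
proof
  fix x assume mn: "m \<le> n" and "x \<in> tail_combs W n"
  then obtain ps where ps: "x = comb W ps" "valid {Suc n..} ps" "ps \<noteq> []" unfolding tail_combs_def by blast
  have "valid {Suc m..} ps" using ps(2) by (rule valid_mono) (use mn in auto)
  then show "x \<in> tail_combs W m" unfolding tail_combs_def using ps by blast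
qed

lemma tail_combs_dom:
  assumes W: "W \<in> Linf" and x: "x \<in> tail_combs W n"
  shows "finite (dom x)" "dom x \<subseteq> {Suc n..}"
proof -
  obtain ps where ps: "x = comb W ps" "valid {Suc n..} ps" using x unfolding tail_combs_def by blast
  have "finite (dom (W m)) \<and> dom (W m) \<subseteq> {Suc n..}" if m: "m \<in> fst ` set ps" for m
  proof -
    have "m \<ge> Suc n" using m validD[OF ps(2)] by auto
    then show ?thesis
      using Linf_dom_ge[OF W, of m] wseq_dom(2)[OF Linf_wseq[OF W], of m] by fastforce
  qed
  then show "finite (dom x)" "dom x \<subseteq> {Suc n..}" unfolding ps(1) dom_comb by (blast intro: finite_UN_I)+
qed

text \<open>\<open>m\<close> lies beyond the indices of \<open>x\<close>, so that the lists can be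
  appended, and beyond its domain, so that no letter is overwritten and the ranges simply
  unite.\<close>

lemma tail_combs_add:
  assumes W: "W \<in> Linf" and x: "x \<in> tail_combs W n"
  shows "\<exists>m. \<forall>y\<in>tail_combs W m. x ++ y \<in> tail_combs W n \<and> ran (x ++ y) = ran x \<union> ran y"
proof -
  obtain ps where ps: "x = comb W ps" "valid {Suc n..} ps" "ps \<noteq> []" using x unfolding tail_combs_def by blast
  obtain m1 where m1: "\<forall>i\<in>fst ` set ps. i \<le> m1"
    by (metis finite_imageI List.finite_set finite_nat_set_iff_bounded_le)
  obtain m2 where m2: "\<forall>i\<in>dom x. i \<le> m2"
    using tail_combs_dom(1)[OF W x] by (metis finite_nat_set_iff_bounded_le)
  define m where "m = max n (max m1 m2)"
  have "x ++ y \<in> tail_combs W n \<and> ran (x ++ y) = ran x \<union> ran y" if y: "y \<in> tail_combs W m" for y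
  proof
    obtain qs where qs: "y = comb W qs" "valid {Suc m..} qs" "qs \<noteq> []" using y unfolding tail_combs_def by blast
    have "valid {Suc n..} qs" using qs(2) by (rule valid_mono) (auto simp: m_def)
    moreover have "i < j" if "i \<in> fst ` set ps" "j \<in> fst ` set qs" for i j
      using m1 that validD[OF qs(2)] by (fastforce simp: m_def)
    ultimately have "valid {Suc n..} (ps @ qs)" unfolding valid_append using ps(2) by blast
    then show "x ++ y \<in> tail_combs W n"
      unfolding tail_combs_def ps(1) qs(1) comb_append[symmetric] using ps(3) by blast
    have "dom x \<inter> dom y = {}"
    proof -
      have "i \<notin> dom y" if "i \<in> dom x" for i
      proof
        assume "i \<in> dom y"
        then have "Suc m \<le> i" using tail_combs_dom(2)[OF W y] by auto
        then show False using m2 that by (force simp: m_def)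
      qed
      then show ?thesis by blast
    qed
    then show "ran (x ++ y) = ran x \<union> ran y" by (rule ran_map_add)
  qed
  then show ?thesis by blast
qed

definition var_ultra :: "(nat \<Rightarrow> 'a lword) \<Rightarrow> ('a lword set \<Rightarrow> bool) set" where
  "var_ultra W = {p \<in> ultra. \<forall>n. p (tail_var W n)}"

definition const_ultra :: "(nat \<Rightarrow> 'a lword) \<Rightarrow> ('a lword set \<Rightarrow> bool) set" where
  "const_ultra W = {p \<in> ultra. \<forall>n. p (tail_const W n)}"

text \<open>A substitution \<open>p\<close> may be too large for small indices, but
  \<open>p \<le> k n0\<close> makes it admissible at every index beyond \<open>n0\<close>; hence the
  maximum.\<close>

lemma T_tail_var:
  assumes W: "W \<in> Linf" and p: "p \<ge> 1" "n0 \<ge> 1" "p \<le> k n0" and x: "x \<in> tail_var W (max n n0)"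
  shows "T p x \<in> tail_const W n"
proof -
  obtain ps where ps: "x = comb W ps" "valid {Suc (max n n0)..} ps" "ps \<noteq> []"
    using x unfolding tail_var_def tail_combs_def by blast
  have ge: "i \<ge> Suc (max n n0)" if "i \<in> fst ` set ps" for i using that validD[OF ps(2)] by auto
  have "valid {Suc (max n n0)..} (sub p ps)"
  proof (rule valid_sub[OF ps(2)])
    fix i assume "i \<in> fst ` set ps"
    then have "k n0 \<le> k i" using ge[of i] p(2) by (intro k_mono) auto
    then show "p \<le> k i" using p(3) by simp
  qed
  then have "valid {Suc n..} (sub p ps)" by (rule valid_mono) auto
  moreover have "T p x = comb W (sub p ps)"
    unfolding ps(1) by (rule T_comb) (rule wseq_dom(3)[OF Linf_wseq[OF W]], use ge in force)
  moreover have "sub p ps \<noteq> []" using ps(3) by (simp add: sub_def)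
  ultimately have "T p x \<in> tail_combs W n" unfolding tail_combs_def by blast
  moreover have "x \<in> tail_combs W (max n n0)" using x unfolding tail_var_def by blast
  from tail_combs_dom(2)[OF W this] have "dom x \<subseteq> {1..}" by auto
  ultimately show ?thesis unfolding tail_const_def using T_no_var p(1) by blast
qed

lemma Carlson_ultrafilters:
  assumes W: "W \<in> Linf"
  obtains q r where "q \<in> var_ultra W" "r \<in> const_ultra W"
    "ultra_mul (++) q q = q" "ultra_mul (++) r r = r" "ultra_mul (++) q r = q" "ultra_mul (++) r q = q"
    "\<And>p n. 1 \<le> p \<Longrightarrow> 1 \<le> n \<Longrightarrow> p \<le> k n \<Longrightarrow> ultra_map (T p) q = r"
proof -
  interpret S: right_topological_semigroup "ultra_mul ((++) :: 'a lword \<Rightarrow> _)"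
    by (rule ultra_mul_semigroup) (simp add: map_add_assoc)
  have W1: "wseq {1..} W" using W by (rule Linf_wseq)
  have tv: "W (Suc n) \<in> tail_var W n" for n
  proof -
    have "W (Suc n) \<in> tail_combs W n"
      unfolding tail_combs_def by (intro CollectI exI[of _ "[(Suc n, 0)]"]) (simp add: valid_Cons)
    then show ?thesis unfolding tail_var_def using LW_var[OF wseq_LW[OF W1, of "Suc n"]] by simp
  qed
  have tc: "T 1 (W (Suc n)) \<in> tail_const W n" for n
  proof -
    have "T 1 (W (Suc n)) \<in> tail_combs W n"
      unfolding tail_combs_def using k_pos[of "Suc n"]
      by (intro CollectI exI[of _ "[(Suc n, 1)]"]) (simp add: valid_Cons)
    then show ?thesis
      unfolding tail_const_def using T_no_var[of "W (Suc n)" 1] wseq_dom(3)[OF W1, of "Suc n"] by simp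
  qed
  have mono: "tail_var W n \<subseteq> tail_var W m" "tail_const W n \<subseteq> tail_const W m" if "m \<le> n" for m n
    using tail_combs_mono[OF that] unfolding tail_var_def tail_const_def by auto
  note closed = ultra_mul_closed[where f = "(++)"]
  have add_var: "\<exists>m. \<forall>y\<in>tail_var W m. x ++ y \<in> tail_var W n" if "x \<in> tail_combs W n" for x n
    using tail_combs_add[OF W that] unfolding tail_var_def by blast
  have add_const: "\<exists>m. \<forall>y\<in>tail_const W m. x ++ y \<in> tail_var W n" if "x \<in> tail_var W n" for x n
    using tail_combs_add[OF W, of x n] that unfolding tail_var_def tail_const_def by blast
  have add_const2: "\<exists>m. \<forall>y\<in>tail_const W m. x ++ y \<in> tail_const W n" if "x \<in> tail_const W n" for x n
    using tail_combs_add[OF W, of x n] that unfolding tail_const_def by blast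
  have var_combs: "x \<in> tail_combs W n" if "x \<in> tail_var W n" for x n
    using that unfolding tail_var_def by blast
  \<comment> \<open>All values of \<open>p\<close> below some \<open>k n\<close> are treated
    together, possibly infinitely many, so that one pair \<open>q\<close>, \<open>r\<close> serves
    every substitution.\<close>
  define \<T> where "\<T> = {ultra_map (T p) | p. 1 \<le> p \<and> (\<exists>n\<ge>1. p \<le> k n)}"
  show ?thesis
  proof (rule S.Carlson_idempotents[of "const_ultra W" "var_ultra W" \<T>])
    show "compact (const_ultra W)" "const_ultra W \<noteq> {}"
      unfolding const_ultra_def by (rule ultra_filter_base; use tc mono in blast)+
    show "compact (var_ultra W)" "var_ultra W \<noteq> {}"
      unfolding var_ultra_def by (rule ultra_filter_base; use tv mono in blast)+
    show "S.subsemigroup (const_ultra W)"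
      unfolding S.subsemigroup_def const_ultra_def
      by (auto intro!: ultra_mul_ultra closed[of _ "tail_const W" _ "tail_const W"] add_const2)
    show "S.subsemigroup (var_ultra W)"
      unfolding S.subsemigroup_def var_ultra_def
      by (auto intro!: ultra_mul_ultra closed[of _ "tail_var W" _ "tail_var W"] add_var var_combs)
    show "ultra_mul (++) a b \<in> var_ultra W \<and> ultra_mul (++) b a \<in> var_ultra W"
      if "a \<in> const_ultra W" "b \<in> var_ultra W" for a b
    proof -
      have ab: "a \<in> ultra" "b \<in> ultra" "\<And>n. a (tail_const W n)" "\<And>n. b (tail_var W n)"
        using that unfolding var_ultra_def const_ultra_def by auto
      have "ultra_mul (++) a b (tail_var W n)" for n
        by (rule closed[of _ "tail_const W" _ "tail_var W"]) (use ab add_var in \<open>auto simp: tail_const_def\<close>)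
      moreover have "ultra_mul (++) b a (tail_var W n)" for n
        by (rule closed[of _ "tail_var W" _ "tail_const W"]) (use ab add_const in auto)
      ultimately show ?thesis using ab ultra_mul_ultra unfolding var_ultra_def by blast
    qed
    show "S a = a" if S: "S \<in> \<T>" and a: "a \<in> const_ultra W" for S a
    proof
      fix A
      obtain p where p: "S = ultra_map (T p)" using S unfolding \<T>_def by blast
      have a: "a \<in> ultra" "a (tail_const W 0)" using a unfolding const_ultra_def by auto
      show "S a A = a A"
        unfolding p ultra_map_def by (rule ultra_cong[OF a]) (auto simp: tail_const_def T_id)
    qed
    show "S a \<in> const_ultra W" if S: "S \<in> \<T>" and a: "a \<in> var_ultra W" for S a
    proof -
      obtain p n0 where p: "S = ultra_map (T p)" "1 \<le> p" "1 \<le> n0" "p \<le> k n0"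
        using S unfolding \<T>_def by blast
      have a: "a \<in> ultra" "\<And>n. a (tail_var W n)" using a unfolding var_ultra_def by auto
      have "a {x. T p x \<in> tail_const W n}" for n
        by (rule ultra_mono[OF a(1) a(2)[of "max n n0"]]) (use T_tail_var[OF W p(2-4)] in blast)
      then show ?thesis unfolding p(1) const_ultra_def using ultra_map_ultra[OF a(1)]
        by (auto simp: ultra_map_def)
    qed
    show "S (ultra_mul (++) a b) = ultra_mul (++) (S a) (S b)" if S: "S \<in> \<T>" for S a b
    proof -
      obtain p where "S = ultra_map (T p)" using S unfolding \<T>_def by blast
      then show ?thesis using ultra_map_mul[of "T p" "(++)", OF T_add] by simp
    qed
    fix q r assume qr: "q \<in> var_ultra W" "r \<in> const_ultra W" "ultra_mul (++) q q = q"
      "ultra_mul (++) r r = r" "ultra_mul (++) q r = q" "ultra_mul (++) r q = q"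
      "\<And>S. S \<in> \<T> \<Longrightarrow> S q = r"
    show thesis
    proof (rule that[OF qr(1-6)])
      show "ultra_map (T p) q = r" if "1 \<le> p" "1 \<le> n" "p \<le> k n" for p n
        by (rule qr(7)) (use that in \<open>auto simp: \<T>_def\<close>)
    qed
  qed
qed

text \<open>A Galvin-Glazer style construction: each term of \<open>U\<close> is taken from a
  \<open>q\<close>-large set chosen so that all combinations formed so far, under all admissible
  substitutions, stay \<open>good\<close>.\<close>

lemma partition_aux:
  assumes W: "W \<in> Linf" and q: "q \<in> var_ultra W" and r: "r \<in> const_ultra W"
    and qq: "ultra_mul (++) q q = q" and rr: "ultra_mul (++) r r = r"
    and qr: "ultra_mul (++) q r = q" and rq: "ultra_mul (++) r q = q"
    and Tq: "\<And>p n. 1 \<le> p \<Longrightarrow> 1 \<le> n \<Longrightarrow> p \<le> k n \<Longrightarrow> ultra_map (T p) q = r"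
    and A: "q A"
  shows "\<exists>U. refining U W \<and> ev U \<subseteq> A"
proof -
  have q1: "q \<in> ultra" "\<And>n. q (tail_var W n)" using q unfolding var_ultra_def by auto
  have r1: "r \<in> ultra" "\<And>n. r (tail_const W n)" using r unfolding const_ultra_def by auto
  \<comment> \<open>The product law unfolded: if \<open>t\<close>-most words complete
    \<open>v\<close> into \<open>A\<close>, then for \<open>p\<close>-most \<open>y\<close> it is
    true that \<open>s\<close>-most words complete \<open>v ++ y\<close>.\<close>
  have mulD: "p {y. s {z. (v ++ y) ++ z \<in> A}}" if "ultra_mul (++) p s = t" "t {y. v ++ y \<in> A}" for p s t v
  proof -
    have "ultra_mul (++) p s {y. v ++ y \<in> A}" using that by simp
    then show ?thesis unfolding ultra_mul_def by (simp add: map_add_assoc)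
  qed
  \<comment> \<open>The invariant under which any combination found so far can still be extended inside \<open>A\<close>.
    A constant combination needs no condition on \<open>r\<close>, since \<open>r q = q\<close>.\<close>
  define good where "good v \<longleftrightarrow> finite (dom v) \<and> q {y. v ++ y \<in> A} \<and>
    (\<upsilon> \<in> ran v \<longrightarrow> v \<in> A \<and> r {y. v ++ y \<in> A})" for v
  have good_step: "q {y. good (v ++ T p y)}" if v: "good v" and n: "1 \<le> n" "p \<le> k n" for v p n
  proof -
    have fin: "finite (dom v)" and qv: "q {y. v ++ y \<in> A}" using v unfolding good_def by auto
    obtain m where m: "\<forall>i\<in>dom v. i \<le> m" using fin by (metis finite_nat_set_iff_bounded_le)
    have far: "finite (dom (v ++ y)) \<and> ran (v ++ y) = ran v \<union> ran y" if y: "y \<in> tail_combs W m" for y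
    proof -
      have "i \<notin> dom y" if "i \<in> dom v" for i
      proof
        assume "i \<in> dom y"
        then have "Suc m \<le> i" using tail_combs_dom(2)[OF W y] by auto
        then show False using m that by force
      qed
      then have "dom v \<inter> dom y = {}" by blast
      then show ?thesis using fin tail_combs_dom(1)[OF W y] by (simp add: ran_map_add)
    qed
    show ?thesis
    proof (cases "p = 0")
      case True
      have "q (tail_var W m \<inter> {y. v ++ y \<in> A} \<inter> {y. q {z. (v ++ y) ++ z \<in> A}} \<inter> {y. r {z. (v ++ y) ++ z \<in> A}})"
        using q1(2) qv mulD[OF qq qv] mulD[OF qr qv] by (simp only: ultra_Int[OF q1(1)])
      then show ?thesis
        by (rule ultra_mono[OF q1(1)]) (use far in \<open>auto simp: True good_def tail_var_def\<close>)
    next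
      case False
      \<comment> \<open>As \<open>T p\<close> sends \<open>q\<close> to \<open>r\<close>, a
        statement about \<open>r\<close>-most constant words is enough here.\<close>
      have "r {y. good (v ++ y)}"
      proof (cases "\<upsilon> \<in> ran v")
        case True
        then have rv: "r {y. v ++ y \<in> A}" using v unfolding good_def by blast
        have "r (tail_const W m \<inter> {y. v ++ y \<in> A} \<inter> {y. q {z. (v ++ y) ++ z \<in> A}} \<inter> {y. r {z. (v ++ y) ++ z \<in> A}})"
          using r1(2) rv mulD[OF rq qv] mulD[OF rr rv] by (simp only: ultra_Int[OF r1(1)])
        then show ?thesis
          by (rule ultra_mono[OF r1(1)]) (use far in \<open>auto simp: good_def tail_const_def\<close>)
      next
        case False
        have "r (tail_const W m \<inter> {y. q {z. (v ++ y) ++ z \<in> A}})"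
          using r1(2) mulD[OF rq qv] by (simp only: ultra_Int[OF r1(1)])
        then show ?thesis
          by (rule ultra_mono[OF r1(1)]) (use far False in \<open>auto simp: good_def tail_const_def\<close>)
      qed
      moreover have "ultra_map (T p) q = r" using Tq[of p n] False n by simp
      ultimately have "ultra_map (T p) q {y. good (v ++ y)}" by simp
      then show ?thesis unfolding ultra_map_def by simp
    qed
  qed
  \<comment> \<open>In a state, \<open>E\<close> collects the combinations of the terms chosen so
    far, the empty one included, \<open>N\<close> bounds the domain of the last term and
    \<open>x\<close> is that term. The initial \<open>x\<close> is a dummy, since terms are counted
    from 1.\<close>
  define P where "P = (\<lambda>(n::nat) (E, N::nat, x::'a lword). finite E \<and> Map.empty \<in> E \<and> (\<forall>v\<in>E. good v))"
  define Q where "Q = (\<lambda>n (E, N, x::'a lword) (E', N', x').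
    x' \<in> tail_var W N \<and> dom x' \<subseteq> {..N'} \<and> E' = E \<union> {v ++ T p x' | v p. v \<in> E \<and> p \<le> k (Suc n)})"
  have "\<exists>f. \<forall>n. P n (f n) \<and> Q n (f n) (f (Suc n))"
  proof (rule dependent_nat_choice)
    have "good Map.empty" unfolding good_def using A by simp
    then show "\<exists>s. P 0 s" unfolding P_def by (intro exI[of _ "({Map.empty}, 0, Map.empty)"]) simp
    fix s n assume "P n s"
    obtain E N x where s: "s = (E, N, x)" by (cases s)
    have E: "finite E" "Map.empty \<in> E" "\<forall>v\<in>E. good v" using \<open>P n s\<close> unfolding P_def s by auto
    \<comment> \<open>The next term gets index \<open>Suc n\<close>, so the substitutions up to
      \<open>k (Suc n)\<close> have to be respected: finitely many \<open>q\<close>-large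
      conditions.\<close>
    have "q (\<Inter>(v, p)\<in>E \<times> {..k (Suc n)}. {y. good (v ++ T p y)})"
      by (rule ultra_INT[OF q1(1)]) (use E good_step[of _ "Suc n"] in auto)
    then have "q (tail_var W N \<inter> (\<Inter>(v, p)\<in>E \<times> {..k (Suc n)}. {y. good (v ++ T p y)}))"
      using q1(2) by (simp only: ultra_Int[OF q1(1)])
    from ultra_nonempty[OF q1(1) this] obtain x' where x': "x' \<in> tail_var W N"
      "\<And>v p. v \<in> E \<Longrightarrow> p \<le> k (Suc n) \<Longrightarrow> good (v ++ T p x')" by auto
    have "x' \<in> tail_combs W N" using x'(1) unfolding tail_var_def by blast
    from tail_combs_dom(1)[OF W this] obtain N' where N': "dom x' \<subseteq> {..N'}"
      by (metis atMost_iff finite_nat_set_iff_bounded_le subsetI)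
    define E' where "E' = E \<union> {v ++ T p x' | v p. v \<in> E \<and> p \<le> k (Suc n)}"
    have "{v ++ T p x' | v p. v \<in> E \<and> p \<le> k (Suc n)} = (\<lambda>(v, p). v ++ T p x') ` (E \<times> {..k (Suc n)})"
      by auto
    then have "finite E'" unfolding E'_def using E(1) by simp
    then have "P (Suc n) (E', N', x')" unfolding P_def E'_def using E x'(2) by auto
    moreover have "Q n s (E', N', x')" unfolding Q_def s E'_def using x'(1) N' by simp
    ultimately show "\<exists>t. P (Suc n) t \<and> Q n s t" by blast
  qed
  then obtain f where f: "\<And>n. P n (f n)" "\<And>n. Q n (f n) (f (Suc n))" by blast
  define E where "E n = fst (f n)" for n
  define N where "N n = fst (snd (f n))" for n
  define U where "U n = snd (snd (f n))" for n
  have f_eq: "f n = (E n, N n, U n)" for n unfolding E_def N_def U_def by simp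
  have E0: "Map.empty \<in> E n" "\<And>v. v \<in> E n \<Longrightarrow> good v" for n
    using f(1)[of n] unfolding P_def f_eq by auto
  have US: "U (Suc n) \<in> tail_var W (N n)" "dom (U (Suc n)) \<subseteq> {..N (Suc n)}"
    "E (Suc n) = E n \<union> {v ++ T p (U (Suc n)) | v p. v \<in> E n \<and> p \<le> k (Suc n)}" for n
    using f(2)[of n] unfolding Q_def f_eq by auto
  have Uev: "U (Suc n) \<in> ev W" for n
  proof -
    obtain ps where ps: "U (Suc n) = comb W ps" "valid {Suc (N n)..} ps" "\<upsilon> \<in> ran (U (Suc n))"
      using US(1)[of n] unfolding tail_var_def tail_combs_def by blast
    have v: "valid {1..} ps" using ps(2) by (rule valid_mono) auto
    have "\<not> (\<forall>(n, p)\<in>set ps. p \<noteq> 0)" using comb_no_var[OF Linf_wseq[OF W] v] ps(1,3) by metis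
    then obtain i where "(i, 0) \<in> set ps" by auto
    then show ?thesis unfolding ps(1) EV_def using EV_onI[OF v] by blast
  qed
  have ULW: "U (Suc n) \<in> LW" for n using Uev EV_LW[OF W] by blast
  have Uinf: "U \<in> Linf"
    unfolding L_inf_def
  proof (intro CollectI allI impI conjI)
    fix n :: nat assume n: "1 \<le> n"
    obtain m where m: "n = Suc m" using n by (cases n) auto
    show "U n \<in> LW" unfolding m by (rule ULW)
    have "U (Suc n) \<in> tail_combs W (N n)" using US(1)[of n] unfolding tail_var_def by blast
    from tail_combs_dom(2)[OF W this] have "dom (U (Suc n)) \<subseteq> {Suc (N n)..}" .
    moreover have "dom (U n) \<subseteq> {..N n}" using US(2)[of m] m by simp
    ultimately show "word_less (U n) (U (Suc n))"
      using word_less_iff[OF ULW[of m] ULW[of n]] m by fastforce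
  qed
  have ref: "refining U W"
    unfolding word_refines_def
  proof (intro conjI allI impI Uinf)
    show "U n \<in> ev W" if "n \<ge> 1" for n using Uev[of "n - 1"] that by simp
  qed
  have Emono: "E m \<subseteq> E n" if "m \<le> n" for m n
    using that by (rule lift_Suc_mono_le[rotated]) (use US(3) in blast)
  have combE: "comb U ps \<in> E n" if "valid {1..n} ps" for ps n
    using that
  proof (induction ps arbitrary: n rule: rev_induct)
    case Nil
    then show ?case using E0 by simp
  next
    case (snoc a ps)
    obtain m p where a: "a = (m, p)" by (cases a)
    have v: "valid {1..n} ps" "m \<in> {1..n}" "p \<le> k m" "\<forall>i\<in>fst ` set ps. i < m"
      using snoc.prems unfolding a valid_snoc by auto
    obtain l where l: "m = Suc l" using v(2) by (cases m) auto
    have "valid {1..l} ps" using v(1,4) l unfolding valid_def by fastforce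
    then have "comb U ps \<in> E l" by (rule snoc.IH)
    then have "comb U ps ++ T p (U m) \<in> E m" using US(3)[of l] v(3) l by blast
    moreover have "comb U (ps @ [a]) = comb U ps ++ T p (U m)" by (simp add: comb_append a)
    ultimately show ?case using Emono[of m n] v(2) by auto
  qed
  have "ev U \<subseteq> A"
  proof
    fix x assume x: "x \<in> ev U"
    then obtain n where "x \<in> ev_on {1..n} U" by (rule EV_finite_support)
    then obtain ps where "x = comb U ps" "valid {1..n} ps" by (rule EV_onE)
    then have "good x" using combE E0(2) by blast
    then show "x \<in> A" using LW_var EV_LW[OF Uinf] x unfolding good_def by blast
  qed
  then show ?thesis using ref by blast
qed

theorem word_partition:
  assumes W: "W \<in> Linf"
  shows "\<exists>U. refining U W \<and> (ev U \<subseteq> A \<or> ev U \<inter> A = {})"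
proof -
  obtain q r where qr: "q \<in> var_ultra W" "r \<in> const_ultra W"
    "ultra_mul (++) q q = q" "ultra_mul (++) r r = r" "ultra_mul (++) q r = q" "ultra_mul (++) r q = q"
    "\<And>p n. 1 \<le> p \<Longrightarrow> 1 \<le> n \<Longrightarrow> p \<le> k n \<Longrightarrow> ultra_map (T p) q = r"
    using Carlson_ultrafilters[OF W] by metis
  have "q \<in> ultra" using qr(1) unfolding var_ultra_def by blast
  then have "q A \<or> q (- A)" using ultra_Compl by blast
  moreover have "\<exists>U. refining U W \<and> ev U \<subseteq> B" if "q B" for B
    by (rule partition_aux[OF W qr(1-6) _ that]) (rule qr(7))
  ultimately show ?thesis by blast
qed

section \<open>Fusion and the dichotomy for Schreier families\<close>

lemma Lfin_append:
  "ws @ vs \<in> Lfin \<longleftrightarrow> ws \<in> Lfin \<and> vs \<in> Lfin \<and> (\<forall>w\<in>set ws. \<forall>v\<in>set vs. word_less w v)"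
  unfolding L_fin_def by (auto simp: sorted_wrt_append)

lemma Lfin_Cons:
  "t # vs \<in> Lfin \<longleftrightarrow> t \<in> LW \<and> vs \<in> Lfin \<and> (\<forall>v\<in>set vs. word_less t v)"
  unfolding L_fin_def by auto

lemma Lfin_Nil [simp]: "[] \<in> Lfin"
  unfolding L_fin_def by simp

lemma ev_fin_Lfin: "ws \<in> ev_fin U \<Longrightarrow> ws \<in> Lfin"
  unfolding EV_fin_def by blast

lemma ev_fin_Nil [simp]: "[] \<in> ev_fin U"
  unfolding EV_fin_def by simp

text \<open>Bounded positions allow finitely many letters each, so that a fusion stage has only
  finitely many conditions to meet.\<close>

lemma finite_words_below: "finite {t \<in> LW. dom t \<subseteq> {..N}}"
proof -
  define B where "B = insert \<upsilon> (\<Union>j\<le>N. \<alpha> ` {1..k j})"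
  have "{t \<in> LW. dom t \<subseteq> {..N}} \<subseteq> (\<Union>A\<in>Pow {..N}. {m. dom m = A \<and> ran m \<subseteq> B})"
  proof clarify
    fix t assume t: "t \<in> LW" "dom t \<subseteq> {..N}"
    have "ran t \<subseteq> B"
    proof
      fix a assume "a \<in> ran t"
      then obtain j where j: "t j = Some a" by (auto simp: ran_def)
      then have "j \<in> dom t" by blast
      then have "the (t j) \<in> {\<upsilon>} \<union> \<alpha> ` {1..k j}" "j \<le> N" using t by (auto simp: located_words_def)
      then show "a \<in> B" using j unfolding B_def by auto
    qed
    then show "t \<in> (\<Union>A\<in>Pow {..N}. {m. dom m = A \<and> ran m \<subseteq> B})" using t(2) by blast
  qed
  moreover have "finite B" unfolding B_def by simp
  then have "finite (\<Union>A\<in>Pow {..N}. {m. dom m = A \<and> ran m \<subseteq> B})"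
    by (intro finite_UN_I finite_set_of_finite_maps) (auto intro: finite_subset)
  ultimately show ?thesis by (rule finite_subset)
qed

lemma word_less_above:
  assumes V: "V \<in> Linf" and n: "1 \<le> n" and x: "x \<in> ev_on {Suc n..} V"
  shows "word_less (V n) x"
proof -
  have W: "wseq {1..} V" using V by (rule Linf_wseq)
  have x1: "x \<in> ev_on {1..} V" by (rule set_mp[OF EV_on_mono x]) auto
  obtain ps where ps: "x = comb V ps" "valid {Suc n..} ps" using x by (rule EV_onE)
  have "i < j" if i: "i \<in> dom (V n)" and j: "j \<in> dom x" for i j
  proof -
    obtain m where m: "m \<in> fst ` set ps" "j \<in> dom (V m)" using j unfolding ps(1) dom_comb by blast
    obtain p where "(m, p) \<in> set ps" using m(1) by force
    from validD[OF ps(2) this] have "n < m" by simp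
    then show ?thesis using wseq_less[OF W _ _ _ i m(2)] n by simp
  qed
  moreover have "x \<in> LW" using EV_on_LW[OF W] x1 by blast
  ultimately show ?thesis using word_less_iff[of "V n" x] wseq_LW[OF W, of n] n by simp
qed

text \<open>\<open>R t E\<close> stands for a question about \<open>t\<close> being settled within
  \<open>E\<close>. Stage \<open>n + 1\<close> settles it for all words ending no later than the
  next term of \<open>U\<close>; \<open>anti\<close> keeps the answers valid at all later
  stages.\<close>

lemma fusion:
  assumes W: "W \<in> Linf"
    and anti: "\<And>t E E'. R t E \<Longrightarrow> E' \<subseteq> E \<Longrightarrow> R t E'"
    and dense: "\<And>t V. V \<in> Linf \<Longrightarrow> \<exists>V'. refining V' V \<and> R t (ev V')"
  shows "\<exists>U. refining U W \<and> (\<forall>t\<in>ev U. R t {v \<in> ev U. word_less t v})"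
proof -
  have finite_dense: "\<exists>V'. refining V' V \<and> (\<forall>t\<in>S. R t (ev V'))" if "finite S" "V \<in> Linf" for S V
    using that
  proof (induction S arbitrary: V rule: finite_induct)
    case empty
    then show ?case using refines_refl by blast
  next
    case (insert t S)
    obtain V1 where V1: "refining V1 V" "R t (ev V1)" using dense[OF insert.prems] by blast
    obtain V2 where V2: "refining V2 V1" "\<forall>t\<in>S. R t (ev V2)"
      using insert.IH refines_Linf[OF V1(1)] by blast
    have "R t (ev V2)" using anti[OF V1(2)] refines_EV[OF V2(1) refines_Linf[OF V1(1)]] by blast
    then show ?case using V2 refines_trans[OF V2(1) V1(1) insert.prems] by blast
  qed
  \<comment> \<open>For \<open>V = w n\<close> the term \<open>V (Suc n)\<close> will be
    \<open>U (Suc n)\<close>, so this set contains every combination of terms of \<open>U\<close>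
    whose last index is \<open>Suc n\<close>.\<close>
  define below where "below n V = {t \<in> LW. dom t \<subseteq> {..Max (dom (V (Suc n)))}}" for n and V :: "nat \<Rightarrow> 'a lword"
  have "\<exists>w. \<forall>n. (w n \<in> Linf \<and> (n = 0 \<longrightarrow> w n = W)) \<and>
      (refining (w (Suc n)) (w n) \<and> (\<forall>t\<in>below n (w n). R t (ev (w (Suc n)))))"
  proof (rule dependent_nat_choice)
    show "\<exists>V. V \<in> Linf \<and> (0 = 0 \<longrightarrow> V = W)" using W by blast
    fix V and n :: nat assume "V \<in> Linf \<and> (n = 0 \<longrightarrow> V = W)"
    then show "\<exists>V'. (V' \<in> Linf \<and> (Suc n = 0 \<longrightarrow> V' = W)) \<and>
        refining V' V \<and> (\<forall>t\<in>below n V. R t (ev V'))"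
      using finite_dense[of "below n V" V] finite_words_below refines_Linf unfolding below_def by blast
  qed
  then obtain w where w0: "w 0 = W" and wL: "\<And>n. w n \<in> Linf"
    and wr: "\<And>n. refining (w (Suc n)) (w n)"
    and wR: "\<And>n t. t \<in> below n (w n) \<Longrightarrow> R t (ev (w (Suc n)))" by blast
  have wmn: "refining (w n) (w m)" if "m \<le> n" for m n
    using that
  proof (induction n)
    case (Suc n)
    then show ?case using refines_refl[OF wL] refines_trans[OF wr _ wL] by (cases "m = Suc n") auto
  qed (simp add: refines_refl wL)
  \<comment> \<open>Taking the \<open>n\<close>-th term, rather than the first, keeps the bound \<open>k n\<close> on the substitutions
    applied to \<open>U n\<close> admissible for the terms of every earlier \<open>w m\<close>.\<close>
  define U where "U n = w (n - 1) n" for n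
  have Uev: "U n \<in> ev_on {n..} (w m)" if "m < n" for m n
    unfolding U_def using refines_EV_on[OF wmn wL, of m "n - 1" n] that by simp
  have UL: "U \<in> Linf"
    unfolding L_inf_def
  proof (intro CollectI allI impI conjI)
    fix n :: nat assume n: "1 \<le> n"
    show "U n \<in> LW" unfolding U_def using wseq_LW[OF Linf_wseq[OF wL]] n by simp
    have "U (Suc n) \<in> ev_on {Suc n..} (w (n - 1))" using Uev[of "n - 1" "Suc n"] by simp
    then show "word_less (U n) (U (Suc n))" unfolding U_def[of n] by (rule word_less_above[OF wL n])
  qed
  have U1: "wseq {1..} U" using UL by (rule Linf_wseq)
  have tail: "ev_on {Suc n..} U \<subseteq> ev (w n)" for n
    unfolding EV_def
  proof (rule EV_on_trans)
    show "wseq {Suc n..} U" by (rule wseq_subset[OF U1]) auto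
    show "wseq {1..} (w n)" by (rule Linf_wseq[OF wL])
    fix m assume m: "m \<in> {Suc n..}"
    then have "{1..} \<inter> {m..} = {m..}" by auto
    then show "U m \<in> ev_on ({1..} \<inter> {m..}) (w n)" using Uev[of n m] m by simp
  qed
  have "ev U \<subseteq> ev W" using tail[of 0] unfolding EV_def w0 by simp
  then have ref: "refining U W"
    unfolding word_refines_def using UL self_EV_on[of _ "{1..}" U] unfolding EV_def by auto
  have "R t {v \<in> ev U. word_less t v}" if t: "t \<in> ev U" for t
  proof -
    obtain ps i0 where ps: "t = comb U ps" "valid {1..} ps" "(i0, 0) \<in> set ps"
      using t unfolding EV_def by (rule EV_onE)
    \<comment> \<open>The last index \<open>n\<close> used by \<open>t\<close> determines the stage
      at which its question was settled.\<close>
    obtain qs n p where qs: "ps = qs @ [(n, p)]"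
    proof (cases ps rule: rev_cases)
      case (snoc qs y)
      then show ?thesis using that[of qs "fst y" "snd y"] by simp
    qed (use ps(3) in simp)
    have n: "1 \<le> n" "\<forall>i\<in>fst ` set ps. i \<le> n" using ps(2) unfolding qs valid_snoc by auto
    have tLW: "t \<in> LW" using t EV_LW[OF UL] by blast
    have dn: "finite (dom (U n))" "dom (U n) \<noteq> {}" using wseq_dom[OF U1, of n] n(1) by simp_all
    have le: "x \<le> Max (dom (U n))" if "i \<le> n" "1 \<le> i" "x \<in> dom (U i)" for x i
    proof (cases "i = n")
      case True
      then show ?thesis using that dn by simp
    next
      case False
      then have "x < Max (dom (U n))" using wseq_less[OF U1, of i n x] that n(1) Max_in[OF dn] by simp
      then show ?thesis by simp
    qed
    have ps1: "1 \<le> i" if "i \<in> fst ` set ps" for i using that validD[OF ps(2)] by auto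
    have "dom t \<subseteq> {..Max (dom (U n))}" unfolding ps(1) dom_comb using le n(2) ps1 by blast
    then have "t \<in> below (n - 1) (w (n - 1))" unfolding below_def using tLW n(1) by (simp add: U_def)
    then have Rt: "R t (ev (w n))" using wR[of t "n - 1"] n(1) by simp
    have mt: "Max (dom (U n)) \<in> dom t"
      unfolding ps(1) dom_comb using Max_in[OF dn] qs by force
    \<comment> \<open>A word beyond \<open>t\<close> uses only indices greater than
      \<open>n\<close>, and the tail of \<open>U\<close> from there on is extracted from
      \<open>w n\<close>.\<close>
    have "{v \<in> ev U. word_less t v} \<subseteq> ev (w n)"
    proof clarify
      fix v assume v: "v \<in> ev U" "word_less t v"
      obtain rs j0 where rs: "v = comb U rs" "valid {1..} rs" "(j0, 0) \<in> set rs"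
        using v(1) unfolding EV_def by (rule EV_onE)
      have vLW: "v \<in> LW" using v(1) EV_LW[OF UL] by blast
      have "n < i" if i: "i \<in> fst ` set rs" for i
      proof (rule ccontr)
        assume "\<not> n < i"
        have i1: "1 \<le> i" using i validD[OF rs(2)] by auto
        then obtain x where x: "x \<in> dom (U i)" using wseq_dom(1)[OF U1, of i] by auto
        then have "x \<in> dom v" using i unfolding rs(1) dom_comb by blast
        then have "Max (dom (U n)) < x" using v(2) mt word_less_iff[OF tLW vLW] by blast
        then show False using le[OF _ i1 x] \<open>\<not> n < i\<close> by simp
      qed
      then have "valid {Suc n..} rs" using rs(2) unfolding valid_def by fastforce
      then have "v \<in> ev_on {Suc n..} U" unfolding rs(1) using rs(3) by (rule EV_onI)
      then show "v \<in> ev (w n)" using tail by blast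
    qed
    then show ?thesis by (rule anti[OF Rt])
  qed
  then show ?thesis using ref by blast
qed

end

definition mins :: "'a lword list \<Rightarrow> nat set" where
  "mins ws = (\<lambda>w. Min (dom w)) ` set ws"

lemma mins_simps [simp]: "mins [] = {}" "mins (t # vs) = {Min (dom t)} \<union> mins vs"
  by (simp_all add: mins_def)

lemma finite_mins: "finite (mins ws)"
  by (simp add: mins_def)

locale schreier_words = words \<alpha> \<upsilon> k for \<alpha> :: "nat \<Rightarrow> 'a" and \<upsilon> k +
  fixes fs :: "omega1 \<Rightarrow> nat \<Rightarrow> omega1"
  assumes fs: "fundamental_sequences fs"
begin

abbreviation "mem \<equiv> schreier_mem fs"

definition res :: "omega1 \<Rightarrow> nat \<Rightarrow> omega1" where
  "res x = (SOME r. residual fs x r)"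

lemma res_residual: "x \<noteq> 0 \<Longrightarrow> residual fs x (res x)"
  unfolding res_def by (rule someI_ex[OF residual_exists[OF fs]])

lemma res_less: "x \<noteq> 0 \<Longrightarrow> n \<ge> 1 \<Longrightarrow> res x n < x"
  using res_residual unfolding residual_def by blast

lemma res_osucc: "n \<ge> 1 \<Longrightarrow> res (osucc z) n = z"
  using res_residual[OF osucc_neq_0] unfolding residual_def by blast

lemma res_limit: "is_limit x \<Longrightarrow> b < x \<Longrightarrow> \<exists>N. \<forall>n\<ge>N. b \<le> res x n"
  using res_residual[of x] unfolding residual_def is_limit_def by blast

lemma Min_dom_pos: "t \<in> LW \<Longrightarrow> 1 \<le> Min (dom t)"
  using LW_dom[of t] Min_in[of "dom t"] by auto

lemma mem_mins_Cons:
  assumes "x \<noteq> 0" "t # vs \<in> Lfin"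
  shows "mem x (mins (t # vs)) \<longleftrightarrow> mem (res x (Min (dom t))) (mins vs)"
proof -
  have t: "t \<in> LW" "\<And>v. v \<in> set vs \<Longrightarrow> v \<in> LW \<and> word_less t v"
    using assms(2) unfolding Lfin_Cons by (auto simp: L_fin_def)
  have "Min (dom t) < Min (dom v)" if v: "v \<in> set vs" for v
  proof -
    have "Min (dom t) \<in> dom t" "Min (dom v) \<in> dom v"
      using LW_dom[OF t(1)] LW_dom[of v] t(2)[OF v] by (auto intro!: Min_in)
    then show ?thesis using word_less_iff[of t v] t(1) t(2)[OF v] by blast
  qed
  then have "\<forall>i\<in>mins vs. Min (dom t) < i" by (auto simp: mins_def)
  then show ?thesis
    using res_residual[OF assms(1)] Min_dom_pos[OF t(1)] finite_mins[of vs]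
    unfolding residual_def mins_simps by blast
qed

lemma mem_0_mins: "mem 0 (mins ws) \<longleftrightarrow> ws = []"
  by (simp add: schreier_mem_0 cat_unit_def mins_def)

lemma mem_mins_nonempty: "x \<noteq> 0 \<Longrightarrow> mem x (mins ws) \<Longrightarrow> ws \<noteq> []"
  using schreier_mem_props[of fs x "mins ws"] by auto

theorem schreier_dichotomy:
  assumes "W \<in> Linf"
  shows "\<exists>U. refining U W \<and>
    ((\<forall>ws\<in>ev_fin U. mem x (mins ws) \<longrightarrow> ws \<in> F) \<or> (\<forall>ws\<in>ev_fin U. mem x (mins ws) \<longrightarrow> ws \<notin> F))"
  using assms
proof (induction x arbitrary: F W rule: less_induct)
  case (less x)
  show ?case
  proof (cases "x = 0")
    case True
    then show ?thesis using refines_refl[OF less.prems] by (auto simp: mem_0_mins)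
  next
    case False
    \<comment> \<open>By \<open>mem_mins_Cons\<close> the tuples \<open>t # vs\<close> with
      \<open>D t E vs\<close> are exactly the members of \<open>L\<^sup>x\<close> that start with
      \<open>t\<close> and continue in \<open>E\<close>. The predicate \<open>R\<close> below is the
      question that fusion settles for a single \<open>t\<close>.\<close>
    define D where "D t E vs \<longleftrightarrow> t # vs \<in> Lfin \<and> set vs \<subseteq> E \<and> mem (res x (Min (dom t))) (mins vs)" for t E vs
    define R where "R t E \<longleftrightarrow> (\<forall>vs. D t E vs \<longrightarrow> t # vs \<in> F) \<or> (\<forall>vs. D t E vs \<longrightarrow> t # vs \<notin> F)" for t E
    have "\<exists>U. refining U W \<and> (\<forall>t\<in>ev U. R t {v \<in> ev U. word_less t v})"
    proof (rule fusion[OF less.prems])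
      show "R t E'" if "R t E" "E' \<subseteq> E" for t E E'
        using that unfolding R_def D_def by blast
      fix t V assume V: "V \<in> Linf"
      show "\<exists>V'. refining V' V \<and> R t (ev V')"
      proof (cases "t \<in> LW")
        case True
        have "res x (Min (dom t)) < x" by (rule res_less[OF False Min_dom_pos[OF True]])
        from less.IH[OF this V, of "{vs. t # vs \<in> F}"] obtain V' where V': "refining V' V"
          "(\<forall>ws\<in>ev_fin V'. mem (res x (Min (dom t))) (mins ws) \<longrightarrow> t # ws \<in> F) \<or>
           (\<forall>ws\<in>ev_fin V'. mem (res x (Min (dom t))) (mins ws) \<longrightarrow> t # ws \<notin> F)" by auto
        have "vs \<in> ev_fin V'" if "D t (ev V') vs" for vs
          using that unfolding D_def Lfin_Cons EV_fin_def by blast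
        then have "R t (ev V')" using V'(2) unfolding R_def D_def by blast
        then show ?thesis using V'(1) by blast
      next
        case False
        then have "R t (ev V)" unfolding R_def D_def Lfin_Cons by blast
        then show ?thesis using refines_refl[OF V] by blast
      qed
    qed
    then obtain U where U: "refining U W" "\<And>t. t \<in> ev U \<Longrightarrow> R t {v \<in> ev U. word_less t v}" by blast
    have UL: "U \<in> Linf" using U(1) by (rule refines_Linf)
    \<comment> \<open>After fusion, membership in \<open>F\<close> depends on the first word alone;
      \<open>A\<close> holds the words with a positive answer, and the partition theorem makes the
      answer constant.\<close>
    define A where "A = {t. \<forall>vs. D t (ev U) vs \<longrightarrow> t # vs \<in> F}"
    have not_A: "t # vs \<notin> F" if "t \<in> ev U" "t \<notin> A" "D t (ev U) vs" for t vs
    proof -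
      \<comment> \<open>The words of a continuation lie above \<open>t\<close> in any case, so the
        restricted set in the conclusion of \<open>fusion\<close> loses none of them.\<close>
      have D: "D t {v \<in> ev U. word_less t v} vs" if "D t (ev U) vs" for vs
        using that unfolding D_def Lfin_Cons by blast
      then show ?thesis using U(2)[OF that(1)] that(2,3) unfolding R_def A_def by blast
    qed
    obtain U' where U': "refining U' U" "ev U' \<subseteq> A \<or> ev U' \<inter> A = {}" using word_partition[OF UL] by blast
    have sub: "ev U' \<subseteq> ev U" using refines_EV[OF U'(1) UL] .
    have split: "\<exists>t vs. ws = t # vs \<and> t \<in> ev U' \<and> D t (ev U) vs" if ws: "ws \<in> ev_fin U'" "mem x (mins ws)" for ws
    proof -
      obtain t vs where tv: "ws = t # vs" using mem_mins_nonempty[OF False ws(2)] by (cases ws) auto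
      have L: "t # vs \<in> Lfin" "t \<in> ev U'" "set vs \<subseteq> ev U'" using ws(1) unfolding tv EV_fin_def by auto
      have "mem (res x (Min (dom t))) (mins vs)" using mem_mins_Cons[OF False L(1)] ws(2) tv by blast
      then show ?thesis using tv L sub unfolding D_def by blast
    qed
    have "(\<forall>ws\<in>ev_fin U'. mem x (mins ws) \<longrightarrow> ws \<in> F) \<or> (\<forall>ws\<in>ev_fin U'. mem x (mins ws) \<longrightarrow> ws \<notin> F)"
      using U'(2)
    proof
      assume "ev U' \<subseteq> A"
      then show ?thesis using split unfolding A_def by blast
    next
      assume "ev U' \<inter> A = {}"
      then have "ws \<notin> F" if "ws \<in> ev_fin U'" "mem x (mins ws)" for ws
        using split[OF that] not_A sub by blast
      then show ?thesis by blast
    qed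
    then show ?thesis using refines_trans[OF U'(1) U(1) less.prems] by blast
  qed
qed

lemma far_extension:
  assumes V: "V \<in> Linf" and ws: "ws \<in> Lfin"
  shows "\<exists>m\<ge>1. \<forall>n\<ge>m. ws @ [V n] \<in> Lfin \<and> N \<le> Min (dom (V n))"
proof -
  have LW: "\<And>w. w \<in> set ws \<Longrightarrow> w \<in> LW" using ws unfolding L_fin_def by blast
  have "finite (\<Union>w\<in>set ws. dom w)" using LW LW_dom by auto
  then obtain M where M: "\<forall>i\<in>(\<Union>w\<in>set ws. dom w). i \<le> M" by (metis finite_nat_set_iff_bounded_le)
  have "ws @ [V n] \<in> Lfin \<and> N \<le> Min (dom (V n))" if n: "n \<ge> Suc (max M N)" for n
  proof
    have VLW: "V n \<in> LW" using wseq_LW[OF Linf_wseq[OF V], of n] n by simp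
    have ge: "n \<le> i" if "i \<in> dom (V n)" for i using Linf_dom_ge[OF V _ that] n by simp
    have "word_less w (V n)" if w: "w \<in> set ws" for w
      unfolding word_less_iff[OF LW[OF w] VLW]
    proof (intro ballI)
      fix i j assume "i \<in> dom w" "j \<in> dom (V n)"
      then have "i \<le> M" "n \<le> j" using M w ge by blast+
      then show "i < j" using n by simp
    qed
    then show "ws @ [V n] \<in> Lfin" unfolding Lfin_append Lfin_Cons using ws VLW by simp
    have "Min (dom (V n)) \<in> dom (V n)" using LW_dom[OF VLW] by (intro Min_in) auto
    then show "N \<le> Min (dom (V n))" using ge n by fastforce
  qed
  then show ?thesis by (intro exI[of _ "Suc (max M N)"]) simp
qed

lemma Linf_EV: "V \<in> Linf \<Longrightarrow> 1 \<le> n \<Longrightarrow> V n \<in> ev V"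
  unfolding EV_def by (rule self_EV_on) simp

text \<open>Walk along \<open>v\<close>, replacing the ordinal by its residual at each word; the
  ordinals decrease, so the walk reaches 0. If \<open>v\<close> ends earlier, far terms of
  \<open>S\<close> continue it. The tuple \<open>ws\<close> records the words already
  consumed.\<close>

lemma front:
  assumes S: "S \<in> Linf"
  shows "ws @ v \<in> ev_fin S \<Longrightarrow>
    \<exists>u. (prefix u v \<or> prefix v u) \<and> ws @ u \<in> ev_fin S \<and> mem x (mins u)"
proof (induction x arbitrary: ws v rule: less_induct)
  case (less x)
  show ?case
  proof (cases "x = 0")
    case True
    then show ?thesis using less.prems mem_0_mins[of "[]"] Lfin_append
      by (intro exI[of _ "[]"]) (auto simp: EV_fin_def)
  next
    case False
    have "\<exists>t v'. (ws @ [t]) @ v' \<in> ev_fin S \<and> (v = t # v' \<or> v = [])"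
    proof (cases v)
      case Nil
      have "ws \<in> Lfin" using less.prems Nil by (simp add: EV_fin_def)
      from far_extension[OF S this] obtain m where "m \<ge> 1" "ws @ [S m] \<in> Lfin" by blast
      then show ?thesis using less.prems Nil Linf_EV[OF S, of m]
        by (intro exI[of _ "S m"] exI[of _ "[]"]) (auto simp: EV_fin_def)
    next
      case (Cons t v')
      then show ?thesis using less.prems by (intro exI[of _ t] exI[of _ v']) simp
    qed
    then obtain t v' where tv: "(ws @ [t]) @ v' \<in> ev_fin S" "v = t # v' \<or> v = []" by blast
    then have "t \<in> LW" using ev_fin_Lfin[OF tv(1)] by (simp add: Lfin_append Lfin_Cons)
    from less.IH[OF res_less[OF False Min_dom_pos[OF this]] tv(1)] obtain u where
      u: "prefix u v' \<or> prefix v' u" "(ws @ [t]) @ u \<in> ev_fin S" "mem (res x (Min (dom t))) (mins u)" by blast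
    have "t # u \<in> Lfin" using ev_fin_Lfin[OF u(2)] by (simp add: Lfin_append Lfin_Cons)
    then have "mem x (mins (t # u))" using mem_mins_Cons[OF False] u(3) by blast
    then show ?thesis using tv(2) u(1,2) by (intro exI[of _ "t # u"]) auto
  qed
qed

section \<open>The strong Cantor-Bendixson index\<close>

abbreviation "sd \<equiv> strong_derivative \<alpha> \<upsilon> k"
abbreviation "bad \<equiv> bad_extensions \<alpha> \<upsilon> k"
abbreviation deriv :: "omega1 \<Rightarrow> (nat \<Rightarrow> 'a lword) \<Rightarrow> 'a lword list set \<Rightarrow> 'a lword list set" where
  "deriv x S F \<equiv> scb_derivative \<alpha> \<upsilon> k S F x"

lemma deriv_0 [simp]: "deriv 0 S F = F"
  by (simp add: scb_derivative.simps)

lemma deriv_osucc: "deriv (osucc x) S F = sd S (deriv x S F)"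
  by (subst scb_derivative.simps) (simp add: osucc_neq_0 is_limit_osucc opred_osucc)

lemma deriv_limit: "is_limit x \<Longrightarrow> deriv x S F = (\<Inter>b\<in>{1..<x}. deriv b S F)"
  by (subst scb_derivative.simps) (simp add: is_limit_def)

lemma sd_iff:
  "ws \<in> sd S F \<longleftrightarrow> (ws \<in> F \<and> ws \<in> ev_fin S \<or> ws = []) \<and>
    \<not> (\<exists>t :: nat \<Rightarrow> _. \<forall>n. t n \<in> bad S F ws \<and> word_less (t n) (t (Suc n)))"
  unfolding strong_derivative_def by auto

lemma sd_increasing:
  "ws \<in> sd S F \<Longrightarrow> \<not> (\<forall>n. t n \<in> bad S F ws \<and> word_less (t n) (t (Suc n)))"
  unfolding sd_iff by blast

lemma bad_iff: "t \<in> bad S F ws \<longleftrightarrow> t \<in> ev S \<and> ws @ [t] \<notin> F"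
  unfolding bad_extensions_def by auto

lemma sd_mono: "F \<subseteq> F' \<Longrightarrow> sd S F \<subseteq> sd S F'"
proof
  fix ws assume FF: "F \<subseteq> F'" and "ws \<in> sd S F"
  moreover have "bad S F' ws \<subseteq> bad S F ws" using FF by (auto simp: bad_iff)
  ultimately show "ws \<in> sd S F'" unfolding sd_iff by blast
qed

lemma sd_ev_fin: "sd S F \<subseteq> ev_fin S"
  unfolding sd_iff subset_iff by auto

text \<open>The terms of \<open>S\<close> beyond \<open>ws\<close> form an increasing sequence, so
  they cannot all be bad extensions of a survivor.\<close>

lemma sd_extension:
  assumes S: "S \<in> Linf" and ws: "ws \<in> sd S F"
  shows "\<exists>t. ws @ [t] \<in> ev_fin S \<and> ws @ [t] \<in> F"
proof -
  have wsS: "ws \<in> ev_fin S" using ws sd_ev_fin by blast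
  obtain m where m: "m \<ge> 1" "\<forall>n\<ge>m. ws @ [S n] \<in> Lfin"
    using far_extension[OF S ev_fin_Lfin[OF wsS]] by blast
  have "word_less (S (m + n)) (S (m + Suc n))" for n
    using S m(1) unfolding L_inf_def by simp
  then have "\<not> (\<forall>n. S (m + n) \<in> bad S F ws)"
    using sd_increasing[OF ws, of "\<lambda>n. S (m + n)"] by blast
  then obtain n where "S (m + n) \<notin> bad S F ws" by blast
  moreover have "S (m + n) \<in> ev S" using Linf_EV[OF S] m(1) by simp
  ultimately have "ws @ [S (m + n)] \<in> F" "S (m + n) \<in> ev S" by (auto simp: bad_iff)
  moreover have "ws @ [S (m + n)] \<in> Lfin" using m(2) by simp
  ultimately show ?thesis using wsS by (intro exI[of _ "S (m + n)"]) (simp add: EV_fin_def)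
qed

text \<open>\<open>strong_derivative\<close> always adds \<open>[]\<close>, whence the hypothesis.
  The delicate step is the successor of a limit, where \<open>osucc b\<close> stays below the limit
  for every \<open>b\<close> below it.\<close>

lemma deriv_antimono:
  assumes "[] \<in> F"
  shows "x \<le> y \<Longrightarrow> deriv y S F \<subseteq> deriv x S F"
proof (induction y arbitrary: x rule: less_induct)
  case (less y)
  have sd1: "sd S F \<subseteq> F" using assms unfolding sd_iff subset_iff by auto
  show ?case
  proof (cases "x = y")
    case False
    then have xy: "x < y" using less.prems by simp
    show ?thesis
    proof (cases y rule: omega1_cases)
      case zero
      then show ?thesis using xy not_less_zero_omega1 by simp
    next
      case (succ z)
      have zy: "z < y" using succ less_osucc by simp
      have "sd S (deriv z S F) \<subseteq> deriv z S F"
      proof (cases z rule: omega1_cases)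
        case zero
        then show ?thesis using sd1 by simp
      next
        case s: (succ u)
        have "deriv z S F \<subseteq> deriv u S F" using less.IH[OF zy] s less_osucc[of u] by simp
        then show ?thesis using sd_mono s deriv_osucc by metis
      next
        case limit
        show ?thesis
        proof
          fix ws assume ws: "ws \<in> sd S (deriv z S F)"
          have "ws \<in> deriv b S F" if b: "b < z" for b
          proof -
            have bz: "osucc b < z" using is_limit_osucc_less[OF limit b] .
            have "deriv z S F \<subseteq> deriv b S F" using less.IH[OF zy] b by simp
            then have "ws \<in> deriv (osucc b) S F" using ws sd_mono deriv_osucc by blast
            then show ?thesis using less.IH[of "osucc b" b] bz zy less_osucc[of b] by force
          qed
          then show "ws \<in> deriv z S F" unfolding deriv_limit[OF limit] by auto
        qed
      qed
      then have "deriv y S F \<subseteq> deriv z S F" using succ deriv_osucc by simp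
      also have "\<dots> \<subseteq> deriv x S F" using less.IH[OF zy, of x] xy succ by (simp add: less_osucc_iff)
      finally show ?thesis .
    next
      case limit
      show ?thesis
      proof (cases "x = 0")
        case True
        have "1 < y" using limit is_limit_osucc_less[OF limit, of 0] omega1_neq_0_iff[of y]
          by (simp add: one_omega1_def is_limit_def)
        then have "deriv y S F \<subseteq> deriv 1 S F" unfolding deriv_limit[OF limit] by auto
        also have "deriv 1 S F \<subseteq> F" using sd1 deriv_osucc[where x = 0] by (simp add: one_omega1_def)
        finally show ?thesis using True by simp
      next
        case False
        then show ?thesis using xy unfolding deriv_limit[OF limit] by (auto simp: one_le_iff_omega1)
      qed
    qed
  qed simp
qed

lemma Lfin_subseq: "ws \<in> Lfin \<Longrightarrow> subseq vs ws \<Longrightarrow> vs \<in> Lfin \<and> set vs \<subseteq> set ws"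
proof (induction ws arbitrary: vs)
  case (Cons w ws)
  then have ws: "w \<in> LW" "ws \<in> Lfin" "\<forall>v\<in>set ws. word_less w v" by (auto simp: Lfin_Cons)
  show ?case
  proof (cases "subseq vs ws")
    case True
    then show ?thesis using Cons.IH[OF ws(2)] by auto
  next
    case False
    then obtain vs' where "vs = w # vs'" "subseq vs' ws"
      using Cons.prems(2) by (cases vs) (auto split: if_splits)
    then show ?thesis using Cons.IH[OF ws(2)] ws by (auto simp: Lfin_Cons)
  qed
next
  case Nil
  then show ?case by (cases vs) auto
qed

text \<open>This part of heredity passes to all derivatives, and it reduces the emptiness of a
  derivative to the absence of \<open>[]\<close>.\<close>

definition subseq_closed :: "'a lword list set \<Rightarrow> bool" where
  "subseq_closed F \<longleftrightarrow> (\<forall>ws\<in>F. \<forall>vs. subseq vs ws \<longrightarrow> vs \<in> F)"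

lemma sd_subseq_closed:
  assumes "subseq_closed F" shows "subseq_closed (sd S F)"
  unfolding subseq_closed_def
proof (intro ballI allI impI)
  fix ws vs assume ws: "ws \<in> sd S F" and vs: "subseq vs ws"
  have "bad S F vs \<subseteq> bad S F ws"
  proof
    fix t assume t: "t \<in> bad S F vs"
    have "subseq (vs @ [t]) (ws @ [t])" using vs by (simp add: list_emb_append_mono)
    then show "t \<in> bad S F ws" using t assms unfolding bad_iff subseq_closed_def by blast
  qed
  moreover have "vs \<in> F \<and> vs \<in> ev_fin S \<or> vs = []"
  proof (cases "ws = []")
    case True
    then show ?thesis using vs by simp
  next
    case False
    then have "ws \<in> F" "ws \<in> ev_fin S" using ws unfolding sd_iff by auto
    then show ?thesis using assms vs Lfin_subseq unfolding subseq_closed_def EV_fin_def by blast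
  qed
  ultimately show "vs \<in> sd S F" using ws unfolding sd_iff by blast
qed

lemma deriv_subseq_closed: "subseq_closed F \<Longrightarrow> subseq_closed (deriv x S F)"
proof (induction x rule: omega1_induct)
  case (succ x)
  then show ?case by (simp add: deriv_osucc sd_subseq_closed)
next
  case (limit x)
  have "subseq_closed (deriv b S F)" if "b \<in> {1..<x}" for b using limit that by simp
  then show ?case unfolding deriv_limit[OF limit(1)] subseq_closed_def by blast
qed simp

lemma deriv_nonempty_iff:
  "subseq_closed F \<Longrightarrow> deriv x S F = {} \<longleftrightarrow> [] \<notin> deriv x S F"
  using deriv_subseq_closed[where F = F and x = x and S = S] unfolding subseq_closed_def by (metis all_not_in_conv list_emb_Nil)

text \<open>Fewer words are extracted from \<open>V\<close>: a bad extension over \<open>V\<close>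
  is already bad over \<open>U\<close>, so survivors that are extracted from \<open>V\<close> keep
  surviving.\<close>

lemma deriv_refines:
  assumes F: "F \<subseteq> Lfin" "[] \<in> F" and U: "U \<in> Linf" and V: "refining V U"
  shows "deriv x U F \<inter> ev_fin V \<subseteq> deriv x V F"
proof (induction x rule: omega1_induct)
  case (succ x)
  have VU: "ev V \<subseteq> ev U" using refines_EV[OF V U] .
  have xL: "deriv x U F \<subseteq> Lfin" using deriv_antimono[OF F(2), of 0 x U] F(1) zero_le_omega1 by auto
  show ?case
  proof
    fix ws assume ws: "ws \<in> deriv (osucc x) U F \<inter> ev_fin V"
    have "bad V (deriv x V F) ws \<subseteq> bad U (deriv x U F) ws"
    proof
      fix t assume t: "t \<in> bad V (deriv x V F) ws"
      have "ws @ [t] \<notin> deriv x U F"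
      proof
        assume "ws @ [t] \<in> deriv x U F"
        moreover from this have "ws @ [t] \<in> ev_fin V"
          using xL ws t unfolding EV_fin_def bad_iff by auto
        ultimately show False using succ t unfolding bad_iff by blast
      qed
      then show "t \<in> bad U (deriv x U F) ws" using t VU unfolding bad_iff by blast
    qed
    moreover have ws': "ws \<in> sd U (deriv x U F)" "ws \<in> ev_fin V" using ws unfolding deriv_osucc by auto
    then have "ws \<in> deriv x V F \<and> ws \<in> ev_fin V \<or> ws = []"
      using succ unfolding sd_iff by blast
    ultimately show "ws \<in> deriv (osucc x) V F"
      using ws'(1) unfolding deriv_osucc sd_iff by blast
  qed
next
  case (limit x)
  then show ?case unfolding deriv_limit[OF limit(1)] by fastforce
qed simp

text \<open>A survivor of \<open>osucc x\<close> derivatives has an extension by some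
  \<open>t\<close> surviving \<open>x\<close> of them. Since the residual ordinal is below
  \<open>x\<close>, its successor is at most \<open>x\<close>, and the same situation
  recurs.\<close>

lemma deriv_osucc_extension:
  assumes S: "S \<in> Linf" and F: "F \<subseteq> Lfin" "[] \<in> F"
  shows "ws \<in> deriv (osucc x) S F \<Longrightarrow> \<exists>vs. ws @ vs \<in> F \<and> ws @ vs \<in> ev_fin S \<and> mem x (mins vs)"
proof (induction x arbitrary: ws rule: less_induct)
  case (less x)
  have ws: "ws \<in> sd S (deriv x S F)" using less.prems unfolding deriv_osucc .
  show ?case
  proof (cases "x = 0")
    case True
    have "deriv (osucc x) S F \<subseteq> deriv 0 S F" using deriv_antimono[OF F(2)] zero_le_omega1 .
    then have "ws \<in> F" using less.prems by auto
    moreover have "ws \<in> ev_fin S" using ws sd_ev_fin by blast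
    ultimately show ?thesis using True mem_0_mins[of "[]"] by (intro exI[of _ "[]"]) simp
  next
    case False
    obtain t where t: "ws @ [t] \<in> ev_fin S" "ws @ [t] \<in> deriv x S F" using sd_extension[OF S ws] by blast
    have "t \<in> LW" using ev_fin_Lfin[OF t(1)] by (simp add: Lfin_append Lfin_Cons)
    then have rx: "res x (Min (dom t)) < x" using res_less[OF False Min_dom_pos] by blast
    then have "ws @ [t] \<in> deriv (osucc (res x (Min (dom t)))) S F"
      using deriv_antimono[OF F(2)] t(2) osucc_le_iff by blast
    from less.IH[OF rx this] obtain vs where vs: "(ws @ [t]) @ vs \<in> F" "(ws @ [t]) @ vs \<in> ev_fin S"
      "mem (res x (Min (dom t))) (mins vs)" by blast
    have "t # vs \<in> Lfin" using ev_fin_Lfin[OF vs(2)] by (simp add: Lfin_append Lfin_Cons)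
    then have "mem x (mins (t # vs))" using mem_mins_Cons[OF False] vs(3) by blast
    then show ?thesis using vs(1,2) by (intro exI[of _ "t # vs"]) simp
  qed
qed

lemma increasing_eventually:
  assumes t: "\<And>n. t n \<in> LW" "\<And>n. word_less (t n) (t (Suc n))" and ws: "ws \<in> Lfin"
  shows "\<exists>n. ws @ [t n] \<in> Lfin \<and> N \<le> Min (dom (t n))"
proof -
  have "(\<lambda>n. t (n - 1)) \<in> Linf" unfolding L_inf_def
  proof (intro CollectI allI impI conjI t(1))
    fix n :: nat assume "1 \<le> n"
    then show "word_less (t (n - 1)) (t (Suc n - 1))" using t(2)[of "n - 1"] by simp
  qed
  from far_extension[OF this ws] show ?thesis by blast
qed

text \<open>Extensions survive as many derivatives as their residual ordinal, which far out is the
  predecessor of \<open>x\<close> or, at a limit, at least any given \<open>b < x\<close>.\<close>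

lemma deriv_lower:
  assumes S: "S \<in> Linf" and G: "subseq_closed G" "[] \<in> G"
  shows "ws \<in> ev_fin S \<Longrightarrow> (\<And>vs. ws @ vs \<in> ev_fin S \<Longrightarrow> mem x (mins vs) \<Longrightarrow> ws @ vs \<in> G) \<Longrightarrow> ws \<in> deriv x S G"
proof (induction x arbitrary: ws rule: less_induct)
  case (less x)
  have ext: "ws @ [t] \<in> deriv (res x (Min (dom t))) S G"
    if x: "x \<noteq> 0" and t: "ws @ [t] \<in> ev_fin S" for t
  proof -
    have "t \<in> LW" using ev_fin_Lfin[OF t] by (simp add: Lfin_append Lfin_Cons)
    then have rx: "res x (Min (dom t)) < x" using res_less[OF x Min_dom_pos] by blast
    show ?thesis
    proof (rule less.IH[OF rx t])
      fix vs assume vs: "(ws @ [t]) @ vs \<in> ev_fin S" "mem (res x (Min (dom t))) (mins vs)"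
      have "t # vs \<in> Lfin" using ev_fin_Lfin[OF vs(1)] by (simp add: Lfin_append Lfin_Cons)
      then have "mem x (mins (t # vs))" using mem_mins_Cons[OF x] vs(2) by blast
      then show "(ws @ [t]) @ vs \<in> G" using less.prems(2)[of "t # vs"] vs(1) by simp
    qed
  qed
  \<comment> \<open>All extensions with minimum at least \<open>N\<close> survive \<open>b\<close>
    derivatives. An increasing sequence of bad ones would eventually pass both \<open>N\<close> and
    \<open>ws\<close>, so there is none.\<close>
  have step: "ws \<in> deriv (osucc b) S G" if x: "x \<noteq> 0" and N: "\<forall>n\<ge>N. b \<le> res x n" for b N
  proof -
    have ge: "ws @ [t] \<in> deriv b S G" if t: "ws @ [t] \<in> ev_fin S" "N \<le> Min (dom t)" for t
      using ext[OF x t(1)] deriv_antimono[OF G(2)] N t(2) by blast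
    obtain m where m: "m \<ge> 1" "ws @ [S m] \<in> Lfin" "N \<le> Min (dom (S m))"
      using far_extension[OF S ev_fin_Lfin[OF less.prems(1)], of N] by blast
    then have "ws @ [S m] \<in> ev_fin S" using Linf_EV[OF S m(1)] less.prems(1) by (simp add: EV_fin_def)
    then have "ws @ [S m] \<in> deriv b S G" using ge m(3) by blast
    \<comment> \<open>The induction hypothesis speaks of proper extensions only; closure under
      subsequences brings \<open>ws\<close> itself into the derivative.\<close>
    moreover have "subseq ws (ws @ [S m])" by (simp add: prefix_imp_subseq)
    ultimately have wsb: "ws \<in> deriv b S G"
      using deriv_subseq_closed[OF G(1), where x = b and S = S] unfolding subseq_closed_def by blast
    have "\<not> (\<forall>n. t n \<in> bad S (deriv b S G) ws \<and> word_less (t n) (t (Suc n)))" for t :: "nat \<Rightarrow> 'a lword"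
    proof
      assume t: "\<forall>n. t n \<in> bad S (deriv b S G) ws \<and> word_less (t n) (t (Suc n))"
      then have "t n \<in> LW" for n using EV_LW[OF S] unfolding bad_iff by blast
      then obtain n where n: "ws @ [t n] \<in> Lfin" "N \<le> Min (dom (t n))"
        using increasing_eventually[of t ws N] t ev_fin_Lfin[OF less.prems(1)] by blast
      then have "ws @ [t n] \<in> ev_fin S" using t less.prems(1) by (auto simp: EV_fin_def bad_iff)
      then show False using ge n(2) t unfolding bad_iff by blast
    qed
    then show ?thesis unfolding deriv_osucc sd_iff using wsb less.prems(1) by blast
  qed
  show ?case
  proof (cases x rule: omega1_cases)
    case zero
    then show ?thesis using less.prems(2)[of "[]"] less.prems(1) mem_0_mins[of "[]"] by simp
  next
    case (succ z)
    have "\<forall>n\<ge>1. z \<le> res x n" using res_osucc succ by simp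
    then show ?thesis using step[of 1 z] succ osucc_neq_0 by simp
  next
    case limit
    have "ws \<in> deriv b S G" if b: "b < x" for b
    proof -
      obtain N where "\<forall>n\<ge>N. b \<le> res x n" using res_limit[OF limit b] by blast
      then have "ws \<in> deriv (osucc b) S G" using step limit is_limit_def by blast
      then show ?thesis using deriv_antimono[OF G(2) less_imp_le[OF less_osucc]] by blast
    qed
    then show ?thesis unfolding deriv_limit[OF limit] by simp
  qed
qed

section \<open>The hereditary part of a tree\<close>

lemma countable_ev: "countable (ev W)"
proof -
  have "ev W \<subseteq> range (comb W)" unfolding EV_def EV_on_eq by blast
  then show ?thesis by (rule countable_subset) simp
qed

lemma tree_Nil: "is_tree F \<Longrightarrow> [] \<in> F"
  unfolding is_tree_def initial_segments_def by blast

lemma tree_prefix: "is_tree F \<Longrightarrow> ws \<in> F \<Longrightarrow> prefix vs ws \<Longrightarrow> vs \<in> F"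
  unfolding is_tree_def initial_segments_def by blast

abbreviation "hp \<equiv> hered_part \<alpha> \<upsilon> k"

lemma hp_subset: "is_tree F \<Longrightarrow> hp F \<subseteq> F"
  unfolding hered_part_def using tree_Nil by blast

lemma hp_Nil: "[] \<in> hp F"
  unfolding hered_part_def by simp

lemma ev_tuple_Nil: "ev_tuple [] = {}"
  unfolding EV_tuple_def EV_on_eq valid_def by auto

lemma hp_tuple:
  assumes F: "F \<subseteq> Lfin" "is_tree F" and ws: "ws \<in> hp F"
  shows "ev_fin_tuple ws \<subseteq> F"
proof (cases "ws = []")
  case True
  then have "ev_fin_tuple ws \<subseteq> {[]}" unfolding EV_fin_tuple_def by (auto simp: ev_tuple_Nil)
  then show ?thesis using tree_Nil[OF F(2)] by blast
qed (use ws in \<open>auto simp: hered_part_def\<close>)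

lemma hp_hereditary:
  assumes F: "F \<subseteq> Lfin" "is_tree F" and ws: "ws \<in> hp F" and vs: "vs \<in> ev_fin_tuple ws"
  shows "vs \<in> hp F"
proof -
  have "ws \<in> Lfin" using ws hp_subset[OF F(2)] F(1) by blast
  then have "ev_fin_tuple vs \<subseteq> ev_fin_tuple ws"
    using EV_tuple_trans[OF _ vs] unfolding EV_fin_tuple_def by blast
  then have "ev_fin_tuple vs \<subseteq> F" "vs \<in> F" using hp_tuple[OF F ws] vs by auto
  then show ?thesis unfolding hered_part_def by blast
qed

lemma hp_subset_tuple:
  assumes F: "F \<subseteq> Lfin" "is_tree F" and ws: "ws \<in> hp F" and vs: "vs \<in> Lfin" "set vs \<subseteq> set ws"
  shows "vs \<in> hp F"
proof (rule hp_hereditary[OF F ws])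
  have "ws \<in> Lfin" using ws hp_subset[OF F(2)] F(1) by blast
  then show "vs \<in> ev_fin_tuple ws" unfolding EV_fin_tuple_def using self_EV_tuple vs by blast
qed

lemma hp_subseq_closed:
  assumes F: "F \<subseteq> Lfin" "is_tree F" shows "subseq_closed (hp F)"
  unfolding subseq_closed_def
proof (intro ballI allI impI)
  fix ws vs assume ws: "ws \<in> hp F" and vs: "subseq vs ws"
  have "ws \<in> Lfin" using ws hp_subset[OF F(2)] F(1) by blast
  then show "vs \<in> hp F" using hp_subset_tuple[OF F ws] Lfin_subseq vs by blast
qed

definition branch :: "'a lword list set \<Rightarrow> (nat \<Rightarrow> 'a lword) \<Rightarrow> bool" where
  "branch F U \<longleftrightarrow> (\<forall>n. map U [1..<Suc n] \<in> F)"

lemma branch_ev_fin: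
  assumes F: "F \<subseteq> Lfin" "is_tree F" and U: "branch (hp F) U"
  shows "ev_fin U \<subseteq> F"
proof
  fix vs assume "vs \<in> ev_fin U"
  then obtain n where "vs \<in> ev_fin_tuple (map U [1..<Suc n])" by (rule EV_fin_finite_support)
  then show "vs \<in> F" using hp_tuple[OF F, of "map U [1..<Suc n]"] U unfolding branch_def by blast
qed

text \<open>Call a tuple bad if for every countable ordinal it survives that many derivatives over
  some refinement. A bad tuple has a bad one-word extension, so without a bound bad tuples grow from
  \<open>[]\<close> into a branch.\<close>

lemma no_branch_bound:
  assumes F: "F \<subseteq> Lfin" "is_tree F" and W: "W \<in> Linf"
    and no: "\<And>U. refining U W \<Longrightarrow> \<not> branch (hp F) U"
  shows "\<exists>x. \<forall>U. refining U W \<longrightarrow> [] \<notin> deriv x U (hp F)"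
proof (rule ccontr)
  assume contra: "\<not> ?thesis"
  define Bad where "Bad ws \<longleftrightarrow> ws \<in> hp F \<and> ws \<in> ev_fin W \<and>
    (\<forall>x. \<exists>U. refining U W \<and> ws \<in> deriv x U (hp F))" for ws
  have step: "\<exists>t. Bad (ws @ [t])" if B: "Bad ws" for ws
  proof (rule ccontr)
    assume nB: "\<nexists>t. Bad (ws @ [t])"
    define X where "X = {t \<in> ev W. ws @ [t] \<in> hp F \<and> ws @ [t] \<in> ev_fin W}"
    have "\<forall>t\<in>X. \<exists>x. \<forall>U. refining U W \<longrightarrow> ws @ [t] \<notin> deriv x U (hp F)"
      using nB unfolding Bad_def X_def by blast
    then obtain b where b: "\<And>t U. t \<in> X \<Longrightarrow> refining U W \<Longrightarrow> ws @ [t] \<notin> deriv (b t) U (hp F)" by metis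
    \<comment> \<open>Regularity of the first uncountable ordinal: the bounds for the countably many
      possible next words have a common bound \<open>x\<close>. Surviving \<open>osucc x\<close>
      derivatives then produces a next word beyond its own bound.\<close>
    have "countable (b ` X)" unfolding X_def using countable_ev by auto
    from bdd_above_countable_omega1[OF this] obtain x where x: "\<And>t. t \<in> X \<Longrightarrow> b t \<le> x"
      unfolding bdd_above_def by blast
    obtain U where U: "refining U W" "ws \<in> deriv (osucc x) U (hp F)" using B unfolding Bad_def by blast
    obtain t where t: "ws @ [t] \<in> ev_fin U" "ws @ [t] \<in> deriv x U (hp F)"
      using sd_extension[OF refines_Linf[OF U(1)]] U(2) unfolding deriv_osucc by blast
    have "ws @ [t] \<in> hp F" using t(2) deriv_antimono[OF hp_Nil, of 0 x U F] zero_le_omega1 by auto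
    moreover have "ws @ [t] \<in> ev_fin W" using t(1) EV_fin_mono[OF refines_EV[OF U(1) W]] by blast
    ultimately have "t \<in> X" unfolding X_def by (auto simp: EV_fin_def)
    then have "ws @ [t] \<in> deriv (b t) U (hp F)" using t(2) deriv_antimono[OF hp_Nil] x by blast
    then show False using b \<open>t \<in> X\<close> U(1) by blast
  qed
  have "\<exists>f. \<forall>n. (Bad (f n) \<and> (n = 0 \<longrightarrow> f n = [])) \<and> (\<exists>t. f (Suc n) = f n @ [t])"
  proof (rule dependent_nat_choice)
    show "\<exists>x. Bad x \<and> (0 = 0 \<longrightarrow> x = [])" using contra hp_Nil unfolding Bad_def by auto
    show "\<exists>y. (Bad y \<and> (Suc n = 0 \<longrightarrow> y = [])) \<and> (\<exists>t. y = ws @ [t])" if "Bad ws \<and> (n = 0 \<longrightarrow> ws = [])" for ws n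
      using step[of ws] that by auto
  qed
  then obtain f where f: "f 0 = []" "\<And>n. Bad (f n)" "\<And>n. \<exists>t. f (Suc n) = f n @ [t]" by blast
  define U where "U n = last (f n)" for n
  have fS: "f (Suc n) = f n @ [U (Suc n)]" for n using f(3)[of n] unfolding U_def by auto
  have fU: "map U [1..<Suc n] = f n" for n by (induction n) (simp_all add: f(1) fS)
  have UL: "U (Suc n) \<in> LW" "word_less (U (Suc n)) (U (Suc (Suc n)))" "U (Suc n) \<in> ev W" for n
  proof -
    have L: "f n @ [U (Suc n), U (Suc (Suc n))] \<in> ev_fin W"
      using f(2)[of "Suc (Suc n)"] unfolding Bad_def by (simp add: fS)
    then show "U (Suc n) \<in> LW" "word_less (U (Suc n)) (U (Suc (Suc n)))" "U (Suc n) \<in> ev W"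
      using ev_fin_Lfin[OF L] by (auto simp: Lfin_append Lfin_Cons EV_fin_def)
  qed
  have "refining U W"
    unfolding word_refines_def L_inf_def
  proof (intro conjI CollectI allI impI)
    fix n :: nat assume "1 \<le> n"
    then obtain m where m: "n = Suc m" by (cases n) auto
    show "U n \<in> LW" "word_less (U n) (U (Suc n))" "U n \<in> ev W" unfolding m by (rule UL)+
  qed
  moreover have "branch (hp F) U" unfolding branch_def fU using f(2) unfolding Bad_def by blast
  ultimately show False using no by blast
qed

section \<open>Pointwise closed families\<close>

abbreviation "Fp \<equiv> Fpow (letter_graph \<alpha> \<upsilon> k)"
abbreviation "cantor_space \<equiv> product_topology (\<lambda>_::(nat \<times> 'a) set. discrete_topology {0, 1::nat}) Fp"

definition char_fun :: "'a lword set \<Rightarrow> (nat \<times> 'a) set \<Rightarrow> nat" where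
  "char_fun X = restrict (indicator (Map.graph ` X)) Fp"

lemma pointwise_closed_iff:
  "pointwise_closed \<alpha> \<upsilon> k G \<longleftrightarrow> closedin cantor_space ((\<lambda>ws. char_fun (set ws)) ` G)"
  unfolding pointwise_closed_def char_fun_def ..

lemma graph_inject: "Map.graph w = Map.graph u \<Longrightarrow> w = u"
proof (rule ext)
  fix i assume eq: "Map.graph w = Map.graph u"
  have "w i = Some a \<longleftrightarrow> u i = Some a" for a
    using eq in_graphI in_graphD by metis
  then show "w i = u i" by (metis not_Some_eq)
qed

lemma graph_Fp: assumes w: "w \<in> LW" shows "Map.graph w \<in> Fp"
proof -
  have "(n, a) \<in> letter_graph \<alpha> \<upsilon> k" if "(n, a) \<in> Map.graph w" for n a
  proof -
    have "w n = Some a" using that by (rule in_graphD)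
    moreover from this have "n \<in> dom w" by blast
    then have "the (w n) \<in> {\<upsilon>} \<union> \<alpha> ` {1..k n}" "n \<ge> 1" using w by (auto simp: located_words_def)
    ultimately show ?thesis unfolding letter_graph_def by simp
  qed
  then show ?thesis unfolding Fpow_def using LW_dom[OF w] by auto
qed

lemma char_fun_topspace: "char_fun X \<in> topspace cantor_space"
  unfolding char_fun_def by (auto simp: indicator_def)

lemma char_fun_graph: "w \<in> LW \<Longrightarrow> char_fun X (Map.graph w) = 1 \<longleftrightarrow> w \<in> X"
  unfolding char_fun_def using graph_Fp[of w] graph_inject by (auto simp: indicator_def)

lemma Linf_map_Lfin: "U \<in> Linf \<Longrightarrow> map U [1..<Suc n] \<in> Lfin"
  using Linf_wseq[of U] unfolding wseq_def L_fin_def by (auto simp: sorted_wrt_map sorted_wrt_iff_nth_less simp del: upt_Suc)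

text \<open>The characteristic functions of the initial segments converge to that of the infinite
  set of all terms, which no finite tuple can realise.\<close>

lemma closed_no_branch:
  assumes G: "pointwise_closed \<alpha> \<upsilon> k G" and U: "U \<in> Linf"
  shows "\<not> branch G U"
proof
  assume br: "branch G U"
  have W: "wseq {1..} U" using U by (rule Linf_wseq)
  have ULW: "U n \<in> LW" if "1 \<le> n" for n using wseq_LW[OF W] that by simp
  have "limitin cantor_space (\<lambda>n. char_fun (set (map U [1..<Suc n]))) (char_fun (U ` {1..})) sequentially"
    unfolding limitin_componentwise
  proof (intro conjI ballI)
    show "char_fun (U ` {1..}) \<in> extensional Fp" unfolding char_fun_def by simp
    show "\<forall>\<^sub>F n in sequentially. char_fun (set (map U [1..<Suc n])) \<in> topspace cantor_space"
      using char_fun_topspace by simp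
    fix i assume i: "i \<in> Fp"
    show "limitin (discrete_topology {0, 1}) (\<lambda>n. char_fun (set (map U [1..<Suc n])) i)
        (char_fun (U ` {1..}) i) sequentially"
    proof (rule limitin_eventually)
      show "char_fun (U ` {1..}) i \<in> topspace (discrete_topology {0, 1})"
        using i unfolding char_fun_def by (auto simp: indicator_def)
      show "\<forall>\<^sub>F n in sequentially. char_fun (set (map U [1..<Suc n])) i = char_fun (U ` {1..}) i"
      proof (cases "i \<in> Map.graph ` U ` {1..}")
        case True
        then obtain m where m: "1 \<le> m" "i = Map.graph (U m)" by auto
        have "char_fun (set (map U [1..<Suc n])) i = char_fun (U ` {1..}) i" if "m \<le> n" for n
        proof -
          have "U m \<in> set (map U [1..<Suc n])" using m(1) that by (auto simp del: upt_Suc)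
          then show ?thesis using True i m(2) unfolding char_fun_def by (auto simp: indicator_def)
        qed
        then show ?thesis unfolding eventually_sequentially by blast
      next
        case False
        have "i \<notin> Map.graph ` set (map U [1..<Suc n])" for n
        proof
          assume "i \<in> Map.graph ` set (map U [1..<Suc n])"
          moreover have "set (map U [1..<Suc n]) \<subseteq> U ` {1..}" by auto
          ultimately show False using False by blast
        qed
        then have "char_fun (set (map U [1..<Suc n])) i = char_fun (U ` {1..}) i" for n
          using i False unfolding char_fun_def by (simp add: indicator_def del: set_map)
        then show ?thesis by simp
      qed
    qed
  qed
  moreover have "\<forall>\<^sub>F n in sequentially. char_fun (set (map U [1..<Suc n])) \<in> (\<lambda>ws. char_fun (set ws)) ` G"
    using br unfolding branch_def by (intro always_eventually allI imageI) blast
  ultimately have "char_fun (U ` {1..}) \<in> (\<lambda>ws. char_fun (set ws)) ` G"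
    using limitin_closedin[OF _ G[unfolded pointwise_closed_iff]] trivial_limit_sequentially by blast
  then obtain ws where ws: "char_fun (U ` {1..}) = char_fun (set ws)" by blast
  have "U n \<in> set ws" if "1 \<le> n" for n
    using char_fun_graph[OF ULW[OF that], of "U ` {1..}"] char_fun_graph[OF ULW[OF that], of "set ws"] ws that
    by simp
  then have "finite (U ` {1..})" by (meson List.finite_set atLeast_iff finite_subset image_subsetI)
  moreover have "inj_on U {1..}"
  proof (rule linorder_inj_onI)
    fix m n :: nat assume "m < n" "m \<in> {1..}" "n \<in> {1..}"
    then show "U m \<noteq> U n" using W word_less_irrefl[OF ULW[of n]] unfolding wseq_def by force
  qed auto
  ultimately have "finite {1::nat..}" using finite_imageD by blast
  then show False using infinite_Ici by blast
qed

text \<open>A limit point \<open>f\<close> missing from the family determines the set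
  \<open>X\<close> of words at which it is 1, and finite parts of \<open>X\<close> are covered by
  members of \<open>G\<close>. Once \<open>X\<close> is infinite, its words ordered by their minima
  form the branch, by closure of the hereditary part under subtuples.\<close>

lemma not_closed_branch:
  assumes F: "F \<subseteq> Lfin" "is_tree F" and W: "W \<in> Linf"
    and nc: "\<not> pointwise_closed \<alpha> \<upsilon> k (hp F \<inter> ev_fin W)"
  shows "\<exists>U. refining U W \<and> branch (hp F) U"
proof -
  define G where "G = hp F \<inter> ev_fin W"
  have "(\<lambda>ws. char_fun (set ws)) ` G \<subseteq> topspace cantor_space" using char_fun_topspace by blast
  then obtain f where f: "f \<in> cantor_space closure_of ((\<lambda>ws. char_fun (set ws)) ` G)"
      "f \<notin> (\<lambda>ws. char_fun (set ws)) ` G"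
    using nc closure_of_subset_eq[of "(\<lambda>ws. char_fun (set ws)) ` G" cantor_space]
    unfolding pointwise_closed_iff G_def by blast
  have fT: "f \<in> topspace cantor_space" using f(1) unfolding in_closure_of by blast
  have f01: "f i \<in> {0, 1}" if "i \<in> Fp" for i using fT that by auto
  have approx: "\<exists>ws\<in>G. \<forall>i\<in>K. char_fun (set ws) i = f i" if K: "finite K" "K \<subseteq> Fp" for K
  proof -
    define V where "V i = (if i \<in> K then {f i} else {0, 1})" for i
    have "openin cantor_space (\<Pi>\<^sub>E i\<in>Fp. V i)"
    proof (rule product_topology_basis)
      show "openin (discrete_topology {0, 1}) (V i)" for i using f01[of i] K(2) unfolding V_def by auto
      have "{i. V i \<noteq> topspace (discrete_topology {0, 1})} \<subseteq> K" unfolding V_def by auto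
      then show "finite {i. V i \<noteq> topspace (discrete_topology {0, 1})}" using K(1) by (rule finite_subset)
    qed
    moreover have "f \<in> (\<Pi>\<^sub>E i\<in>Fp. V i)" using fT f01 unfolding V_def by (auto simp: PiE_iff)
    ultimately obtain g where g: "g \<in> (\<lambda>ws. char_fun (set ws)) ` G" "g \<in> (\<Pi>\<^sub>E i\<in>Fp. V i)"
      using f(1) unfolding in_closure_of by blast
    have "g i = f i" if "i \<in> K" for i
    proof -
      have "g i \<in> V i" using g(2) that K(2) by (auto simp: PiE_iff)
      then show ?thesis using that unfolding V_def by simp
    qed
    then show ?thesis using g(1) by blast
  qed
  define X where "X = {x \<in> LW. f (Map.graph x) = 1}"
  have GL: "ws \<in> Lfin" "set ws \<subseteq> LW" "ws \<in> hp F" "set ws \<subseteq> ev W" if "ws \<in> G" for ws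
    using that unfolding G_def EV_fin_def L_fin_def by auto
  have cover: "\<exists>ws\<in>G. Y \<subseteq> set ws" if Y: "finite Y" "Y \<subseteq> X" for Y
  proof -
    have YLW: "Y \<subseteq> LW" using Y(2) unfolding X_def by blast
    have "Map.graph ` Y \<subseteq> Fp" using YLW graph_Fp by blast
    from approx[OF finite_imageI[OF Y(1)] this] obtain ws where ws: "ws \<in> G"
      "\<forall>i\<in>Map.graph ` Y. char_fun (set ws) i = f i" by blast
    have "y \<in> set ws" if y: "y \<in> Y" for y
    proof -
      have "char_fun (set ws) (Map.graph y) = f (Map.graph y)" using ws(2) y by blast
      then show ?thesis using y Y(2) YLW char_fun_graph[of y "set ws"] unfolding X_def by auto
    qed
    then show ?thesis using ws(1) by blast
  qed
  \<comment> \<open>If \<open>X\<close> were finite, the words of \<open>X\<close> in a covering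
    member would form a tuple of \<open>G\<close> whose characteristic function is
    \<open>f\<close>.\<close>
  have infX: "infinite X"
  proof
    assume fin: "finite X"
    from cover[OF fin] obtain ws where ws: "ws \<in> G" "X \<subseteq> set ws" by blast
    define vs where "vs = filter (\<lambda>x. x \<in> X) ws"
    have vsX: "set vs = X" using ws(2) unfolding vs_def by auto
    have "vs \<in> Lfin" using GL(1)[OF ws(1)] unfolding vs_def L_fin_def by (auto simp: sorted_wrt_filter)
    then have "vs \<in> G"
      using hp_subset_tuple[OF F GL(3)[OF ws(1)], of vs] ws vsX GL(4)[OF ws(1)] unfolding G_def EV_fin_def by auto
    moreover have "char_fun (set vs) = f"
    proof
      fix i
      show "char_fun (set vs) i = f i"
      proof (cases "i \<in> Fp")
        case True
        show ?thesis
        proof (cases "f i = 1")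
          case f1: True
          \<comment> \<open>A coordinate where \<open>f\<close> is 1 must be the graph of a located
            word, because some member of \<open>G\<close> agrees with \<open>f\<close>
            there.\<close>
          obtain us where us: "us \<in> G" "char_fun (set us) i = f i" using approx[of "{i}"] True by auto
          then have "indicator (Map.graph ` set us) i = (1::nat)"
            using f1 True unfolding char_fun_def by simp
          then have "i \<in> Map.graph ` set us" by (simp only: indicator_eq_1_iff)
          then obtain x where "x \<in> LW" "i = Map.graph x" using GL(2)[OF us(1)] by blast
          then have "x \<in> X" using f1 unfolding X_def by simp
          then show ?thesis using \<open>i = _\<close> char_fun_graph[OF \<open>x \<in> LW\<close>, of X] vsX f1 by simp
        next
          case False
          then have "i \<notin> Map.graph ` X" unfolding X_def by auto
          then show ?thesis using f01[OF True] False vsX True unfolding char_fun_def by auto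
        qed
      next
        case False
        then show ?thesis using fT unfolding char_fun_def by (auto simp: PiE_iff extensional_def)
      qed
    qed
    ultimately show False using f(2) by blast
  qed
  have comparable: "word_less x y \<or> word_less y x" if "x \<in> X" "y \<in> X" "x \<noteq> y" for x y
  proof -
    obtain ws where ws: "ws \<in> G" "x \<in> set ws" "y \<in> set ws" using cover[of "{x, y}"] \<open>x \<in> X\<close> \<open>y \<in> X\<close> by auto
    obtain i j where "x = ws ! i" "y = ws ! j" "i < length ws" "j < length ws"
      using ws(2,3) by (metis in_set_conv_nth)
    then show ?thesis
      using GL(1)[OF ws(1)] \<open>x \<noteq> y\<close> unfolding L_fin_def sorted_wrt_iff_nth_less
      by (metis (lifting) mem_Collect_eq linorder_neqE_nat)
  qed
  define m where "m x = Min (dom x)" for x :: "'a lword"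
  have XLW: "x \<in> LW" if "x \<in> X" for x using that unfolding X_def by blast
  have mless: "m x < m y" if "x \<in> X" "y \<in> X" "word_less x y" for x y
  proof -
    have "Min (dom x) \<in> dom x" "Min (dom y) \<in> dom y"
      using LW_dom XLW that(1,2) by (meson Min_in)+
    then show ?thesis using word_less_iff[of x y] XLW that unfolding m_def by blast
  qed
  have inj: "inj_on m X"
  proof (rule inj_onI)
    fix x y assume "x \<in> X" "y \<in> X" "m x = m y"
    then show "x = y" using comparable[of x y] mless[of x y] mless[of y x] by auto
  qed
  then have infM: "infinite (m ` X)" using infX finite_imageD by blast
  \<comment> \<open>\<open>enumerate\<close> counts from 0, sequences of words from 1.\<close>
  define U where "U n = inv_into X m (enumerate (m ` X) (n - 1))" for n
  have UX: "U n \<in> X" "m (U n) = enumerate (m ` X) (n - 1)" for n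
    unfolding U_def using inv_into_into[OF enumerate_in_set[OF infM]] f_inv_into_f[OF enumerate_in_set[OF infM]]
    by blast+
  have UL: "U \<in> Linf"
    unfolding L_inf_def
  proof (intro CollectI allI impI conjI)
    fix n :: nat assume n: "1 \<le> n"
    show "U n \<in> LW" using UX XLW by blast
    have "n - 1 < Suc n - 1" using n by simp
    from enumerate_mono[OF this infM] have lt: "m (U n) < m (U (Suc n))" using UX(2) by simp
    then have "U n \<noteq> U (Suc n)" by auto
    then show "word_less (U n) (U (Suc n))"
      using comparable[OF UX(1) UX(1)] mless[OF UX(1) UX(1)] lt by (meson less_asym)
  qed
  have Xev: "x \<in> ev W" if x: "x \<in> X" for x
  proof -
    obtain ws where "ws \<in> G" "x \<in> set ws" using cover[of "{x}"] x by auto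
    then show ?thesis using GL(4) by blast
  qed
  have "refining U W" unfolding word_refines_def using UL UX(1) Xev by blast
  moreover have "branch (hp F) U"
    unfolding branch_def
  proof
    fix n
    have "set (map U [1..<Suc n]) \<subseteq> X" using UX(1) by auto
    then obtain ws where ws: "ws \<in> G" "set (map U [1..<Suc n]) \<subseteq> set ws"
      using cover[of "set (map U [1..<Suc n])"] by blast
    show "map U [1..<Suc n] \<in> hp F"
      by (rule hp_subset_tuple[OF F GL(3)[OF ws(1)] Linf_map_Lfin[OF UL] ws(2)])
  qed
  ultimately show ?thesis by blast
qed

section \<open>Members of \<open>L\<^sup>\<xi>\<close> in the tree and the values of the
  index\<close>

lemma L_xi_eq: "L_xi fs \<alpha> \<upsilon> k x = {ws \<in> Lfin. mem x (mins ws)}"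
proof (cases "x = 0")
  case True
  then show ?thesis unfolding L_xi_def by (auto simp: mem_0_mins)
next
  case False
  then show ?thesis unfolding L_xi_def schreier_def mins_def by simp
qed

text \<open>Supplies the second form of the conclusion of case 2 (ii): by \<open>front\<close> a
  tuple of \<open>F\<close> is comparable with a member of \<open>L\<^sup>x\<close>, and it cannot
  extend one, because the tree would then contain that member.\<close>

lemma not_mem_tree:
  assumes F: "is_tree F" and U: "U \<in> Linf" and no: "\<forall>ws\<in>ev_fin U. mem x (mins ws) \<longrightarrow> ws \<notin> F"
  shows "F \<inter> ev_fin U \<subseteq> initial_segments (L_xi fs \<alpha> \<upsilon> k x) - L_xi fs \<alpha> \<upsilon> k x"
proof
  fix ws assume ws: "ws \<in> F \<inter> ev_fin U"
  then obtain u where u: "prefix u ws \<or> prefix ws u" "u \<in> ev_fin U" "mem x (mins u)"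
    using front[OF U, of "[]" ws x] by auto
  have "\<not> prefix u ws" using tree_prefix[OF F] ws no u(2,3) by blast
  then have "prefix ws u" using u(1) by blast
  then have "ws \<in> initial_segments (L_xi fs \<alpha> \<upsilon> k x)"
    unfolding initial_segments_def L_xi_eq using u(2,3) ev_fin_Lfin by blast
  moreover have "ws \<notin> L_xi fs \<alpha> \<upsilon> k x" unfolding L_xi_eq using ws no by blast
  ultimately show "ws \<in> initial_segments (L_xi fs \<alpha> \<upsilon> k x) - L_xi fs \<alpha> \<upsilon> k x" by blast
qed

text \<open>A member of \<open>L\<^sup>\<xi>\<close> of minimal length works: no tuple extracted from it can properly extend
  another member.\<close>

lemma mem_hp_exists:
  assumes F: "F \<subseteq> Lfin" "is_tree F" and U: "U \<in> Linf"
    and all: "\<forall>ws\<in>ev_fin U. mem x (mins ws) \<longrightarrow> ws \<in> F"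
  shows "\<exists>ws\<in>ev_fin U. mem x (mins ws) \<and> ws \<in> hp F"
proof -
  have "\<exists>ws. ws \<in> ev_fin U \<and> mem x (mins ws)" using front[OF U, of "[]" "[]" x] by auto
  then obtain ws where ws: "ws \<in> ev_fin U" "mem x (mins ws)"
    and min: "\<And>vs. vs \<in> ev_fin U \<Longrightarrow> mem x (mins vs) \<Longrightarrow> length ws \<le> length vs"
    using ex_has_least_nat[of "\<lambda>ws. ws \<in> ev_fin U \<and> mem x (mins ws)" _ length] by blast
  have wsL: "ws \<in> Lfin" using ws(1) by (rule ev_fin_Lfin)
  have "vs \<in> F" if vs: "vs \<in> ev_fin_tuple ws" for vs
  proof -
    have vsU: "vs \<in> ev_fin U" using vs EV_tuple_EV[OF ws(1) U] unfolding EV_fin_tuple_def EV_fin_def by blast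
    then obtain u where u: "prefix u vs \<or> prefix vs u" "u \<in> ev_fin U" "mem x (mins u)"
      using front[OF U, of "[]" vs x] by auto
    have uF: "u \<in> F" using all u(2,3) by blast
    have "prefix vs u"
    proof (rule ccontr)
      assume "\<not> prefix vs u"
      then have "prefix u vs" "u \<noteq> vs" using u(1) by auto
      then have "length u < length vs" by (simp add: prefix_length_less strict_prefix_def)
      then show False using min[OF u(2,3)] EV_fin_tuple_length[OF wsL vs] by simp
    qed
    then show ?thesis using tree_prefix[OF F(2) uF] by blast
  qed
  then have "ws \<in> hp F" unfolding hered_part_def using all ws by blast
  then show ?thesis using ws by blast
qed

lemma sO_bounds:
  assumes F: "F \<subseteq> Lfin" "is_tree F" and x: "[] \<notin> deriv x U (hp F)"
  shows "sO_defined \<alpha> \<upsilon> k U (hp F)" "sO \<alpha> \<upsilon> k U (hp F) \<le> x"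
proof -
  have "x \<noteq> 0" using x hp_Nil[of F] by auto
  then have "1 \<le> x \<and> deriv x U (hp F) = {}"
    using deriv_nonempty_iff[OF hp_subseq_closed[OF F]] x one_le_iff_omega1 by blast
  then show "sO_defined \<alpha> \<upsilon> k U (hp F)" "sO \<alpha> \<upsilon> k U (hp F) \<le> x"
    unfolding sO_defined_def sO_def by (auto intro: Least_le)
qed

lemma sO_less_iff:
  assumes F: "F \<subseteq> Lfin" "is_tree F" and def: "sO_defined \<alpha> \<upsilon> k U (hp F)"
  shows "x < sO \<alpha> \<upsilon> k U (hp F) \<longleftrightarrow> [] \<in> deriv x U (hp F)"
proof
  assume "x < sO \<alpha> \<upsilon> k U (hp F)"
  then show "[] \<in> deriv x U (hp F)" using sO_bounds(2)[OF F] by (meson not_le)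
next
  assume mem: "[] \<in> deriv x U (hp F)"
  have "deriv (sO \<alpha> \<upsilon> k U (hp F)) U (hp F) = {}"
    using LeastI_ex[OF def[unfolded sO_defined_def]] unfolding sO_def by blast
  then show "x < sO \<alpha> \<upsilon> k U (hp F)"
    using mem deriv_antimono[OF hp_Nil[of F], of "sO \<alpha> \<upsilon> k U (hp F)" x U] by (metis empty_iff not_le subsetD)
qed

end

theorem theorem3p12:
  fixes \<alpha> :: "nat \<Rightarrow> 'a" and \<Sigma> :: "'a set" and \<upsilon> :: 'a and k :: "nat \<Rightarrow> nat"
    and F :: "'a lword list set" and W :: "nat \<Rightarrow> 'a lword"
    and fs :: "omega1 \<Rightarrow> nat \<Rightarrow> omega1"
  assumes "bij_betw \<alpha> {1..} \<Sigma>" and "\<upsilon> \<notin> \<Sigma>"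
    and "\<forall>n\<ge>1. k n \<ge> 1" and "mono_on {1..} k"
    and "fundamental_sequences fs"
    and "F \<subseteq> L_fin \<alpha> \<upsilon> k" and "is_tree F"
    and "W \<in> L_inf \<alpha> \<upsilon> k"
  shows
    "(\<not> pointwise_closed \<alpha> \<upsilon> k (hered_part \<alpha> \<upsilon> k F \<inter> EV_fin \<alpha> \<upsilon> k W) \<longrightarrow>
        (\<exists>U. word_refines \<alpha> \<upsilon> k U W \<and> EV_fin \<alpha> \<upsilon> k U \<subseteq> F)) \<and>
     (pointwise_closed \<alpha> \<upsilon> k (hered_part \<alpha> \<upsilon> k F \<inter> EV_fin \<alpha> \<upsilon> k W) \<longrightarrow>
        (\<forall>U. word_refines \<alpha> \<upsilon> k U W \<longrightarrow> sO_defined \<alpha> \<upsilon> k U (hered_part \<alpha> \<upsilon> k F)) \<and>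
        bdd_above {sO \<alpha> \<upsilon> k U (hered_part \<alpha> \<upsilon> k F) | U. word_refines \<alpha> \<upsilon> k U W} \<and>
        (\<forall>\<zeta> \<xi>. \<zeta> = Sup {sO \<alpha> \<upsilon> k U (hered_part \<alpha> \<upsilon> k F) | U. word_refines \<alpha> \<upsilon> k U W} \<longrightarrow>
          (osucc \<xi> < \<zeta> \<longrightarrow>
             (\<exists>U. word_refines \<alpha> \<upsilon> k U W \<and> L_xi fs \<alpha> \<upsilon> k \<xi> \<inter> EV_fin \<alpha> \<upsilon> k U \<subseteq> F)) \<and>
          (\<xi> > \<zeta> \<longrightarrow>
             (\<forall>W1. word_refines \<alpha> \<upsilon> k W1 W \<longrightarrow>
               (\<exists>U. word_refines \<alpha> \<upsilon> k U W1 \<and>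
                  L_xi fs \<alpha> \<upsilon> k \<xi> \<inter> EV_fin \<alpha> \<upsilon> k U \<subseteq> L_fin \<alpha> \<upsilon> k - F \<and>
                  F \<inter> EV_fin \<alpha> \<upsilon> k U \<subseteq>
                    initial_segments (L_xi fs \<alpha> \<upsilon> k \<xi>) - L_xi fs \<alpha> \<upsilon> k \<xi>))) \<and>
          (osucc \<xi> = \<zeta> \<or> \<xi> = \<zeta> \<longrightarrow>
             (\<exists>U. word_refines \<alpha> \<upsilon> k U W \<and>
                (L_xi fs \<alpha> \<upsilon> k \<xi> \<inter> EV_fin \<alpha> \<upsilon> k U \<subseteq> F \<or>
                 L_xi fs \<alpha> \<upsilon> k \<xi> \<inter> EV_fin \<alpha> \<upsilon> k U \<subseteq> L_fin \<alpha> \<upsilon> k - F)))))"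
proof -
  interpret schreier_words \<alpha> \<upsilon> k fs
  proof
    show "\<alpha> i \<noteq> \<upsilon>" if "i \<ge> 1" for i
    proof -
      have "\<alpha> i \<in> \<Sigma>" using assms(1) that unfolding bij_betw_def by auto
      then show ?thesis using assms(2) by auto
    qed
    show "k m \<le> k n" if "1 \<le> m" "m \<le> n" for m n
      using mono_onD[OF assms(4), of m n] that by simp
  qed (use assms(3,5) in auto)
  note F = assms(6,7) and W = assms(8)
  let ?H = "hered_part \<alpha> \<upsilon> k F"
  let ?S = "{sO \<alpha> \<upsilon> k U ?H | U. refining U W}"
  have L: "L_xi fs \<alpha> \<upsilon> k x \<inter> ev_fin U = {ws \<in> ev_fin U. mem x (mins ws)}" for x U
    unfolding L_xi_eq using ev_fin_Lfin by blast
  have case1: "\<exists>U. refining U W \<and> ev_fin U \<subseteq> F" if "\<not> pointwise_closed \<alpha> \<upsilon> k (?H \<inter> ev_fin W)"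
    using not_closed_branch[OF F W that] branch_ev_fin[OF F] by blast
  have dich: "\<exists>U. refining U W \<and> (L_xi fs \<alpha> \<upsilon> k \<xi> \<inter> ev_fin U \<subseteq> F \<or>
      L_xi fs \<alpha> \<upsilon> k \<xi> \<inter> ev_fin U \<subseteq> Lfin - F)" for \<xi>
    unfolding L using schreier_dichotomy[OF W, of \<xi> F] ev_fin_Lfin by blast
  {
    assume cl: "pointwise_closed \<alpha> \<upsilon> k (?H \<inter> ev_fin W)"
    have "\<not> branch ?H U" if U: "refining U W" for U
    proof
      assume "branch ?H U"
      moreover have "map U [1..<Suc n] \<in> ev_fin W" for n
        using Linf_map_Lfin[OF refines_Linf[OF U]] U unfolding EV_fin_def word_refines_def by auto
      ultimately have "branch (?H \<inter> ev_fin W) U" unfolding branch_def by blast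
      then show False using closed_no_branch[OF cl refines_Linf[OF U]] by blast
    qed
    from no_branch_bound[OF F W this] obtain b where b: "\<And>U. refining U W \<Longrightarrow> [] \<notin> deriv b U ?H" by blast
    have def: "sO_defined \<alpha> \<upsilon> k U ?H" if "refining U W" for U using sO_bounds(1)[OF F b[OF that]] .
    have bdd: "bdd_above ?S" unfolding bdd_above_def using sO_bounds(2)[OF F b] by blast
    have ne: "?S \<noteq> {}" using refines_refl[OF W] by blast
    have upper: "\<exists>U. refining U W \<and> L_xi fs \<alpha> \<upsilon> k \<xi> \<inter> ev_fin U \<subseteq> F" if \<xi>: "osucc \<xi> < Sup ?S" for \<xi>
    proof -
      obtain U where U: "refining U W" "osucc \<xi> < sO \<alpha> \<upsilon> k U ?H"
        using \<xi> less_cSup_iff[OF ne bdd] by blast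
      then have memU: "[] \<in> deriv (osucc \<xi>) U ?H" using sO_less_iff[OF F def] by blast
      have UL: "U \<in> Linf" using U(1) by (rule refines_Linf)
      \<comment> \<open>The alternative is decided over \<open>V\<close>, so the survival of
        \<open>[]\<close> is transferred from \<open>U\<close> to \<open>V\<close>; there it yields
        one member of \<open>L\<^sup>\<xi>\<close> in \<open>F\<close>, which refutes the negative
        alternative.\<close>
      obtain V where V: "refining V U" "(\<forall>ws\<in>ev_fin V. mem \<xi> (mins ws) \<longrightarrow> ws \<in> F) \<or>
          (\<forall>ws\<in>ev_fin V. mem \<xi> (mins ws) \<longrightarrow> ws \<notin> F)"
        using schreier_dichotomy[OF UL] by blast
      have HL: "?H \<subseteq> Lfin" using hp_subset[OF F(2)] F(1) by blast
      have "[] \<in> deriv (osucc \<xi>) V ?H" using deriv_refines[OF HL hp_Nil UL V(1), where x = "osucc \<xi>"] memU ev_fin_Nil by blast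
      from deriv_osucc_extension[OF refines_Linf[OF V(1)] HL hp_Nil this] obtain vs
        where "vs \<in> ?H" "vs \<in> ev_fin V" "mem \<xi> (mins vs)" by auto
      then have "\<forall>ws\<in>ev_fin V. mem \<xi> (mins ws) \<longrightarrow> ws \<in> F" using V(2) hp_subset[OF F(2)] by blast
      then show ?thesis unfolding L using refines_trans[OF V(1) U(1) W] by blast
    qed
    have lower: "\<exists>U. refining U W1 \<and> L_xi fs \<alpha> \<upsilon> k \<xi> \<inter> ev_fin U \<subseteq> Lfin - F \<and>
        F \<inter> ev_fin U \<subseteq> initial_segments (L_xi fs \<alpha> \<upsilon> k \<xi>) - L_xi fs \<alpha> \<upsilon> k \<xi>"
      if \<xi>: "\<xi> > Sup ?S" and W1: "refining W1 W" for \<xi> W1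
    proof -
      obtain U where U: "refining U W1" "(\<forall>ws\<in>ev_fin U. mem \<xi> (mins ws) \<longrightarrow> ws \<in> F) \<or>
          (\<forall>ws\<in>ev_fin U. mem \<xi> (mins ws) \<longrightarrow> ws \<notin> F)"
        using schreier_dichotomy[OF refines_Linf[OF W1]] by blast
      have UL: "U \<in> Linf" using U(1) by (rule refines_Linf)
      have "\<not> (\<forall>ws\<in>ev_fin U. mem \<xi> (mins ws) \<longrightarrow> ws \<in> F)"
      proof
        assume all: "\<forall>ws\<in>ev_fin U. mem \<xi> (mins ws) \<longrightarrow> ws \<in> F"
        \<comment> \<open>\<open>deriv_lower\<close> needs all of \<open>L\<^sup>\<xi>\<close>
          inside \<open>?H\<close>, while so far only \<open>F\<close> contains it. The dichotomy
          for \<open>?H\<close> is decided positively by the single member that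
          \<open>mem_hp_exists\<close> provides.\<close>
        obtain V where V: "refining V U" "(\<forall>ws\<in>ev_fin V. mem \<xi> (mins ws) \<longrightarrow> ws \<in> ?H) \<or>
            (\<forall>ws\<in>ev_fin V. mem \<xi> (mins ws) \<longrightarrow> ws \<notin> ?H)"
          using schreier_dichotomy[OF UL] by blast
        have VL: "V \<in> Linf" using V(1) by (rule refines_Linf)
        have VW: "refining V W"
          using refines_trans[OF V(1) refines_trans[OF U(1) W1 W] W] .
        have "\<forall>ws\<in>ev_fin V. mem \<xi> (mins ws) \<longrightarrow> ws \<in> F"
          using all EV_fin_mono[OF refines_EV[OF V(1) UL]] by blast
        then have "\<forall>ws\<in>ev_fin V. mem \<xi> (mins ws) \<longrightarrow> ws \<in> ?H"
          using mem_hp_exists[OF F VL] V(2) by blast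
        then have "[] \<in> deriv \<xi> V ?H"
          by (intro deriv_lower[OF VL hp_subseq_closed[OF F] hp_Nil]) auto
        then have "\<xi> < sO \<alpha> \<upsilon> k V ?H" using sO_less_iff[OF F def[OF VW]] by blast
        also have "\<dots> \<le> Sup ?S" using VW by (intro cSup_upper bdd) blast
        finally show False using \<xi> by simp
      qed
      then have no: "\<forall>ws\<in>ev_fin U. mem \<xi> (mins ws) \<longrightarrow> ws \<notin> F" using U(2) by blast
      then have "L_xi fs \<alpha> \<upsilon> k \<xi> \<inter> ev_fin U \<subseteq> Lfin - F" unfolding L using ev_fin_Lfin by blast
      then show ?thesis using U(1) not_mem_tree[OF F(2) UL no] by blast
    qed
    note def bdd upper lower
  }
  note closed = this
  show ?thesis
  proof (intro conjI impI allI)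
    fix \<zeta> \<xi>
    assume cl: "pointwise_closed \<alpha> \<upsilon> k (?H \<inter> ev_fin W)" and \<zeta>: "\<zeta> = Sup ?S"
    show "\<exists>U. refining U W \<and> L_xi fs \<alpha> \<upsilon> k \<xi> \<inter> ev_fin U \<subseteq> F" if "osucc \<xi> < \<zeta>"
      using that unfolding \<zeta> by (rule closed(3)[OF cl])
    show "\<exists>U. refining U W1 \<and> L_xi fs \<alpha> \<upsilon> k \<xi> \<inter> ev_fin U \<subseteq> Lfin - F \<and>
        F \<inter> ev_fin U \<subseteq> initial_segments (L_xi fs \<alpha> \<upsilon> k \<xi>) - L_xi fs \<alpha> \<upsilon> k \<xi>"
      if "\<zeta> < \<xi>" "refining W1 W" for W1
      using that unfolding \<zeta> by (rule closed(4)[OF cl])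
    show "\<exists>U. refining U W \<and> (L_xi fs \<alpha> \<upsilon> k \<xi> \<inter> ev_fin U \<subseteq> F \<or>
        L_xi fs \<alpha> \<upsilon> k \<xi> \<inter> ev_fin U \<subseteq> Lfin - F)" by (rule dich)
  qed (fact case1 closed(1) closed(2))+
qed

end
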